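(* Let $T$ be a complete first-order theory with monster model $\mathcal U$, and let $\phi(x,y)$ be a formula. The following are equivalent: (i) $\phi(x,y)$ has $NIP$ (for $T$). (ii) For every global Keisler $\phi$-measure $\mu(x)\in\mathfrak M_\phi(\mathcal U)$ and every countable model $M\models T$, if $\mu$ is finitely satisfiable in $M$, then $\mu$ is Baire-1/2 definable over $M$. (iii) For every global $\phi$-type $p(x)\in S_\phi(\mathcal U)$ and every countable model $M\models T$, if $p$ is finitely satisfiable in $M$, then $p$ is strongly Borel definable over $M$.
   Context: A formula $\phi(x,y)$ has $NIP$ (for $T$) if there are no $(a_i)_{i<\omega}$ and $(b_E)_{E\subseteq\omega}$ in $\mathcal U$ with $\models\phi(a_i,b_E)\iff i\in E$. Write $\tilde\phi(y,x)=\phi(x,y)$. A global $\phi$-type is a complete consistent collection of Boolean combinations of instances $\phi(x,b)$, $b\in\mathcal U$; $S_\phi(\mathcal U)$ is the space of these. A global Keisler $\phi$-measure is a finitely additive probability measure on the Boolean algebra of Boolean combinations of instances $\phi(x,b)$, $b\in\mathcal U$. A $\phi$-type (resp. $\phi$-measure) is finitely satisfiable in $M$ if every formula in it (resp. every formula of positive measure) is satisfied by some element of $M$. For a model $M$, $S_{\tilde\phi}(M)$ is the Stone space of complete $\tilde\phi$-types over $M$ (in the variable $y$); for countable $M$ it is a compact metrizable space. For $q\in S_{\tilde\phi}(M)$ and $b\models q$: if $p$ is finitely satisfiable in $M$, whether $\phi(x,b)\in p$ depends only on $q$; if $\mu$ is finitely satisfiable in $M$, $\mu(\phi(x,b))$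 depends only on $q$. On a compact metric space $X$: a function $f:X\to\mathbb R$ is $DBSC$ if there are continuous $f_n$ ($f_0=0$) and $C>0$ with $f_n\to f$ pointwise and $\sum_n|f_{n+1}(x)-f_n(x)|\le C$ for all $x$; $f$ is Baire-1/2 if it is a uniform limit of a sequence of $DBSC$ functions. $\mu$ is Baire-1/2 definable over $M$ if the function $S_{\tilde\phi}(M)\to[0,1]$, $q\mapsto\mu(\phi(x,b))$ ($b\models q$), is Baire-1/2. $p$ is strongly Borel definable over $M$ if the set $\{b\in\mathcal U:\phi(x,b)\in p\}$ is a finite Boolean combination of closed sets over $M$ (sets of realizations in $\mathcal U$ of partial types over $M$); equivalently here, the $\{0,1\}$-valued function $q\mapsto[\phi(x,b)\in p]$ on $S_{\tilde\phi}(M)$ is $DBSC$.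
   Formalization: (ii)⇒(i) and (iii)⇒(i) are stated only for a countable language; (i)⇒(ii),(iii) for any. Otherwise false: the random graph with continuum many named distinct vertices has no countable models, so (ii),(iii) hold vacuously, yet the edge relation lacks NIP. *)

theory Defs
  imports "HOL-Analysis.Analysis"
begin

unbundle cardinal_syntax

section \<open>First-order logic with equality\<close>

text \<open>Constants are function symbols of arity 0. Only the symbols in \<open>Funs\<close> and \<open>Rels\<close>
  belong to the language, so languages without function or relation symbols are covered.\<close>

record ('f, 'r) lang =
  Funs :: "'f set"
  Rels :: "'r set"
  farity :: "'f \<Rightarrow> nat"
  rarity :: "'r \<Rightarrow> nat"

datatype 'f trm = Var nat | Fn 'f "'f trm list"

datatype ('f, 'r) fm =
    Eq "'f trm" "'f trm"
  | Rel 'r "'f trm list"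
  | Neg "('f, 'r) fm"
  | Conj "('f, 'r) fm" "('f, 'r) fm"
  | Ex nat "('f, 'r) fm"

primrec tvars :: "'f trm \<Rightarrow> nat set" where
  "tvars (Var v) = {v}"
| "tvars (Fn f ts) = \<Union> (set (map tvars ts))"

primrec fvars :: "('f, 'r) fm \<Rightarrow> nat set" where
  "fvars (Eq s t) = tvars s \<union> tvars t"
| "fvars (Rel r ts) = \<Union> (set (map tvars ts))"
| "fvars (Neg \<psi>) = fvars \<psi>"
| "fvars (Conj \<psi> \<theta>) = fvars \<psi> \<union> fvars \<theta>"
| "fvars (Ex v \<psi>) = fvars \<psi> - {v}"

primrec is_term :: "('f, 'r) lang \<Rightarrow> 'f trm \<Rightarrow> bool" where
  "is_term L (Var v) = True"
| "is_term L (Fn f ts) = (f \<in> Funs L \<and> length ts = farity L f \<and> list_all (is_term L) ts)"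

primrec is_formula :: "('f, 'r) lang \<Rightarrow> ('f, 'r) fm \<Rightarrow> bool" where
  "is_formula L (Eq s t) = (is_term L s \<and> is_term L t)"
| "is_formula L (Rel r ts) = (r \<in> Rels L \<and> length ts = rarity L r \<and> list_all (is_term L) ts)"
| "is_formula L (Neg \<psi>) = is_formula L \<psi>"
| "is_formula L (Conj \<psi> \<theta>) = (is_formula L \<psi> \<and> is_formula L \<theta>)"
| "is_formula L (Ex v \<psi>) = is_formula L \<psi>"

definition sentences :: "('f, 'r) lang \<Rightarrow> ('f, 'r) fm set" where
  "sentences L = {\<sigma>. is_formula L \<sigma> \<and> fvars \<sigma> = {}}"

text \<open>Needed to deduce NIP from properties of countable models: over an uncountable language there
  may be no countable model at all, for instance for the random graph with uncountably many
  distinct named vertices.\<close>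

definition countable_language :: "('f, 'r) lang \<Rightarrow> bool" where
  "countable_language L \<longleftrightarrow> countable (Funs L) \<and> countable (Rels L)"

text \<open>\<open>tuples A n\<close> is the cartesian power \<open>A\<close> to the \<open>n\<close>.\<close>

definition tuples :: "'a set \<Rightarrow> nat \<Rightarrow> 'a list set" where
  "tuples A n = {a. set a \<subseteq> A \<and> length a = n}"

record ('f, 'r, 'a) struc =
  Dom :: "'a set"
  fint :: "'f \<Rightarrow> 'a list \<Rightarrow> 'a"
  rint :: "'r \<Rightarrow> 'a list \<Rightarrow> bool"

definition is_struc :: "('f, 'r) lang \<Rightarrow> ('f, 'r, 'a) struc \<Rightarrow> bool" where
  "is_struc L U \<longleftrightarrow> Dom U \<noteq> {} \<and>
     (\<forall>f\<in>Funs L. \<forall>a\<in>tuples (Dom U) (farity L f). fint U f a \<in> Dom U)"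

primrec tval :: "('f, 'r, 'a) struc \<Rightarrow> (nat \<Rightarrow> 'a) \<Rightarrow> 'f trm \<Rightarrow> 'a" where
  "tval U e (Var v) = e v"
| "tval U e (Fn f ts) = fint U f (map (tval U e) ts)"

primrec sat :: "('f, 'r, 'a) struc \<Rightarrow> (nat \<Rightarrow> 'a) \<Rightarrow> ('f, 'r) fm \<Rightarrow> bool" where
  "sat U e (Eq s t) = (tval U e s = tval U e t)"
| "sat U e (Rel r ts) = rint U r (map (tval U e) ts)"
| "sat U e (Neg \<psi>) = (\<not> sat U e \<psi>)"
| "sat U e (Conj \<psi> \<theta>) = (sat U e \<psi> \<and> sat U e \<theta>)"
| "sat U e (Ex v \<psi>) = (\<exists>a\<in>Dom U. sat U (e(v := a)) \<psi>)"

definition models :: "('f, 'r) lang \<Rightarrow> ('f, 'r, 'a) struc \<Rightarrow> ('f, 'r) fm set \<Rightarrow> bool" where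
  "models L U T \<longleftrightarrow> is_struc L U \<and> (\<forall>\<sigma>\<in>T. \<forall>e. range e \<subseteq> Dom U \<longrightarrow> sat U e \<sigma>)"

text \<open>A satisfiable set of \<open>L\<close>-sentences has a model of cardinality at most \<open>|L| + \<aleph>\<^sub>0\<close>
  (downward Loewenheim-Skolem), and the type \<open>('f, 'r) fm\<close> is at least that large. Hence
  satisfiability and semantic consequence are decided by the models with domain in that type.\<close>

definition satisfiable :: "('f, 'r) lang \<Rightarrow> ('f, 'r) fm set \<Rightarrow> bool" where
  "satisfiable L T \<longleftrightarrow> (\<exists>N :: ('f, 'r, ('f, 'r) fm) struc. models L N T)"

definition entails :: "('f, 'r) lang \<Rightarrow> ('f, 'r) fm set \<Rightarrow> ('f, 'r) fm \<Rightarrow> bool" where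
  "entails L T \<sigma> \<longleftrightarrow> (\<forall>N :: ('f, 'r, ('f, 'r) fm) struc. models L N T \<longrightarrow> models L N {\<sigma>})"

definition complete_theory :: "('f, 'r) lang \<Rightarrow> ('f, 'r) fm set \<Rightarrow> bool" where
  "complete_theory L T \<longleftrightarrow> T \<subseteq> sentences L \<and> satisfiable L T \<and>
     (\<forall>\<sigma>\<in>sentences L. entails L T \<sigma> \<or> entails L T (Neg \<sigma>))"

text \<open>Substructures are given by their domains.\<close>

definition restr :: "('f, 'r, 'a) struc \<Rightarrow> 'a set \<Rightarrow> ('f, 'r, 'a) struc" where
  "restr U M = U\<lparr>Dom := M\<rparr>"

definition elem_substructure :: "('f, 'r) lang \<Rightarrow> 'a set \<Rightarrow> ('f, 'r, 'a) struc \<Rightarrow> bool" where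
  "elem_substructure L M U \<longleftrightarrow> M \<subseteq> Dom U \<and> is_struc L (restr U M) \<and>
     (\<forall>\<psi> e. is_formula L \<psi> \<longrightarrow> range e \<subseteq> M \<longrightarrow> (sat (restr U M) e \<psi> \<longleftrightarrow> sat U e \<psi>))"

section \<open>Partial types and monster models\<close>

text \<open>\<open>asg e vs c\<close> is the assignment \<open>e\<close> with the variables \<open>vs\<close> sent to the entries of \<open>c\<close>.\<close>

definition asg :: "(nat \<Rightarrow> 'a) \<Rightarrow> nat list \<Rightarrow> 'a list \<Rightarrow> nat \<Rightarrow> 'a" where
  "asg e vs c = (\<lambda>v. case map_of (zip vs c) v of None \<Rightarrow> e v | Some a \<Rightarrow> a)"

text \<open>An \<open>L(A)\<close>-formula in the free variables \<open>vs\<close> is a pair \<open>(\<psi>, e)\<close>: an \<open>L\<close>-formula together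
  with parameters \<open>e v \<in> A\<close> for its remaining free variables \<open>v\<close>.\<close>

definition par_formulas ::
  "('f, 'r) lang \<Rightarrow> 'a set \<Rightarrow> nat list \<Rightarrow> (('f, 'r) fm \<times> (nat \<Rightarrow> 'a)) set" where
  "par_formulas L A vs = {(\<psi>, e). is_formula L \<psi> \<and> (\<forall>v \<in> fvars \<psi> - set vs. e v \<in> A)}"

definition realizations ::
  "('f, 'r, 'a) struc \<Rightarrow> nat list \<Rightarrow> (('f, 'r) fm \<times> (nat \<Rightarrow> 'a)) set \<Rightarrow> 'a list set" where
  "realizations U vs \<pi> = {c \<in> tuples (Dom U) (length vs). \<forall>(\<psi>, e)\<in>\<pi>. sat U (asg e vs c) \<psi>}"

definition saturated :: "('f, 'r) lang \<Rightarrow> 'k rel \<Rightarrow> ('f, 'r, 'a) struc \<Rightarrow> bool" where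
  "saturated L \<kappa> U \<longleftrightarrow>
     (\<forall>A \<pi>. A \<subseteq> Dom U \<longrightarrow> |A| <o \<kappa> \<longrightarrow> \<pi> \<subseteq> par_formulas L A [0] \<longrightarrow>
        (\<forall>\<pi>'. \<pi>' \<subseteq> \<pi> \<longrightarrow> finite \<pi>' \<longrightarrow> realizations U [0] \<pi>' \<noteq> {}) \<longrightarrow>
        realizations U [0] \<pi> \<noteq> {})"

definition elementary_map ::
  "('f, 'r) lang \<Rightarrow> ('f, 'r, 'a) struc \<Rightarrow> 'a set \<Rightarrow> ('a \<Rightarrow> 'a) \<Rightarrow> bool" where
  "elementary_map L U A h \<longleftrightarrow> A \<subseteq> Dom U \<and> h ` A \<subseteq> Dom U \<and>
     (\<forall>\<psi> e. is_formula L \<psi> \<longrightarrow> (\<forall>v\<in>fvars \<psi>. e v \<in> A) \<longrightarrow> (sat U e \<psi> \<longleftrightarrow> sat U (h \<circ> e) \<psi>))"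

definition automorphism :: "('f, 'r) lang \<Rightarrow> ('f, 'r, 'a) struc \<Rightarrow> ('a \<Rightarrow> 'a) \<Rightarrow> bool" where
  "automorphism L U g \<longleftrightarrow> bij_betw g (Dom U) (Dom U) \<and>
     (\<forall>f\<in>Funs L. \<forall>a\<in>tuples (Dom U) (farity L f). g (fint U f a) = fint U f (map g a)) \<and>
     (\<forall>r\<in>Rels L. \<forall>a\<in>tuples (Dom U) (rarity L r). rint U r (map g a) \<longleftrightarrow> rint U r a)"

definition strongly_homogeneous :: "('f, 'r) lang \<Rightarrow> 'k rel \<Rightarrow> ('f, 'r, 'a) struc \<Rightarrow> bool" where
  "strongly_homogeneous L \<kappa> U \<longleftrightarrow>
     (\<forall>A h. |A| <o \<kappa> \<longrightarrow> elementary_map L U A h \<longrightarrow>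
        (\<exists>g. automorphism L U g \<and> (\<forall>a\<in>A. g a = h a)))"

text \<open>The three cardinal inequalities say \<open>\<kappa> > |L| + \<aleph>\<^sub>0\<close>.\<close>

definition monster_model :: "('f, 'r) lang \<Rightarrow> 'k rel \<Rightarrow> ('f, 'r, 'a) struc \<Rightarrow> bool" where
  "monster_model L \<kappa> U \<longleftrightarrow> is_struc L U \<and>
     Card_order \<kappa> \<and> natLeq <o \<kappa> \<and> |Funs L| <o \<kappa> \<and> |Rels L| <o \<kappa> \<and>
     saturated L \<kappa> U \<and> strongly_homogeneous L \<kappa> U"

section \<open>Partitioned formulas, local types and local measures\<close>

text \<open>A partitioned formula \<open>\<phi>(x, y)\<close>: \<open>x\<close> (\<open>ObjVars\<close>) and \<open>y\<close> (\<open>ParVars\<close>) are finite tuples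
  of variables.\<close>

record ('f, 'r) pformula =
  Form :: "('f, 'r) fm"
  ObjVars :: "nat list"
  ParVars :: "nat list"

definition is_pformula :: "('f, 'r) lang \<Rightarrow> ('f, 'r) pformula \<Rightarrow> bool" where
  "is_pformula L \<phi> \<longleftrightarrow> is_formula L (Form \<phi>) \<and> distinct (ObjVars \<phi> @ ParVars \<phi>) \<and>
     fvars (Form \<phi>) \<subseteq> set (ObjVars \<phi> @ ParVars \<phi>)"

definition opp :: "('f, 'r) pformula \<Rightarrow> ('f, 'r) pformula" where
  "opp \<phi> = \<lparr>Form = Form \<phi>, ObjVars = ParVars \<phi>, ParVars = ObjVars \<phi>\<rparr>"

abbreviation xlen :: "('f, 'r) pformula \<Rightarrow> nat" where
  "xlen \<phi> \<equiv> length (ObjVars \<phi>)"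

abbreviation ylen :: "('f, 'r) pformula \<Rightarrow> nat" where
  "ylen \<phi> \<equiv> length (ParVars \<phi>)"

text \<open>\<open>holds U \<phi> a b\<close> is \<open>U \<Turnstile> \<phi>(a, b)\<close>; the underlying assignment is irrelevant, as all free
  variables of \<open>\<phi>\<close> occur in \<open>x\<close> or \<open>y\<close>.\<close>

definition holds ::
  "('f, 'r, 'a) struc \<Rightarrow> ('f, 'r) pformula \<Rightarrow> 'a list \<Rightarrow> 'a list \<Rightarrow> bool" where
  "holds U \<phi> a b \<longleftrightarrow>
     sat U (asg (asg (\<lambda>_. undefined) (ParVars \<phi>) b) (ObjVars \<phi>) a) (Form \<phi>)"

definition NIP :: "('f, 'r, 'a) struc \<Rightarrow> ('f, 'r) pformula \<Rightarrow> bool" where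
  "NIP U \<phi> \<longleftrightarrow>
     \<not> (\<exists>(a :: nat \<Rightarrow> 'a list) (b :: nat set \<Rightarrow> 'a list).
          (\<forall>i. a i \<in> tuples (Dom U) (xlen \<phi>)) \<and> (\<forall>E. b E \<in> tuples (Dom U) (ylen \<phi>)) \<and>
          (\<forall>i E. holds U \<phi> (a i) (b E) \<longleftrightarrow> i \<in> E))"

text \<open>Boolean combinations of instances; \<open>Inst b\<close> stands for \<open>\<phi>(x, b)\<close>.\<close>

datatype 'p bform = Inst 'p | BNot "'p bform" | BAnd "'p bform" "'p bform"

definition BOr :: "'p bform \<Rightarrow> 'p bform \<Rightarrow> 'p bform" where
  "BOr \<psi> \<theta> = BNot (BAnd (BNot \<psi>) (BNot \<theta>))"

primrec beval :: "('p \<Rightarrow> bool) \<Rightarrow> 'p bform \<Rightarrow> bool" where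
  "beval v (Inst b) = v b"
| "beval v (BNot \<psi>) = (\<not> beval v \<psi>)"
| "beval v (BAnd \<psi> \<theta>) = (beval v \<psi> \<and> beval v \<theta>)"

definition bsat ::
  "('f, 'r, 'a) struc \<Rightarrow> ('f, 'r) pformula \<Rightarrow> 'a list \<Rightarrow> 'a list bform \<Rightarrow> bool" where
  "bsat U \<phi> a \<psi> = beval (holds U \<phi> a) \<psi>"

text \<open>The \<open>\<phi>\<close>-formulas over \<open>A\<close>; \<open>set_bform\<close> is the set of parameter tuples that occur.\<close>

definition phi_formulas :: "('f, 'r) pformula \<Rightarrow> 'a set \<Rightarrow> 'a list bform set" where
  "phi_formulas \<phi> A = {\<psi>. set_bform \<psi> \<subseteq> tuples A (ylen \<phi>)}"

definition consistent ::
  "('f, 'r, 'a) struc \<Rightarrow> ('f, 'r) pformula \<Rightarrow> 'a list bform set \<Rightarrow> bool" where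
  "consistent U \<phi> p \<longleftrightarrow>
     (\<forall>p0. p0 \<subseteq> p \<longrightarrow> finite p0 \<longrightarrow> (\<exists>a\<in>tuples (Dom U) (xlen \<phi>). \<forall>\<psi>\<in>p0. bsat U \<phi> a \<psi>))"

text \<open>Complete \<open>\<phi>\<close>-types over \<open>A\<close>. The global \<open>\<phi>\<close>-types are those over \<open>Dom U\<close>.\<close>

definition phi_types ::
  "('f, 'r, 'a) struc \<Rightarrow> ('f, 'r) pformula \<Rightarrow> 'a set \<Rightarrow> 'a list bform set set" where
  "phi_types U \<phi> A = {p. p \<subseteq> phi_formulas \<phi> A \<and> consistent U \<phi> p \<and>
     (\<forall>\<psi>\<in>phi_formulas \<phi> A. \<psi> \<in> p \<or> BNot \<psi> \<in> p)}"

definition phi_tp ::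
  "('f, 'r, 'a) struc \<Rightarrow> ('f, 'r) pformula \<Rightarrow> 'a set \<Rightarrow> 'a list \<Rightarrow> 'a list bform set" where
  "phi_tp U \<phi> A a = {\<psi>\<in>phi_formulas \<phi> A. bsat U \<phi> a \<psi>}"

definition stone_space ::
  "('f, 'r, 'a) struc \<Rightarrow> ('f, 'r) pformula \<Rightarrow> 'a set \<Rightarrow> 'a list bform set topology" where
  "stone_space U \<phi> A =
     topology_generated_by {{q \<in> phi_types U \<phi> A. \<psi> \<in> q} | \<psi>. \<psi> \<in> phi_formulas \<phi> A}"

text \<open>A finitely additive probability measure on the Boolean algebra of global \<open>\<phi>\<close>-formulas;
  the second condition says that equivalent formulas are identified.\<close>

definition keisler_phi_measure ::
  "('f, 'r, 'a) struc \<Rightarrow> ('f, 'r) pformula \<Rightarrow> ('a list bform \<Rightarrow> real) \<Rightarrow> bool" where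
  "keisler_phi_measure U \<phi> \<mu> \<longleftrightarrow>
     (\<forall>\<psi>\<in>phi_formulas \<phi> (Dom U). 0 \<le> \<mu> \<psi>) \<and>
     (\<forall>\<psi>\<in>phi_formulas \<phi> (Dom U). \<forall>\<theta>\<in>phi_formulas \<phi> (Dom U).
        (\<forall>a\<in>tuples (Dom U) (xlen \<phi>). bsat U \<phi> a \<psi> \<longleftrightarrow> bsat U \<phi> a \<theta>) \<longrightarrow> \<mu> \<psi> = \<mu> \<theta>) \<and>
     (\<forall>\<psi>\<in>phi_formulas \<phi> (Dom U).
        (\<forall>a\<in>tuples (Dom U) (xlen \<phi>). bsat U \<phi> a \<psi>) \<longrightarrow> \<mu> \<psi> = 1) \<and>
     (\<forall>\<psi>\<in>phi_formulas \<phi> (Dom U). \<forall>\<theta>\<in>phi_formulas \<phi> (Dom U).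
        (\<forall>a\<in>tuples (Dom U) (xlen \<phi>). \<not> (bsat U \<phi> a \<psi> \<and> bsat U \<phi> a \<theta>)) \<longrightarrow>
        \<mu> (BOr \<psi> \<theta>) = \<mu> \<psi> + \<mu> \<theta>)"

definition type_fin_sat ::
  "('f, 'r, 'a) struc \<Rightarrow> ('f, 'r) pformula \<Rightarrow> 'a set \<Rightarrow> 'a list bform set \<Rightarrow> bool" where
  "type_fin_sat U \<phi> M p \<longleftrightarrow> (\<forall>\<psi>\<in>p. \<exists>a\<in>tuples M (xlen \<phi>). bsat U \<phi> a \<psi>)"

definition measure_fin_sat ::
  "('f, 'r, 'a) struc \<Rightarrow> ('f, 'r) pformula \<Rightarrow> 'a set \<Rightarrow> ('a list bform \<Rightarrow> real) \<Rightarrow> bool" where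
  "measure_fin_sat U \<phi> M \<mu> \<longleftrightarrow>
     (\<forall>\<psi>\<in>phi_formulas \<phi> (Dom U). \<mu> \<psi> > 0 \<longrightarrow> (\<exists>a\<in>tuples M (xlen \<phi>). bsat U \<phi> a \<psi>))"

section \<open>Baire-1/2 functions and definability\<close>

definition DBSC :: "'x topology \<Rightarrow> ('x \<Rightarrow> real) \<Rightarrow> bool" where
  "DBSC X f \<longleftrightarrow>
     (\<exists>(g :: nat \<Rightarrow> 'x \<Rightarrow> real) C. C > 0 \<and>
        (\<forall>n. continuous_map X euclideanreal (g n)) \<and>
        (\<forall>x\<in>topspace X. g 0 x = 0 \<and> (\<lambda>n. g n x) \<longlonglongrightarrow> f x \<and>
           summable (\<lambda>n. \<bar>g (Suc n) x - g n x\<bar>) \<and> (\<Sum>n. \<bar>g (Suc n) x - g n x\<bar>) \<le> C))"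

definition baire_half :: "'x topology \<Rightarrow> ('x \<Rightarrow> real) \<Rightarrow> bool" where
  "baire_half X f \<longleftrightarrow>
     (\<exists>g :: nat \<Rightarrow> 'x \<Rightarrow> real. (\<forall>k. DBSC X (g k)) \<and> uniform_limit (topspace X) g f sequentially)"

text \<open>The function \<open>F\<close> is \<open>q \<mapsto> \<mu>(\<phi>(x, b))\<close> for \<open>b \<Turnstile> q\<close>. Its values on the type space are
  determined, because every complete type over a small \<open>M\<close> is realized in \<open>U\<close>.\<close>

definition baire_half_definable ::
  "('f, 'r, 'a) struc \<Rightarrow> ('f, 'r) pformula \<Rightarrow> 'a set \<Rightarrow> ('a list bform \<Rightarrow> real) \<Rightarrow> bool" where
  "baire_half_definable U \<phi> M \<mu> \<longleftrightarrow>
     (\<exists>F. (\<forall>b\<in>tuples (Dom U) (ylen \<phi>). F (phi_tp U (opp \<phi>) M b) = \<mu> (Inst b)) \<and>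
          baire_half (stone_space U (opp \<phi>) M) F)"

text \<open>Sets of realizations of partial types over \<open>M\<close>, in arbitrary \<open>L(M)\<close>-formulas (not only
  Boolean combinations of instances of \<open>\<phi>\<close>). The inconsistent set of formulas, which contributes
  the empty set, is not excluded; this does not affect the Boolean combinations below.\<close>

definition closed_over ::
  "('f, 'r) lang \<Rightarrow> ('f, 'r, 'a) struc \<Rightarrow> nat list \<Rightarrow> 'a set \<Rightarrow> 'a list set set" where
  "closed_over L U vs M = {realizations U vs \<pi> | \<pi>. \<pi> \<subseteq> par_formulas L M vs}"

inductive_set boolean_combinations :: "'x set \<Rightarrow> 'x set set \<Rightarrow> 'x set set"
  for \<Omega> :: "'x set" and G :: "'x set set" where
  basic: "X \<in> G \<Longrightarrow> X \<in> boolean_combinations \<Omega> G"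
| compl: "X \<in> boolean_combinations \<Omega> G \<Longrightarrow> \<Omega> - X \<in> boolean_combinations \<Omega> G"
| inter: "X \<in> boolean_combinations \<Omega> G \<Longrightarrow> Y \<in> boolean_combinations \<Omega> G \<Longrightarrow>
    X \<inter> Y \<in> boolean_combinations \<Omega> G"

definition strongly_borel_definable ::
  "('f, 'r) lang \<Rightarrow> ('f, 'r, 'a) struc \<Rightarrow> ('f, 'r) pformula \<Rightarrow> 'a set \<Rightarrow> 'a list bform set
     \<Rightarrow> bool" where
  "strongly_borel_definable L U \<phi> M p \<longleftrightarrow>
     {b \<in> tuples (Dom U) (ylen \<phi>). Inst b \<in> p}
       \<in> boolean_combinations (tuples (Dom U) (ylen \<phi>)) (closed_over L U (ParVars \<phi>) M)"

text \<open>Models of \<open>T\<close> are, as usual with a monster model, elementary substructures of \<open>U\<close>.\<close>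

definition countable_model ::
  "('f, 'r) lang \<Rightarrow> ('f, 'r) fm set \<Rightarrow> ('f, 'r, 'a) struc \<Rightarrow> 'a set \<Rightarrow> bool" where
  "countable_model L T U M \<longleftrightarrow>
     countable M \<and> elem_substructure L M U \<and> models L (restr U M) T"

definition fs_measures_baire_half_definable ::
  "('f, 'r) lang \<Rightarrow> ('f, 'r) fm set \<Rightarrow> ('f, 'r, 'a) struc \<Rightarrow> ('f, 'r) pformula \<Rightarrow> bool" where
  "fs_measures_baire_half_definable L T U \<phi> \<longleftrightarrow>
     (\<forall>\<mu> M. keisler_phi_measure U \<phi> \<mu> \<longrightarrow> countable_model L T U M \<longrightarrow>
        measure_fin_sat U \<phi> M \<mu> \<longrightarrow> baire_half_definable U \<phi> M \<mu>)"

definition fs_types_strongly_borel_definable ::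
  "('f, 'r) lang \<Rightarrow> ('f, 'r) fm set \<Rightarrow> ('f, 'r, 'a) struc \<Rightarrow> ('f, 'r) pformula \<Rightarrow> bool" where
  "fs_types_strongly_borel_definable L T U \<phi> \<longleftrightarrow>
     (\<forall>p M. p \<in> phi_types U \<phi> (Dom U) \<longrightarrow> countable_model L T U M \<longrightarrow>
        type_fin_sat U \<phi> M p \<longrightarrow> strongly_borel_definable L U \<phi> M p)"

end

(* The evaluation map b |-> mu(phi(x,b)) is approximated, exactly on every finite set of
   parameters, by averages of instances phi(a,y) with a in M. Fix r < s and iterate the derivative
   F |-> cl(F Int {mu >= s}) Int cl(F Int {mu <= r}), closures being taken in the space of
   phi-opposite types over M. A point surviving n derivatives spans a binary tree of parameters on
   which n such averages are independent with margin s - r. Since the convex hull of a class of finite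
   VC dimension has finite fat-shattering dimension (sampling, Sauer-Shelah and an exponential
   moment estimate), NIP makes some derivative empty, so {mu >= s} and {mu <= r} are separated by a
   finite union of differences of closed sets, whose indicator is DBSC. Running r and s through a
   fine grid gives the Baire-1/2 approximations; a phi-type is a measure with values 0 and 1.

   Conversely, if (a_i) and (b_E) witness the failure of NIP, take a countable elementary
   substructure containing the a_i and the limit of their phi-types along a nonprincipal ultrafilter.
   Either kind of definability makes the set of parameters b with phi(x,b) in the limit type and its
   complement countable unions of sets closed over M, which a Baire category argument on finite
   patterns together with saturation excludes. *)

theory Submission
  imports Defs "HOL-Library.Countable_Set_Type"
begin

section \<open>Shattering\<close>

text \<open>The fat-shattering bound must be uniform in supports and weights: the averages that
  represent a measure get larger supports as more parameters are prescribed, and only their values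
  at the tree points are controlled. The points of the tree are replaced at every level, but only by
  points with the same pattern on the supports already chosen, so earlier averages keep their
  values. Two notions of closed set have to be reconciled: strong Borel definability allows
  arbitrary \<open>L(M)\<close>-formulas, while the topology of the type space sees only instances
  of \<open>\<phi>\<close>. Closures are therefore taken on tuples of \<open>U\<close>, where both
  can be compared. Saturation is given for one variable, and each formula carries its own assignment
  of parameters. Renaming of variables turns this into realization of types in countably many
  variables under one common assignment; both the bound on shattered sequences and the category
  argument rest on it. Countability of the language enters in the converse, for the countable
  elementary substructure and for writing the complement of a closed set as a countable
  union.\<close>

definition shatters :: "'a set set \<Rightarrow> 'a set \<Rightarrow> bool" where
  "shatters F S \<longleftrightarrow> (\<forall>T\<subseteq>S. \<exists>C\<in>F. C \<inter> S = T)"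

lemma shatters_mono:
  assumes "shatters F S" "T \<subseteq> S"
  shows "shatters F T"
  unfolding shatters_def
proof (intro allI impI)
  fix V assume "V \<subseteq> T"
  then obtain C where "C \<in> F" "C \<inter> S = V"
    using assms unfolding shatters_def by blast
  then show "\<exists>C\<in>F. C \<inter> T = V" using assms(2) \<open>V \<subseteq> T\<close> by blast
qed

text \<open>Pajor's form of Sauer-Shelah: counting shattered sets avoids binomial sums in the
  induction. Split \<open>F\<close> at \<open>x\<close>; a set shattered by either half is shattered
  by \<open>F\<close>, and one shattered by both halves yields a second shattered set, with
  \<open>x\<close> added.\<close>

lemma card_le_card_shattered:
  assumes "finite X" "F \<subseteq> Pow X"
  shows "card F \<le> card {S. S \<subseteq> X \<and> shatters F S}"
  using assms
proof (induction X arbitrary: F rule: finite_induct)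
  case empty
  show ?case
  proof (cases "F = {}")
    case False
    then have "F = {{}}" using empty by auto
    then have "{S. S \<subseteq> {} \<and> shatters F S} = {{}}" by (auto simp: shatters_def)
    then show ?thesis using \<open>F = {{}}\<close> by simp
  qed simp
next
  case (insert x X)
  define F0 where "F0 = {C \<in> F. x \<notin> C}"
  define F1 where "F1 = (\<lambda>C. C - {x}) ` {C \<in> F. x \<in> C}"
  define sh where "sh = (\<lambda>G. {S. S \<subseteq> X \<and> shatters G S})"
  have fF: "finite F" using insert.hyps(1) insert.prems by (meson finite_Pow_iff finite_insert finite_subset)
  have sub: "F0 \<subseteq> Pow X" "F1 \<subseteq> Pow X" using insert.prems by (auto simp: F0_def F1_def)
  have fsh: "finite (sh G)" for G using insert.hyps(1) by (simp add: sh_def)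
  have "inj_on (\<lambda>C. C - {x}) {C \<in> F. x \<in> C}" by (auto simp: inj_on_def)
  then have c1: "card F1 = card {C \<in> F. x \<in> C}" by (simp add: F1_def card_image)
  have "F = F0 \<union> {C \<in> F. x \<in> C}" by (auto simp: F0_def)
  then have "card F = card F0 + card {C \<in> F. x \<in> C}"
    using fF by (metis (no_types, lifting) F0_def card_Un_disjoint disjoint_iff finite_Un mem_Collect_eq)
  then have "card F = card F0 + card F1" using c1 by simp
  also have "\<dots> \<le> card (sh F0) + card (sh F1)"
    using insert.IH[OF sub(1)] insert.IH[OF sub(2)] by (simp add: sh_def)
  also have "\<dots> = card (sh F0 \<union> sh F1) + card (insert x ` (sh F0 \<inter> sh F1))"
  proof -
    have "inj_on (insert x) (sh F0 \<inter> sh F1)"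
      using insert.hyps(2) by (auto simp: inj_on_def sh_def)
    then show ?thesis using card_Un_Int[OF fsh fsh] by (simp add: card_image)
  qed
  also have "\<dots> = card ((sh F0 \<union> sh F1) \<union> insert x ` (sh F0 \<inter> sh F1))"
  proof (rule card_Un_disjoint[symmetric])
    show "(sh F0 \<union> sh F1) \<inter> insert x ` (sh F0 \<inter> sh F1) = {}"
      using insert.hyps(2) by (auto simp: sh_def)
  qed (use fsh in auto)
  also have "\<dots> \<le> card {S. S \<subseteq> insert x X \<and> shatters F S}"
  proof (rule card_mono)
    show "finite {S. S \<subseteq> insert x X \<and> shatters F S}" using insert.hyps(1) by simp
    have a: "shatters F S" if "S \<subseteq> X" "shatters F0 S" for S
      using that unfolding shatters_def F0_def by blast
    have b: "shatters F S" if S: "S \<subseteq> X" "shatters F1 S" for S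
      unfolding shatters_def
    proof (intro allI impI)
      fix T assume "T \<subseteq> S"
      then obtain D where "D \<in> F1" "D \<inter> S = T"
        using S unfolding shatters_def by blast
      then obtain C where "C \<in> F" "(C - {x}) \<inter> S = T"
        unfolding F1_def by blast
      then show "\<exists>C\<in>F. C \<inter> S = T" using S(1) insert.hyps(2) by blast
    qed
    have c: "shatters F (insert x S)" if S: "S \<subseteq> X" "shatters F0 S" "shatters F1 S" for S
      unfolding shatters_def
    proof (intro allI impI)
      fix T assume T: "T \<subseteq> insert x S"
      have T': "T - {x} \<subseteq> S" using T by blast
      show "\<exists>C\<in>F. C \<inter> insert x S = T"
      proof (cases "x \<in> T")
        case True
        obtain D where "D \<in> F1" "D \<inter> S = T - {x}"
          using S(3) T' unfolding shatters_def by blast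
        then obtain C where "C \<in> F" "x \<in> C" "(C - {x}) \<inter> S = T - {x}"
          unfolding F1_def by blast
        then show ?thesis using True by blast
      next
        case False
        obtain C where "C \<in> F" "x \<notin> C" "C \<inter> S = T - {x}"
          using S(2) T' unfolding shatters_def F0_def by blast
        then show ?thesis using False by blast
      qed
    qed
    show "(sh F0 \<union> sh F1) \<union> insert x ` (sh F0 \<inter> sh F1) \<subseteq> {S. S \<subseteq> insert x X \<and> shatters F S}"
      using a b c by (auto simp: sh_def)
  qed
  finally show ?case .
qed

lemma sauer_shelah:
  fixes F :: "nat set set"
  assumes F: "F \<subseteq> Pow {..<n}"
    and dim: "\<And>S. S \<subseteq> {..<n} \<Longrightarrow> card S = d \<Longrightarrow> \<not> shatters F S"
  shows "card F \<le> (n + 1) ^ d"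
proof -
  have "card F \<le> card {S. S \<subseteq> {..<n} \<and> shatters F S}"
    by (rule card_le_card_shattered) (use F in auto)
  also have "\<dots> \<le> card ((\<lambda>xs. set xs \<inter> {..<n}) ` {xs. set xs \<subseteq> {..n} \<and> length xs = d})"
  proof (rule card_mono)
    show "finite ((\<lambda>xs. set xs \<inter> {..<n}) ` {xs. set xs \<subseteq> {..n} \<and> length xs = d})"
      by (simp add: finite_lists_length_eq)
    show "{S. S \<subseteq> {..<n} \<and> shatters F S}
        \<subseteq> (\<lambda>xs. set xs \<inter> {..<n}) ` {xs. set xs \<subseteq> {..n} \<and> length xs = d}"
    proof
      fix S assume "S \<in> {S. S \<subseteq> {..<n} \<and> shatters F S}"
      then have S: "S \<subseteq> {..<n}" "shatters F S" by auto
      have finS: "finite S" using S(1) finite_subset by blast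
      have "card S \<le> d"
      proof (rule ccontr)
        assume "\<not> card S \<le> d"
        then obtain T where "T \<subseteq> S" "card T = d"
          by (meson nat_le_linear obtain_subset_with_card_n)
        then show False using dim[of T] S shatters_mono by blast
      qed
      \<comment> \<open>\<open>n\<close> lies outside \<open>{..<n}\<close> and serves as padding,
        so each set of at most \<open>d\<close> elements is coded by a list of length exactly
        \<open>d\<close>.\<close>
      define xs where "xs = sorted_list_of_set S @ replicate (d - card S) n"
      have "length xs = d" using \<open>card S \<le> d\<close> by (simp add: xs_def)
      moreover have "set xs \<subseteq> {..n}" "S = set xs \<inter> {..<n}"
        using S(1) finS by (auto simp: xs_def split: if_splits)
      ultimately show "S \<in> (\<lambda>xs. set xs \<inter> {..<n}) ` {xs. set xs \<subseteq> {..n} \<and> length xs = d}"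
        by blast
    qed
  qed
  also have "\<dots> \<le> card {xs. set xs \<subseteq> {..n} \<and> length xs = d}"
    by (rule card_image_le) (simp add: finite_lists_length_eq)
  also have "\<dots> = (n + 1) ^ d" by (simp add: card_lists_length_eq)
  finally show ?thesis .
qed

section \<open>Exponential moments of sums of signs\<close>

definition sgn_of :: "bool \<Rightarrow> real" where
  "sgn_of P = (if P then 1 else - 1)"

lemma sum_Pow_lessThan_Suc:
  fixes h :: "nat set \<Rightarrow> real"
  shows "(\<Sum>E\<in>Pow {..<Suc n}. h E) = (\<Sum>E\<in>Pow {..<n}. h E + h (insert n E))"
proof -
  have "inj_on (insert n) (Pow {..<n})" by (auto simp: inj_on_def)
  moreover have "Pow {..<n} \<inter> insert n ` Pow {..<n} = {}" by auto
  ultimately show ?thesis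
    by (simp add: lessThan_Suc Pow_insert sum.union_disjoint sum.reindex sum.distrib)
qed

text \<open>The moment generating function of a sum of \<open>n\<close> independent signs, up to the
  factor \<open>2 ^ n\<close>. The signs of \<open>C\<close> drop out because a uniform sign times a
  fixed sign is again uniform.\<close>

lemma exp_moment_signs:
  fixes l :: real
  shows "(\<Sum>E\<in>Pow {..<n}. exp (l * (\<Sum>k<n. sgn_of (k \<in> E) * sgn_of (k \<in> C))))
     = (exp l + exp (- l)) ^ n"
proof (induction n)
  case (Suc n)
  define S where "S = (\<lambda>E. \<Sum>k<n. sgn_of (k \<in> E) * sgn_of (k \<in> C))"
  have s: "sgn_of (n \<in> C) = 1 \<or> sgn_of (n \<in> C) = - 1" by (simp add: sgn_of_def)
  have "(\<Sum>E\<in>Pow {..<Suc n}. exp (l * (\<Sum>k<Suc n. sgn_of (k \<in> E) * sgn_of (k \<in> C))))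
      = (\<Sum>E\<in>Pow {..<n}. exp (l * S E) * (exp l + exp (- l)))"
    unfolding sum_Pow_lessThan_Suc
  proof (rule sum.cong[OF refl])
    fix E assume E: "E \<in> Pow {..<n}"
    then have n: "n \<notin> E" by auto
    have "(\<Sum>k<n. sgn_of (k \<in> insert n E) * sgn_of (k \<in> C)) = S E"
      unfolding S_def by (rule sum.cong) auto
    then show "exp (l * (\<Sum>k<Suc n. sgn_of (k \<in> E) * sgn_of (k \<in> C))) +
          exp (l * (\<Sum>k<Suc n. sgn_of (k \<in> insert n E) * sgn_of (k \<in> C)))
        = exp (l * S E) * (exp l + exp (- l))"
      using s n by (auto simp: S_def[symmetric] sgn_of_def algebra_simps exp_add exp_minus exp_diff field_simps)
  qed
  also have "\<dots> = (exp l + exp (- l)) ^ Suc n"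
    using Suc by (simp add: S_def sum_distrib_right[symmetric])
  finally show ?case .
qed simp


lemma sum_exp_le_exp_square:
  fixes l :: real
  assumes "0 \<le> l" "l \<le> 1"
  shows "exp l + exp (- l) \<le> 2 * exp (l\<^sup>2)"
proof -
  have "exp (- l) \<le> 1 / (1 + l)"
    using exp_ge_add_one_self[of l] assms by (simp add: exp_minus field_simps)
  also have "\<dots> \<le> 1 - l + l\<^sup>2"
    using assms by (simp add: field_simps power2_eq_square)
  finally have "exp l + exp (- l) \<le> 2 * (1 + l\<^sup>2)" using exp_bound[OF assms] by simp
  also have "\<dots> \<le> 2 * exp (l\<^sup>2)" by (rule mult_left_mono[OF exp_ge_add_one_self]) simp
  finally show ?thesis .
qed

lemma power_less_exp:
  fixes c :: real assumes "c > 0"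
  shows "\<exists>n. real ((n + 1) ^ d) < exp (c * real n)"
proof -
  have "filterlim (\<lambda>n. c * real (n + 1)) at_top sequentially"
    using assms by (intro filterlim_tendsto_pos_mult_at_top[OF tendsto_const])
      (intro assms, rule filterlim_compose[OF filterlim_real_sequentially filterlim_add_const_nat_at_top])
  then have "((\<lambda>n. (c * real (n + 1)) ^ d / exp (c * real (n + 1))) \<longlongrightarrow> 0) sequentially"
    by (rule filterlim_compose[OF tendsto_power_div_exp_0])
  \<comment> \<open>The shift to \<open>n + 1\<close> keeps the quotient positive; after cancelling,
    the value at \<open>x = c * real (n + 1)\<close> differs from the wanted quotient by the factor
    \<open>c ^ d / exp c\<close>, which is therefore the threshold.\<close>
  then have "\<forall>\<^sub>F n in sequentially. (c * real (n + 1)) ^ d / exp (c * real (n + 1)) < c ^ d / exp c"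
    using assms by (intro order_tendstoD(2)) auto
  then obtain n where "(c * real (n + 1)) ^ d / exp (c * real (n + 1)) < c ^ d / exp c"
    by (auto simp: eventually_sequentially)
  moreover have "exp (c * real (n + 1)) = exp c * exp (c * real n)"
    by (simp add: exp_add[symmetric] algebra_simps)
  ultimately have "real (n + 1) ^ d < exp (c * real n)"
    using assms by (simp add: power_mult_distrib divide_simps mult.commute)
  then show ?thesis by auto
qed

lemma sum_signs_eq_0:
  assumes "k < n"
  shows "(\<Sum>E\<in>Pow {..<n}. sgn_of (k \<in> E)) = 0"
proof -
  have "(\<Sum>E\<in>Pow {..<n}. sgn_of (k \<in> E)) = (\<Sum>E\<in>Pow {..<n}. - sgn_of (k \<in> E))"
    by (rule sum.reindex_bij_witness[where i = "\<lambda>E. if k \<in> E then E - {k} else insert k E"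
          and j = "\<lambda>E. if k \<in> E then E - {k} else insert k E"])
      (use assms in \<open>auto simp: sgn_of_def\<close>)
  then show ?thesis by (simp add: sum_negf)
qed

section \<open>Fat-shattering of convex hulls\<close>

definition prob_weights :: "'a set \<Rightarrow> 'a set \<Rightarrow> ('a \<Rightarrow> real) \<Rightarrow> bool" where
  "prob_weights A S w \<longleftrightarrow> finite S \<and> S \<subseteq> A \<and> (\<forall>a\<in>S. 0 \<le> w a) \<and> sum w S = 1"

text \<open>With weights as in \<open>prob_weights\<close>, these functions form the convex hull of
  the class of instances \<open>R a\<close>.\<close>

definition mean :: "('a \<Rightarrow> 'b \<Rightarrow> bool) \<Rightarrow> 'a set \<Rightarrow> ('a \<Rightarrow> real) \<Rightarrow> 'b \<Rightarrow> real" where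
  "mean R S w b = (\<Sum>a\<in>S. w a * of_bool (R a b))"

lemma prob_weights_average:
  fixes h :: "'a \<Rightarrow> real"
  assumes "prob_weights A S w"
  shows "\<exists>a\<in>S. (\<Sum>a\<in>S. w a * h a) \<le> h a"
proof -
  have S: "finite S" "\<forall>a\<in>S. 0 \<le> w a" "sum w S = 1" using assms by (auto simp: prob_weights_def)
  have ne: "S \<noteq> {}" using S(3) by auto
  define m where "m = Max (h ` S)"
  have "m \<in> h ` S" using S(1) ne by (simp add: m_def)
  then obtain a where a: "a \<in> S" "h a = m" by auto
  have "(\<Sum>a\<in>S. w a * h a) \<le> (\<Sum>a\<in>S. w a * m)"
    by (rule sum_mono) (use S in \<open>auto simp: m_def intro!: mult_left_mono\<close>)
  also have "\<dots> = m" using S(3) by (simp add: sum_distrib_right[symmetric])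
  finally show ?thesis using a by auto
qed

definition vc_shattered :: "('a \<Rightarrow> 'b \<Rightarrow> bool) \<Rightarrow> 'b set \<Rightarrow> nat \<Rightarrow> (nat \<Rightarrow> 'a) \<Rightarrow> bool" where
  "vc_shattered R B d a \<longleftrightarrow> (\<forall>E\<subseteq>{..<d}. \<exists>b\<in>B. \<forall>i<d. R (a i) b \<longleftrightarrow> i \<in> E)"

text \<open>Here \<open>x E\<close> is the point realizing the pattern \<open>E\<close> with margin between \<open>r\<close> and \<open>s\<close>.\<close>

definition fat_shattered ::
  "('a \<Rightarrow> 'b \<Rightarrow> bool) \<Rightarrow> 'a set \<Rightarrow> 'b set \<Rightarrow> real \<Rightarrow> real \<Rightarrow> nat \<Rightarrow> (nat \<Rightarrow> 'a set)
     \<Rightarrow> (nat \<Rightarrow> 'a \<Rightarrow> real) \<Rightarrow> (nat set \<Rightarrow> 'b) \<Rightarrow> bool" where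
  "fat_shattered R A B r s n S w x \<longleftrightarrow>
     (\<forall>k<n. prob_weights A (S k) (w k)) \<and>
     (\<forall>E\<subseteq>{..<n}. x E \<in> B \<and> (\<forall>k<n. if k \<in> E then s \<le> mean R (S k) (w k) (x E)
                                       else mean R (S k) (w k) (x E) \<le> r))"

text \<open>Each mean is replaced by one well-chosen instance \<open>a k\<close>: the pattern that \<open>x E\<close> cuts out of the
  \<open>a k\<close> then agrees with \<open>E\<close> on noticeably more than half of the coordinates, on average over \<open>E\<close>.
  Polynomially many patterns cannot achieve this.\<close>

lemma no_large_fat_shattering:
  fixes R :: "'a \<Rightarrow> 'b \<Rightarrow> bool"
  assumes dim: "\<And>a. a ` {..<d} \<subseteq> A \<Longrightarrow> \<not> vc_shattered R B d a" and rs: "r < s"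
  shows "\<exists>n. \<forall>S w x. \<not> fat_shattered R A B r s n S w x"
proof -
  \<comment> \<open>Capping the margin at 1 keeps \<open>g / 2\<close> in the range where
    \<open>sum_exp_le_exp_square\<close> applies.\<close>
  define g where "g = min (s - r) 1"
  have g: "0 < g" "g \<le> 1" "g \<le> s - r" using rs by (auto simp: g_def)
  obtain n where n: "real ((n + 1) ^ d) < exp (g\<^sup>2 / 4 * real n)"
    using power_less_exp[of "g\<^sup>2 / 4" d] g by auto
  show ?thesis
  proof (intro exI allI notI)
    fix S w x assume fs: "fat_shattered R A B r s n S w x"
    let ?P = "Pow {..<n}"
    define e where "e = (\<lambda>(k::nat) E. sgn_of (k \<in> E))"
    have "\<exists>a\<in>A. 2 ^ n * g \<le> (\<Sum>E\<in>?P. e k E * sgn_of (R a (x E)))" if k: "k < n" for k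
    proof -
      have pw: "prob_weights A (S k) (w k)" using fs k by (auto simp: fat_shattered_def)
      obtain a where a: "a \<in> S k" "(\<Sum>a\<in>S k. w k a * (\<Sum>E\<in>?P. e k E * of_bool (R a (x E))))
          \<le> (\<Sum>E\<in>?P. e k E * of_bool (R a (x E)))"
        using prob_weights_average[OF pw, of "\<lambda>a. \<Sum>E\<in>?P. e k E * of_bool (R a (x E))"] by blast
      \<comment> \<open>The signs of coordinate \<open>k\<close> sum to zero over all
        \<open>E\<close>, so the mean may be centred at \<open>(r + s) / 2\<close>; every
        \<open>E\<close> then contributes at least half of the margin.\<close>
      have "2 ^ n * g / 2 = (\<Sum>E\<in>?P. g / 2)" by (simp add: card_Pow)
      also have "\<dots> \<le> (\<Sum>E\<in>?P. e k E * (mean R (S k) (w k) (x E) - (r + s) / 2))"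
      proof (rule sum_mono)
        fix E assume "E \<in> ?P"
        then have "if k \<in> E then s \<le> mean R (S k) (w k) (x E) else mean R (S k) (w k) (x E) \<le> r"
          using fs k by (auto simp: fat_shattered_def)
        then show "g / 2 \<le> e k E * (mean R (S k) (w k) (x E) - (r + s) / 2)"
          using g(3) by (auto simp: e_def sgn_of_def field_simps split: if_splits)
      qed
      also have "\<dots> = (\<Sum>E\<in>?P. e k E * mean R (S k) (w k) (x E)) - (\<Sum>E\<in>?P. e k E) * ((r + s) / 2)"
        by (simp add: right_diff_distrib sum_subtractf sum_distrib_right)
      also have "\<dots> = (\<Sum>E\<in>?P. e k E * mean R (S k) (w k) (x E))"
        using sum_signs_eq_0[OF k] by (simp add: e_def)
      also have "\<dots> = (\<Sum>a\<in>S k. w k a * (\<Sum>E\<in>?P. e k E * of_bool (R a (x E))))"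
        unfolding mean_def sum_distrib_left by (subst sum.swap) (simp add: mult_ac)
      also note a(2)
      also have "(\<Sum>E\<in>?P. e k E * of_bool (R a (x E)))
          = (\<Sum>E\<in>?P. e k E * sgn_of (R a (x E)) / 2 + e k E / 2)"
        by (rule sum.cong) (auto simp: sgn_of_def)
      also have "\<dots> = (\<Sum>E\<in>?P. e k E * sgn_of (R a (x E))) / 2 + (\<Sum>E\<in>?P. e k E) / 2"
        by (simp add: sum.distrib sum_divide_distrib)
      also have "\<dots> = (\<Sum>E\<in>?P. e k E * sgn_of (R a (x E))) / 2"
        using sum_signs_eq_0[OF k] by (simp add: e_def)
      finally have "2 ^ n * g \<le> (\<Sum>E\<in>?P. e k E * sgn_of (R a (x E)))" by simp
      then show ?thesis using a(1) pw by (auto simp: prob_weights_def)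
    qed
    then obtain a where a: "\<And>k. k < n \<Longrightarrow> a k \<in> A"
      "\<And>k. k < n \<Longrightarrow> 2 ^ n * g \<le> (\<Sum>E\<in>?P. e k E * sgn_of (R (a k) (x E)))"
      by metis
    define tr where "tr = (\<lambda>E. {k. k < n \<and> R (a k) (x E)})"
    define h where "h = (\<lambda>E C. \<Sum>k<n. e k E * e k C)"
    have "card (tr ` ?P) \<le> (n + 1) ^ d"
    proof (rule sauer_shelah)
      show "tr ` ?P \<subseteq> ?P" by (auto simp: tr_def)
      fix T assume T: "T \<subseteq> {..<n}" "card T = d"
      show "\<not> shatters (tr ` ?P) T"
      proof
        assume sh: "shatters (tr ` ?P) T"
        have "finite T" using T(1) finite_subset by blast
        then obtain f where f: "bij_betw f {..<d} T"
          using T(2) ex_bij_betw_nat_finite by (metis atLeast0LessThan)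
        have fT: "f i \<in> T" "f i < n" if "i < d" for i using f that T(1) by (auto simp: bij_betw_def)
        have "vc_shattered R B d (a \<circ> f)"
          unfolding vc_shattered_def
        proof (intro allI impI)
          fix E assume E: "E \<subseteq> {..<d}"
          have "f ` E \<subseteq> T" using E fT by auto
          then obtain G where G: "G \<in> ?P" "tr G \<inter> T = f ` E"
            using sh unfolding shatters_def by (metis (no_types, lifting) imageE)
          have "R ((a \<circ> f) i) (x G) \<longleftrightarrow> i \<in> E" if i: "i < d" for i
          proof -
            have "R ((a \<circ> f) i) (x G) \<longleftrightarrow> f i \<in> tr G \<inter> T" using fT[OF i] by (simp add: tr_def)
            also have "\<dots> \<longleftrightarrow> i \<in> E"
              unfolding G(2) using f i E by (auto simp: bij_betw_def inj_on_def)
            finally show ?thesis .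
          qed
          moreover have "x G \<in> B" using fs G(1) by (auto simp: fat_shattered_def)
          ultimately show "\<exists>b\<in>B. \<forall>i<d. R ((a \<circ> f) i) b \<longleftrightarrow> i \<in> E" by blast
        qed
        moreover have "(a \<circ> f) ` {..<d} \<subseteq> A" using a(1) fT by auto
        ultimately show False using dim by blast
      qed
    qed
    then have cardF: "real (card (tr ` ?P)) \<le> real ((n + 1) ^ d)" using of_nat_mono by blast
    \<comment> \<open>\<open>l = g / 2\<close> maximizes \<open>g * l - l\<^sup>2\<close>, the
      exponential gain per coordinate less the loss in \<open>sum_exp_le_exp_square\<close>.
      \<open>c\<close> is a lower bound for the average of \<open>g / 2 * h E (tr E)\<close> over
      \<open>E\<close>.\<close>
    define c where "c = g / 2 * (real n * g)"
    have "real n * (2 ^ n * g) = (\<Sum>k<n. 2 ^ n * g)" by simp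
    also have "\<dots> \<le> (\<Sum>k<n. \<Sum>E\<in>?P. e k E * sgn_of (R (a k) (x E)))"
      by (rule sum_mono) (use a in auto)
    also have "\<dots> = (\<Sum>E\<in>?P. \<Sum>k<n. e k E * sgn_of (R (a k) (x E)))" by (rule sum.swap)
    also have "\<dots> = (\<Sum>E\<in>?P. h E (tr E))"
      unfolding h_def by (intro sum.cong refl) (simp add: e_def tr_def)
    finally have h_sum: "real n * (2 ^ n * g) \<le> (\<Sum>E\<in>?P. h E (tr E))" .
    \<comment> \<open>The tangent line of \<open>exp\<close> at \<open>c\<close> takes the place of
      Jensen's inequality.\<close>
    have "exp c * 2 ^ n \<le> exp c * (\<Sum>E\<in>?P. 1 + (g / 2 * h E (tr E) - c))"
    proof -
      have "(\<Sum>E\<in>?P. 1 + (g / 2 * h E (tr E) - c)) = 2 ^ n * (1 - c) + g / 2 * (\<Sum>E\<in>?P. h E (tr E))"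
        by (simp only: sum.distrib sum_subtractf sum_distrib_left[symmetric]) (simp add: card_Pow algebra_simps)
      moreover have "g / 2 * (real n * (2 ^ n * g)) \<le> g / 2 * (\<Sum>E\<in>?P. h E (tr E))"
        by (rule mult_left_mono[OF h_sum]) (use g in auto)
      ultimately show ?thesis by (simp add: c_def algebra_simps)
    qed
    also have "\<dots> \<le> (\<Sum>E\<in>?P. exp (g / 2 * h E (tr E)))"
      unfolding sum_distrib_left
    proof (rule sum_mono)
      fix E
      have "exp c * (1 + (g / 2 * h E (tr E) - c)) \<le> exp c * exp (g / 2 * h E (tr E) - c)"
        by (rule mult_left_mono) (use exp_ge_add_one_self in auto)
      then show "exp c * (1 + (g / 2 * h E (tr E) - c)) \<le> exp (g / 2 * h E (tr E))"
        by (simp add: exp_add[symmetric])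
    qed
    \<comment> \<open>\<open>tr E\<close> varies with \<open>E\<close>. Summing over all traces
      makes the second argument of \<open>h\<close> independent of \<open>E\<close>, at the cost of
      the polynomial number of traces.\<close>
    also have "\<dots> \<le> (\<Sum>E\<in>?P. \<Sum>C\<in>tr ` ?P. exp (g / 2 * h E C))"
    proof (rule sum_mono)
      fix E assume "E \<in> ?P"
      then show "exp (g / 2 * h E (tr E)) \<le> (\<Sum>C\<in>tr ` ?P. exp (g / 2 * h E C))"
        by (intro member_le_sum[where f = "\<lambda>C. exp (g / 2 * h E C)"]) auto
    qed
    also have "\<dots> = (\<Sum>C\<in>tr ` ?P. \<Sum>E\<in>?P. exp (g / 2 * h E C))" by (rule sum.swap)
    also have "\<dots> = (\<Sum>C\<in>tr ` ?P. (exp (g / 2) + exp (- (g / 2))) ^ n)"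
      unfolding h_def e_def by (subst exp_moment_signs) simp
    also have "\<dots> = real (card (tr ` ?P)) * (exp (g / 2) + exp (- (g / 2))) ^ n" by simp
    also have "\<dots> \<le> real ((n + 1) ^ d) * (2 * exp ((g / 2)\<^sup>2)) ^ n"
      by (intro mult_mono cardF power_mono sum_exp_le_exp_square) (use g in \<open>auto simp: add_nonneg_nonneg\<close>)
    also have "\<dots> = 2 ^ n * (real ((n + 1) ^ d) * exp (g\<^sup>2 / 4 * real n))"
      by (simp add: power_mult_distrib exp_of_nat_mult[symmetric] power_divide mult_ac)
    finally have "exp c \<le> real ((n + 1) ^ d) * exp (g\<^sup>2 / 4 * real n)" by simp
    moreover have "exp c = exp (g\<^sup>2 / 4 * real n) * exp (g\<^sup>2 / 4 * real n)"
      by (simp add: exp_add[symmetric] c_def power2_eq_square algebra_simps)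
    ultimately show False using n by simp
  qed
qed

section \<open>Renaming and saturation\<close>

primrec tren :: "(nat \<Rightarrow> nat) \<Rightarrow> 'f trm \<Rightarrow> 'f trm" where
  "tren h (Var v) = Var (h v)"
| "tren h (Fn g ts) = Fn g (map (tren h) ts)"

text \<open>Bound variables are renamed together with the free ones, so an injective
  \<open>h\<close> cannot cause capture and no fresh variables have to be chosen.\<close>

primrec fren :: "(nat \<Rightarrow> nat) \<Rightarrow> ('f, 'r) fm \<Rightarrow> ('f, 'r) fm" where
  "fren h (Eq s t) = Eq (tren h s) (tren h t)"
| "fren h (Rel r ts) = Rel r (map (tren h) ts)"
| "fren h (Neg \<psi>) = Neg (fren h \<psi>)"
| "fren h (Conj \<psi> \<theta>) = Conj (fren h \<psi>) (fren h \<theta>)"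
| "fren h (Ex v \<psi>) = Ex (h v) (fren h \<psi>)"

lemma tval_tren: "tval U e (tren h t) = tval U (e \<circ> h) t"
  by (induction t) (simp_all add: comp_def cong: map_cong)

lemma sat_fren:
  assumes "inj h"
  shows "sat U e (fren h \<psi>) \<longleftrightarrow> sat U (e \<circ> h) \<psi>"
proof (induction \<psi> arbitrary: e)
  case (Ex v \<psi>)
  have "e(h v := a) \<circ> h = (e \<circ> h)(v := a)" for a
    using assms by (auto simp: fun_eq_iff inj_eq)
  then show ?case using Ex.IH by (simp only: fren.simps sat.simps)
qed (simp_all add: tval_tren comp_def cong: map_cong)

lemma is_term_tren: "is_term L (tren h t) = is_term L t"
  by (induction t) (auto simp: list_all_iff)

lemma is_formula_fren: "is_formula L (fren h \<psi>) = is_formula L \<psi>"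
  by (induction \<psi>) (auto simp: list_all_iff is_term_tren)

lemma finite_tvars: "finite (tvars t)"
  by (induction t) auto

lemma finite_fvars: "finite (fvars \<psi>)"
  by (induction \<psi>) (auto simp: finite_tvars)

lemma tval_cong: "(\<And>v. v \<in> tvars t \<Longrightarrow> e v = e' v) \<Longrightarrow> tval U e t = tval U e' t"
proof (induction t)
  case (Fn f ts)
  have "map (tval U e) ts = map (tval U e') ts"
    using Fn by (intro map_cong) auto
  then show ?case by (simp only: tval.simps)
qed simp

lemma sat_cong: "(\<And>v. v \<in> fvars \<psi> \<Longrightarrow> e v = e' v) \<Longrightarrow> sat U e \<psi> = sat U e' \<psi>"
proof (induction \<psi> arbitrary: e e')
  case (Eq s t)
  then show ?case using tval_cong[of s e e' U] tval_cong[of t e e' U] by simp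
next
  case (Rel r ts)
  have "map (tval U e) ts = map (tval U e') ts"
    using Rel by (intro map_cong refl tval_cong) auto
  then show ?case by (simp only: sat.simps)
next
  case (Neg \<psi>)
  have "sat U e \<psi> = sat U e' \<psi>" by (rule Neg.IH) (simp add: Neg.prems)
  then show ?case by (simp only: sat.simps)
next
  case (Conj \<psi> \<theta>)
  have "sat U e \<psi> = sat U e' \<psi>" by (rule Conj.IH) (simp add: Conj.prems)
  moreover have "sat U e \<theta> = sat U e' \<theta>" by (rule Conj.IH) (simp add: Conj.prems)
  ultimately show ?case by (simp only: sat.simps)
next
  case (Ex v \<psi>)
  have "sat U (e(v := a)) \<psi> = sat U (e'(v := a)) \<psi>" for a
    by (rule Ex.IH) (simp add: Ex.prems)
  then show ?case by (simp only: sat.simps)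
qed

definition ex_list :: "nat list \<Rightarrow> ('f, 'r) fm \<Rightarrow> ('f, 'r) fm" where
  "ex_list vs \<psi> = foldr Ex vs \<psi>"

text \<open>The base of the fold is a tautology, which makes the empty conjunction true; its
  variable 0 is free in every \<open>conj_list\<close>.\<close>

definition conj_list :: "('f, 'r) fm list \<Rightarrow> ('f, 'r) fm" where
  "conj_list \<psi>s = foldr Conj \<psi>s (Neg (Conj (Eq (Var 0) (Var 0)) (Neg (Eq (Var 0) (Var 0)))))"

lemma is_formula_ex_list [simp]: "is_formula L (ex_list vs \<psi>) = is_formula L \<psi>"
  by (induction vs) (auto simp: ex_list_def)

lemma is_formula_conj_list [simp]:
  "is_formula L (conj_list \<psi>s) \<longleftrightarrow> (\<forall>\<psi>\<in>set \<psi>s. is_formula L \<psi>)"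
  by (induction \<psi>s) (auto simp: conj_list_def)

lemma sat_conj_list [simp]: "sat U e (conj_list \<psi>s) \<longleftrightarrow> (\<forall>\<psi>\<in>set \<psi>s. sat U e \<psi>)"
  by (induction \<psi>s) (auto simp: conj_list_def)

lemma sat_ex_list:
  "sat U e (ex_list vs \<psi>) \<longleftrightarrow>
     (\<exists>e'. (\<forall>v. v \<notin> set vs \<longrightarrow> e' v = e v) \<and> (\<forall>v\<in>set vs. e' v \<in> Dom U) \<and> sat U e' \<psi>)"
proof (induction vs arbitrary: e)
  case Nil
  have "sat U e (ex_list [] \<psi>) \<longleftrightarrow> sat U e \<psi>" by (simp add: ex_list_def)
  moreover have "(\<forall>v. e' v = e v) \<longleftrightarrow> e' = e" for e' by auto
  ultimately show ?case by auto
next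
  case (Cons u vs)
  have "sat U e (ex_list (u # vs) \<psi>) \<longleftrightarrow> (\<exists>a\<in>Dom U. sat U (e(u := a)) (ex_list vs \<psi>))"
    by (simp add: ex_list_def)
  also have "\<dots> \<longleftrightarrow> (\<exists>a\<in>Dom U. \<exists>e'. (\<forall>v. v \<notin> set vs \<longrightarrow> e' v = (e(u := a)) v) \<and>
      (\<forall>v\<in>set vs. e' v \<in> Dom U) \<and> sat U e' \<psi>)"
    by (simp only: Cons.IH)
  also have "\<dots> \<longleftrightarrow> (\<exists>e'. (\<forall>v. v \<notin> set (u # vs) \<longrightarrow> e' v = e v) \<and>
      (\<forall>v\<in>set (u # vs). e' v \<in> Dom U) \<and> sat U e' \<psi>)" (is "?l \<longleftrightarrow> ?r")
  proof
    assume ?l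
    then obtain a e' where a: "a \<in> Dom U" and e': "\<forall>v. v \<notin> set vs \<longrightarrow> e' v = (e(u := a)) v"
      "\<forall>v\<in>set vs. e' v \<in> Dom U" "sat U e' \<psi>" by blast
    have "e' u \<in> Dom U" using a e' by (cases "u \<in> set vs") auto
    then show ?r using e' by (intro exI[of _ e']) auto
  next
    assume ?r
    then obtain e' where "\<forall>v. v \<notin> set (u # vs) \<longrightarrow> e' v = e v"
      "\<forall>v\<in>set (u # vs). e' v \<in> Dom U" "sat U e' \<psi>" by blast
    then show ?l by (intro bexI[of _ "e' u"] exI[of _ e']) auto
  qed
  finally show ?case .
qed

lemma asg_notin: "v \<notin> set vs \<Longrightarrow> length c = length vs \<Longrightarrow> asg e vs c v = e v"
  unfolding asg_def by (metis map_of_zip_is_None option.simps(4))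

lemma asg_in:
  assumes "v \<in> set vs" "length c = length vs"
  shows "asg e vs c v = asg e' vs c v" "asg e vs c v \<in> set c"
proof -
  obtain a where a: "map_of (zip vs c) v = Some a"
    using assms by (metis map_of_zip_is_Some)
  then show "asg e vs c v = asg e' vs c v" by (simp add: asg_def)
  have "(v, a) \<in> set (zip vs c)" using a by (rule map_of_SomeD)
  then show "asg e vs c v \<in> set c" using a by (auto simp: asg_def dest: set_zip_rightD)
qed

lemma asg_map:
  assumes "\<forall>v. v \<notin> set vs \<longrightarrow> e' v = e v"
  shows "asg e vs (map e' vs) = e'"
proof
  fix v
  show "asg e vs (map e' vs) v = e' v"
    using assms by (cases "v \<in> set vs") (auto simp: asg_def map_of_zip_map)
qed

lemma map_asg:
  assumes "distinct vs" "length c = length vs"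
  shows "map (asg e vs c) vs = c"
  using assms by (intro nth_equalityI) (auto simp: asg_def map_of_zip_nth)

lemma asg_singleton: "asg e [v] [c] = e(v := c)"
  by (auto simp: asg_def)

section \<open>Realizing types in countably many variables\<close>

lemma monster_countably_saturated:
  assumes "monster_model L \<kappa> U" "countable A" "A \<subseteq> Dom U" "\<pi> \<subseteq> par_formulas L A [0]"
    "\<And>\<pi>'. \<pi>' \<subseteq> \<pi> \<Longrightarrow> finite \<pi>' \<Longrightarrow> realizations U [0] \<pi>' \<noteq> {}"
  shows "realizations U [0] \<pi> \<noteq> {}"
proof -
  have "|A| <o \<kappa>"
    using assms(1,2) countable_card_le_natLeq[of A] ordLeq_ordLess_trans
    by (auto simp: monster_model_def)
  then show ?thesis
    using assms unfolding monster_model_def saturated_def by blast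
qed

text \<open>Finite satisfiability of a type whose unknowns are the possibly infinitely many
  variables in \<open>V\<close>; the variables outside \<open>V\<close> are parameters with the
  values \<open>e\<close>.\<close>

definition extendable ::
  "('f, 'r, 'a) struc \<Rightarrow> ('f, 'r) fm set \<Rightarrow> nat set \<Rightarrow> (nat \<Rightarrow> 'a) \<Rightarrow> bool" where
  "extendable U \<Gamma> V e \<longleftrightarrow> range e \<subseteq> Dom U \<and>
     (\<forall>\<Gamma>0\<subseteq>\<Gamma>. finite \<Gamma>0 \<longrightarrow>
        (\<exists>e'. (\<forall>v. v \<notin> V \<longrightarrow> e' v = e v) \<and> range e' \<subseteq> Dom U \<and> (\<forall>\<psi>\<in>\<Gamma>0. sat U e' \<psi>)))"

lemma extendableD:
  assumes "extendable U \<Gamma> V e" "\<Gamma>0 \<subseteq> \<Gamma>" "finite \<Gamma>0"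
  obtains e' where "\<And>v. v \<notin> V \<Longrightarrow> e' v = e v" "range e' \<subseteq> Dom U" "\<And>\<psi>. \<psi> \<in> \<Gamma>0 \<Longrightarrow> sat U e' \<psi>"
  using assms unfolding extendable_def by meson

text \<open>A value for \<open>v\<close> must leave every finite part of \<open>\<Gamma>\<close>
  solvable in the remaining unknowns. This is a type in the single variable \<open>v\<close>: in
  each finite conjunction the remaining unknowns are quantified existentially.\<close>

lemma extendable_step:
  fixes e :: "nat \<Rightarrow> 'a"
  assumes mon: "monster_model L \<kappa> U" and form: "\<And>\<psi>. \<psi> \<in> \<Gamma> \<Longrightarrow> is_formula L \<psi>"
    and ext: "extendable U \<Gamma> V e" and v: "v \<in> V"
  shows "\<exists>a. extendable U \<Gamma> (V - {v}) (e(v := a))"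
proof -
  \<comment> \<open>\<open>saturated\<close> speaks of variable 0, so \<open>v\<close> and 0 are
    exchanged.\<close>
  define \<tau> where "\<tau> = (\<lambda>x. if x = 0 then v else if x = v then 0 else x)"
  have inj: "inj \<tau>" by (auto simp: \<tau>_def inj_def)
  define vs where "vs = (\<lambda>\<psi>s :: ('b, 'c) fm list. sorted_list_of_set ((V - {v}) \<inter> fvars (conj_list \<psi>s)))"
  have set_vs: "set (vs \<psi>s) = (V - {v}) \<inter> fvars (conj_list \<psi>s)" for \<psi>s
    by (simp add: vs_def finite_fvars)
  define q where "q = (\<lambda>\<psi>s. fren \<tau> (ex_list (vs \<psi>s) (conj_list \<psi>s)))"
  define \<pi> where "\<pi> = {(q \<psi>s, e \<circ> \<tau>) | \<psi>s. set \<psi>s \<subseteq> \<Gamma>}"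
  have rng: "range e \<subseteq> Dom U" using ext by (simp add: extendable_def)
  have sat_q: "sat U (asg (e \<circ> \<tau>) [0] [c]) (q \<psi>s)
      \<longleftrightarrow> sat U (e(v := c)) (ex_list (vs \<psi>s) (conj_list \<psi>s))" for c \<psi>s
  proof -
    have "asg (e \<circ> \<tau>) [0] [c] \<circ> \<tau> = e(v := c)"
      unfolding asg_singleton by (auto simp: \<tau>_def fun_eq_iff)
    then show ?thesis by (simp only: q_def sat_fren[OF inj])
  qed
  have "realizations U [0] \<pi> \<noteq> {}"
  proof (rule monster_countably_saturated[OF mon])
    show "countable (range e)" by simp
    show "\<pi> \<subseteq> par_formulas L (range e) [0]"
      by (auto simp: \<pi>_def par_formulas_def q_def is_formula_fren form subset_iff)
    fix \<pi>' assume \<pi>': "\<pi>' \<subseteq> \<pi>" "finite \<pi>'"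
    have "\<forall>p\<in>\<pi>'. \<exists>\<psi>s. p = (q \<psi>s, e \<circ> \<tau>) \<and> set \<psi>s \<subseteq> \<Gamma>"
      using \<pi>'(1) by (auto simp: \<pi>_def)
    then obtain l where l: "\<And>p. p \<in> \<pi>' \<Longrightarrow> p = (q (l p), e \<circ> \<tau>) \<and> set (l p) \<subseteq> \<Gamma>"
      by metis
    \<comment> \<open>Finitely many members of \<open>\<pi>\<close> draw on finitely many members of
      \<open>\<Gamma>\<close>, and one assignment solving these witnesses all the existential
      closures.\<close>
    have "(\<Union>p\<in>\<pi>'. set (l p)) \<subseteq> \<Gamma>" "finite (\<Union>p\<in>\<pi>'. set (l p))"
      using l \<pi>'(2) by auto
    then obtain e' where e': "\<And>u. u \<notin> V \<Longrightarrow> e' u = e u" "range e' \<subseteq> Dom U"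
        "\<And>\<psi>. \<psi> \<in> (\<Union>p\<in>\<pi>'. set (l p)) \<Longrightarrow> sat U e' \<psi>"
      using extendableD[OF ext] by blast
    have "sat U (asg (e \<circ> \<tau>) [0] [e' v]) (q (l p))" if p: "p \<in> \<pi>'" for p
      unfolding sat_q sat_ex_list
    proof (intro exI conjI)
      let ?e = "\<lambda>u. if u \<in> set (vs (l p)) then e' u else (e(v := e' v)) u"
      show "\<forall>u. u \<notin> set (vs (l p)) \<longrightarrow> ?e u = (e(v := e' v)) u" by simp
      show "\<forall>u\<in>set (vs (l p)). ?e u \<in> Dom U" using e'(2) by auto
      have "sat U e' (conj_list (l p))" using e'(3) p by auto
      moreover have "sat U ?e (conj_list (l p)) = sat U e' (conj_list (l p))"
        by (rule sat_cong) (use e'(1) in \<open>auto simp: set_vs\<close>)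
      ultimately show "sat U ?e (conj_list (l p))" by simp
    qed
    then have "[e' v] \<in> realizations U [0] \<pi>'"
      using l e'(2) by (fastforce simp: realizations_def tuples_def)
    then show "realizations U [0] \<pi>' \<noteq> {}" by blast
  qed (rule rng)
  then obtain c where c: "c \<in> Dom U" "\<And>\<psi>s. set \<psi>s \<subseteq> \<Gamma> \<Longrightarrow> sat U (asg (e \<circ> \<tau>) [0] [c]) (q \<psi>s)"
    by (fastforce simp: realizations_def tuples_def \<pi>_def length_Suc_conv)
  have "extendable U \<Gamma> (V - {v}) (e(v := c))"
    unfolding extendable_def
  proof (intro conjI allI impI)
    show "range (e(v := c)) \<subseteq> Dom U" using rng c(1) by auto
    fix \<Gamma>0 assume "\<Gamma>0 \<subseteq> \<Gamma>" "finite \<Gamma>0"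
    then obtain \<psi>s where \<psi>s: "set \<psi>s = \<Gamma>0" using finite_list by blast
    then have "sat U (e(v := c)) (ex_list (vs \<psi>s) (conj_list \<psi>s))"
      using c(2)[of \<psi>s] \<open>\<Gamma>0 \<subseteq> \<Gamma>\<close> unfolding sat_q by simp
    then obtain e' where e': "\<forall>u. u \<notin> set (vs \<psi>s) \<longrightarrow> e' u = (e(v := c)) u"
      "\<forall>u\<in>set (vs \<psi>s). e' u \<in> Dom U" "sat U e' (conj_list \<psi>s)"
      unfolding sat_ex_list by blast
    show "\<exists>e'. (\<forall>u. u \<notin> V - {v} \<longrightarrow> e' u = (e(v := c)) u) \<and> range e' \<subseteq> Dom U \<and> (\<forall>\<psi>\<in>\<Gamma>0. sat U e' \<psi>)"
    proof (intro exI conjI)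
      show "\<forall>u. u \<notin> V - {v} \<longrightarrow> e' u = (e(v := c)) u" using e'(1) by (auto simp: set_vs)
      show "range e' \<subseteq> Dom U"
      proof
        fix x assume "x \<in> range e'"
        then obtain u where "x = e' u" by blast
        then show "x \<in> Dom U" using e'(1,2) rng c(1) by (cases "u \<in> set (vs \<psi>s)") auto
      qed
      show "\<forall>\<psi>\<in>\<Gamma>0. sat U e' \<psi>" using e'(3) \<psi>s by simp
    qed
  qed
  then show ?thesis by blast
qed

text \<open>Unknowns are fixed one after the other in the order of their indices. A formula has
  finitely many free variables, so all of its unknowns are settled at a finite stage, at which it is
  still solvable.\<close>

lemma monster_realizes:
  fixes e :: "nat \<Rightarrow> 'a"
  assumes mon: "monster_model L \<kappa> U" and form: "\<And>\<psi>. \<psi> \<in> \<Gamma> \<Longrightarrow> is_formula L \<psi>"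
    and ext: "extendable U \<Gamma> V e"
  shows "\<exists>e'. (\<forall>v. v \<notin> V \<longrightarrow> e' v = e v) \<and> range e' \<subseteq> Dom U \<and> (\<forall>\<psi>\<in>\<Gamma>. sat U e' \<psi>)"
proof -
  have "\<exists>f. \<forall>n. (extendable U \<Gamma> (V - {..<n}) (f n) \<and> (n = 0 \<longrightarrow> f n = e)) \<and>
          (\<exists>a. f (Suc n) = (f n)(n := a) \<and> (n \<notin> V \<longrightarrow> f (Suc n) = f n))"
  proof (rule dependent_nat_choice)
    show "\<exists>x. extendable U \<Gamma> (V - {..<0}) x \<and> (0 = 0 \<longrightarrow> x = e)" using ext by simp
    fix x :: "nat \<Rightarrow> 'a" and n
    assume x: "extendable U \<Gamma> (V - {..<n}) x \<and> (n = 0 \<longrightarrow> x = e)"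
    have *: "V - {..<Suc n} = V - {..<n} - {n}" by auto
    show "\<exists>y. (extendable U \<Gamma> (V - {..<Suc n}) y \<and> (Suc n = 0 \<longrightarrow> y = e)) \<and>
        (\<exists>a. y = x(n := a) \<and> (n \<notin> V \<longrightarrow> y = x))"
    proof (cases "n \<in> V")
      case True
      then have "n \<in> V - {..<n}" by simp
      from extendable_step[OF mon form _ this] x obtain a
        where "extendable U \<Gamma> (V - {..<Suc n}) (x(n := a))" unfolding * by blast
      then show ?thesis using True by blast
    next
      case False
      then have "V - {..<Suc n} = V - {..<n}" unfolding * by auto
      then show ?thesis using x False by (intro exI[of _ x]) (auto intro: exI[of _ "x n"])
    qed
  qed
  then obtain f where f': "\<And>n. (extendable U \<Gamma> (V - {..<n}) (f n) \<and> (n = 0 \<longrightarrow> f n = e)) \<and>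
          (\<exists>a. f (Suc n) = (f n)(n := a) \<and> (n \<notin> V \<longrightarrow> f (Suc n) = f n))"
    by blast
  have f: "\<And>n. extendable U \<Gamma> (V - {..<n}) (f n)" "f 0 = e"
    "\<And>n. \<exists>a. f (Suc n) = (f n)(n := a)" "\<And>n. n \<notin> V \<Longrightarrow> f (Suc n) = f n"
    using f' by blast+
  have same: "f m u = f n u" if "m \<ge> n" "\<And>k. n \<le> k \<Longrightarrow> k < m \<Longrightarrow> k \<noteq> u" for m n u
    using that
  proof (induction m rule: dec_induct)
    case (step k)
    obtain a where a: "f (Suc k) = (f k)(k := a)" using f(3) by blast
    have "k \<noteq> u" using step.prems[of k] step.hyps by auto
    then have "f (Suc k) u = f k u" using a by simp
    then show ?case using step.IH step.prems by simp
  qed simp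
  \<comment> \<open>From stage \<open>n + 1\<close> on, variable \<open>n\<close> never changes, so
    the diagonal is the limit of the stages.\<close>
  define g where "g = (\<lambda>n. f (Suc n) n)"
  have g_eq: "g u = f n u" if "u < n" for u n
    unfolding g_def using that by (intro same[symmetric]) auto
  show ?thesis
  proof (intro exI[of _ g] conjI allI impI ballI)
    fix v assume "v \<notin> V"
    then have "g v = f v v" using f(4) by (simp add: g_def)
    then show "g v = e v" using same[of 0 v v] f(2) by simp
  next
    show "range g \<subseteq> Dom U" using f(1) by (auto simp: g_def extendable_def)
  next
    fix \<psi> assume \<psi>: "\<psi> \<in> \<Gamma>"
    obtain n where n: "\<forall>v\<in>fvars \<psi>. v < n"
      using finite_fvars finite_nat_set_iff_bounded by blast
    have sub: "{\<psi>} \<subseteq> \<Gamma>" using \<psi> by simp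
    obtain e' where e': "\<And>v. v \<notin> V - {..<n} \<Longrightarrow> e' v = f n v"
      and sat: "\<And>\<theta>. \<theta> \<in> {\<psi>} \<Longrightarrow> sat U e' \<theta>"
      by (rule extendableD[OF f(1)[of n] sub]) (simp, rule that)
    have "sat U g \<psi> = sat U e' \<psi>"
    proof (rule sat_cong)
      fix v assume "v \<in> fvars \<psi>"
      then have "v < n" using n by blast
      then show "g v = e' v" using e' g_eq by simp
    qed
    then show "sat U g \<psi>" using sat by simp
  qed
qed

text \<open>Variables are tagged with (the code of) their value. Keeping the variable in the tag makes the
  renaming injective, so that bound variables are not captured.\<close>

lemma common_parameters:
  fixes M :: "'a set"
  assumes "countable M" "M \<noteq> {}"
  shows "\<exists>\<epsilon>. range \<epsilon> \<subseteq> M \<and> (\<forall>\<psi> e. (\<psi>, e) \<in> par_formulas L M vs \<longrightarrow>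
      (\<exists>\<theta>. is_formula L \<theta> \<and> (\<forall>U c. length c = length vs \<longrightarrow> sat U (asg e vs c) \<psi> = sat U (asg \<epsilon> vs c) \<theta>)))"
proof -
  obtain K where K: "\<forall>v\<in>set vs. v < K"
    using finite_nat_set_iff_bounded by blast
  define \<epsilon> where "\<epsilon> = (\<lambda>n. from_nat_into M (snd (prod_decode (n - K))))"
  show ?thesis
  proof (intro exI[of _ \<epsilon>] conjI allI impI)
    show "range \<epsilon> \<subseteq> M" using from_nat_into[OF assms(2)] by (auto simp: \<epsilon>_def)
    fix \<psi> :: "('b, 'c) fm" and e :: "nat \<Rightarrow> 'a" assume pf: "(\<psi>, e) \<in> par_formulas L M vs"
    \<comment> \<open>The offset \<open>K\<close> keeps the tagged variables apart from
      \<open>vs\<close>, whose names stay. For bound variables \<open>e v\<close> may lie outside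
      \<open>M\<close> and its code be meaningless; injectivity survives because the tag contains
      \<open>v\<close>.\<close>
    define h where "h = (\<lambda>v. if v \<in> set vs then v else K + prod_encode (v, to_nat_on M (e v)))"
    have inj: "inj h"
    proof (rule injI)
      fix u v assume "h u = h v"
      then show "u = v" using K by (force simp: h_def split: if_splits)
    qed
    show "\<exists>\<theta>. is_formula L \<theta> \<and> (\<forall>U c. length c = length vs \<longrightarrow> sat U (asg e vs c) \<psi> = sat U (asg \<epsilon> vs c) \<theta>)"
    proof (intro exI[of _ "fren h \<psi>"] conjI allI impI)
      show "is_formula L (fren h \<psi>)" using pf by (simp add: is_formula_fren par_formulas_def)
      fix U :: "('b, 'c, 'a) struc" and c :: "'a list" assume len: "length c = length vs"
      show "sat U (asg e vs c) \<psi> = sat U (asg \<epsilon> vs c) (fren h \<psi>)"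
        unfolding sat_fren[OF inj]
      proof (rule sat_cong)
        fix v assume v: "v \<in> fvars \<psi>"
        show "asg e vs c v = (asg \<epsilon> vs c \<circ> h) v"
        proof (cases "v \<in> set vs")
          case True
          then show ?thesis using asg_in(1)[OF True len] by (simp add: h_def)
        next
          case False
          then have "e v \<in> M" using v pf by (auto simp: par_formulas_def)
          moreover have "h v \<notin> set vs" using False K by (force simp: h_def)
          ultimately show ?thesis
            using False len assms(1) by (simp add: asg_notin h_def \<epsilon>_def)
        qed
      qed
    qed
  qed
qed

text \<open>Each formula of \<open>\<pi>\<close> comes with its own assignment of parameters. Under
  the common \<open>\<epsilon>\<close> the type becomes a set of \<open>L\<close>-formulas with
  unknowns \<open>vs\<close> and all other variables fixed, the situation of
  \<open>monster_realizes\<close>.\<close>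

lemma tuple_saturation:
  assumes mon: "monster_model L \<kappa> U" and M: "countable M" "M \<noteq> {}" "M \<subseteq> Dom U"
    and vs: "distinct vs" and \<pi>: "\<pi> \<subseteq> par_formulas L M vs"
    and fin: "\<And>\<pi>'. \<pi>' \<subseteq> \<pi> \<Longrightarrow> finite \<pi>' \<Longrightarrow> realizations U vs \<pi>' \<noteq> {}"
  shows "realizations U vs \<pi> \<noteq> {}"
proof -
  obtain \<epsilon> where \<epsilon>: "range \<epsilon> \<subseteq> M"
    and "\<forall>\<psi> e. (\<psi>, e) \<in> par_formulas L M vs \<longrightarrow>
      (\<exists>\<theta>. is_formula L \<theta> \<and> (\<forall>U c. length c = length vs \<longrightarrow> sat U (asg e vs c) \<psi> = sat U (asg \<epsilon> vs c) \<theta>))"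
    using common_parameters[OF M(1,2), of L vs] by (elim exE conjE) (rule that)
  then have "\<exists>\<theta>. is_formula L \<theta> \<and> (\<forall>c. length c = length vs \<longrightarrow>
      sat U (asg (snd p) vs c) (fst p) = sat U (asg \<epsilon> vs c) \<theta>)" if "p \<in> \<pi>" for p
    using \<pi> that by (cases p) fastforce
  then obtain t where t: "\<And>p. p \<in> \<pi> \<Longrightarrow> is_formula L (t p)"
    "\<And>p c. p \<in> \<pi> \<Longrightarrow> length c = length vs \<Longrightarrow>
      sat U (asg (snd p) vs c) (fst p) = sat U (asg \<epsilon> vs c) (t p)"
    by metis
  have "extendable U (t ` \<pi>) (set vs) \<epsilon>"
    unfolding extendable_def
  proof (intro conjI allI impI)
    show "range \<epsilon> \<subseteq> Dom U" using \<epsilon> M(3) by auto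
    fix \<Gamma>0 assume "\<Gamma>0 \<subseteq> t ` \<pi>" "finite \<Gamma>0"
    then obtain \<pi>' where \<pi>': "\<pi>' \<subseteq> \<pi>" "finite \<pi>'" "\<Gamma>0 = t ` \<pi>'"
      by (meson finite_subset_image)
    then obtain c where c: "c \<in> realizations U vs \<pi>'" using fin by blast
    then have len: "length c = length vs" "set c \<subseteq> Dom U" by (auto simp: realizations_def tuples_def)
    show "\<exists>e'. (\<forall>v. v \<notin> set vs \<longrightarrow> e' v = \<epsilon> v) \<and> range e' \<subseteq> Dom U \<and> (\<forall>\<psi>\<in>\<Gamma>0. sat U e' \<psi>)"
    proof (intro exI[of _ "asg \<epsilon> vs c"] conjI allI impI ballI)
      fix v assume "v \<notin> set vs"
      then show "asg \<epsilon> vs c v = \<epsilon> v" using len by (simp add: asg_notin)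
    next
      show "range (asg \<epsilon> vs c) \<subseteq> Dom U"
      proof
        fix x assume "x \<in> range (asg \<epsilon> vs c)"
        then obtain v where "x = asg \<epsilon> vs c v" by blast
        then show "x \<in> Dom U"
          using asg_in(2)[of v vs c \<epsilon>] asg_notin[of v vs c \<epsilon>] len \<epsilon> M(3) by (cases "v \<in> set vs") auto
      qed
    next
      fix \<psi> assume "\<psi> \<in> \<Gamma>0"
      then obtain p where p: "p \<in> \<pi>'" "\<psi> = t p" using \<pi>'(3) by blast
      then have "sat U (asg (snd p) vs c) (fst p)" using c by (auto simp: realizations_def)
      then show "sat U (asg \<epsilon> vs c) \<psi>" using t(2)[of p c] p \<pi>'(1) len by auto
    qed
  qed
  from monster_realizes[OF mon _ this] obtain e'
    where e': "\<forall>v. v \<notin> set vs \<longrightarrow> e' v = \<epsilon> v" "range e' \<subseteq> Dom U" "\<forall>\<psi>\<in>t ` \<pi>. sat U e' \<psi>"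
    using t(1) by blast
  have "asg \<epsilon> vs (map e' vs) = e'" by (rule asg_map[OF e'(1)])
  then have "sat U (asg (snd p) vs (map e' vs)) (fst p)" if "p \<in> \<pi>" for p
    using t(2)[OF that, of "map e' vs"] e'(3) that by simp
  moreover have "map e' vs \<in> tuples (Dom U) (length vs)" using e'(2) by (auto simp: tuples_def)
  ultimately have "map e' vs \<in> realizations U vs \<pi>"
    unfolding realizations_def by (simp add: split_beta)
  then show ?thesis by blast
qed

section \<open>Types over a countable set\<close>

lemma beval_cong: "(\<And>b. b \<in> set_bform \<psi> \<Longrightarrow> v b = v' b) \<Longrightarrow> beval v \<psi> = beval v' \<psi>"
  by (induction \<psi>) auto

lemma finite_set_bform: "finite (set_bform \<psi>)"
  by (induction \<psi>) auto

text \<open>Case distinction on one member of \<open>X\<close> at a time. \<open>bform\<close> has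
  no constants, so a point of \<open>Y\<close> is borrowed to write down a contradiction.\<close>

lemma pattern_bform:
  assumes "finite X" "X \<subseteq> Y" "Y \<noteq> {}"
  shows "\<exists>\<psi>. set_bform \<psi> \<subseteq> Y \<and> (\<forall>v. beval v \<psi> \<longleftrightarrow> {a \<in> X. v a} \<in> \<P>)"
  using assms(1,2)
proof (induction X arbitrary: \<P> rule: finite_induct)
  case empty
  obtain y where y: "y \<in> Y" using assms(3) by blast
  define F where "F = BAnd (Inst y) (BNot (Inst y))"
  show ?case
    by (rule exI[of _ "if {} \<in> \<P> then BNot F else F"]) (use y in \<open>simp add: F_def\<close>)
next
  case (insert x X)
  obtain \<psi>0 where \<psi>0: "set_bform \<psi>0 \<subseteq> Y" "\<And>v. beval v \<psi>0 \<longleftrightarrow> {a \<in> X. v a} \<in> \<P>"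
    using insert.IH[of \<P>] insert.prems by auto
  obtain \<psi>1 where \<psi>1: "set_bform \<psi>1 \<subseteq> Y" "\<And>v. beval v \<psi>1 \<longleftrightarrow> {a \<in> X. v a} \<in> {E. insert x E \<in> \<P>}"
    using insert.IH[of "{E. insert x E \<in> \<P>}"] insert.prems by auto
  have eq: "{a \<in> insert x X. v a} = (if v x then insert x {a \<in> X. v a} else {a \<in> X. v a})" for v
    by auto
  show ?case
  proof (intro exI[of _ "BOr (BAnd (Inst x) \<psi>1) (BAnd (BNot (Inst x)) \<psi>0)"] conjI allI)
    show "set_bform (BOr (BAnd (Inst x) \<psi>1) (BAnd (BNot (Inst x)) \<psi>0)) \<subseteq> Y"
      using \<psi>0(1) \<psi>1(1) insert.prems by (simp add: BOr_def)
    show "beval v (BOr (BAnd (Inst x) \<psi>1) (BAnd (BNot (Inst x)) \<psi>0)) \<longleftrightarrow> {a \<in> insert x X. v a} \<in> \<P>" for v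
      unfolding eq by (simp add: BOr_def \<psi>0(2) \<psi>1(2))
  qed
qed

section \<open>Closed sets over the parameters and the space of opposite types\<close>

lemma closed_over_full: "tuples (Dom U) (length vs) \<in> closed_over L U vs M"
  unfolding closed_over_def realizations_def by (intro CollectI exI[of _ "{}"]) auto

lemma closed_over_INT:
  assumes "I \<noteq> {}" "\<And>i. i \<in> I \<Longrightarrow> C i \<in> closed_over L U vs M"
  shows "(\<Inter>i\<in>I. C i) \<in> closed_over L U vs M"
proof -
  have "\<exists>\<pi>. C i = realizations U vs \<pi> \<and> \<pi> \<subseteq> par_formulas L M vs" if "i \<in> I" for i
    using assms(2)[OF that] by (auto simp: closed_over_def)
  then obtain \<pi> where \<pi>: "\<And>i. i \<in> I \<Longrightarrow> C i = realizations U vs (\<pi> i)"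
    "\<And>i. i \<in> I \<Longrightarrow> \<pi> i \<subseteq> par_formulas L M vs" by metis
  have "(\<Inter>i\<in>I. C i) = realizations U vs (\<Union>i\<in>I. \<pi> i)"
    using assms(1) \<pi>(1) by (auto simp: realizations_def)
  then show ?thesis
    unfolding closed_over_def using \<pi>(2) by (intro CollectI exI conjI) auto
qed

lemma closed_over_Int:
  "C \<in> closed_over L U vs M \<Longrightarrow> D \<in> closed_over L U vs M \<Longrightarrow> C \<inter> D \<in> closed_over L U vs M"
  using closed_over_INT[of "{C, D}" "\<lambda>X. X" L U vs M] by auto

lemma sat_Form:
  assumes "is_pformula L \<phi>"
  shows "sat U f (Form \<phi>) \<longleftrightarrow> holds U \<phi> (map f (ObjVars \<phi>)) (map f (ParVars \<phi>))"
  unfolding holds_def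
proof (rule sat_cong)
  fix v assume "v \<in> fvars (Form \<phi>)"
  then have v: "v \<in> set (ObjVars \<phi>) \<or> v \<in> set (ParVars \<phi>)" using assms by (auto simp: is_pformula_def)
  let ?g = "asg (\<lambda>_. undefined) (ParVars \<phi>) (map f (ParVars \<phi>))"
  show "f v = asg ?g (ObjVars \<phi>) (map f (ObjVars \<phi>)) v"
  proof (cases "v \<in> set (ObjVars \<phi>)")
    case True
    then show ?thesis by (simp add: asg_def map_of_zip_map)
  next
    case False
    then show ?thesis using v by (simp add: asg_notin) (simp add: asg_def map_of_zip_map)
  qed
qed

lemma sat_asg_Form:
  assumes "is_pformula L \<phi>" "length a = xlen \<phi>" "length b = ylen \<phi>"
  shows "sat U (asg (asg e (ObjVars \<phi>) a) (ParVars \<phi>) b) (Form \<phi>) \<longleftrightarrow> holds U \<phi> a b"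
proof -
  have d: "distinct (ObjVars \<phi>)" "distinct (ParVars \<phi>)" "set (ObjVars \<phi>) \<inter> set (ParVars \<phi>) = {}"
    using assms(1) by (auto simp: is_pformula_def)
  have "map (asg (asg e (ObjVars \<phi>) a) (ParVars \<phi>) b) (ObjVars \<phi>) = map (asg e (ObjVars \<phi>) a) (ObjVars \<phi>)"
    using d(3) assms(3) by (intro map_cong refl asg_notin) auto
  then show ?thesis
    using d assms by (simp add: sat_Form[OF assms(1)] map_asg)
qed

lemma holds_opp:
  assumes "is_pformula L \<phi>" "length a = xlen \<phi>" "length b = ylen \<phi>"
  shows "holds U (opp \<phi>) b a \<longleftrightarrow> holds U \<phi> a b"
  unfolding holds_def[of U "opp \<phi>"] using sat_asg_Form[OF assms] by (simp add: opp_def)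

text \<open>\<open>M\<close> is any countable nonempty set of parameters, so that the locale also
  serves the coordinates of a shattered sequence in \<open>NIP_bounded_vc\<close>.\<close>

locale phi_setting =
  fixes L :: "('f, 'r) lang" and \<kappa> :: "'k rel" and U :: "('f, 'r, 'a) struc"
    and \<phi> :: "('f, 'r) pformula" and M :: "'a set"
  assumes mon: "monster_model L \<kappa> U" and pform: "is_pformula L \<phi>"
    and M: "countable M" "M \<noteq> {}" "M \<subseteq> Dom U"
begin

abbreviation pts :: "'a list set" where
  "pts \<equiv> tuples (Dom U) (ylen \<phi>)"

abbreviation insts :: "'a list set" where
  "insts \<equiv> tuples M (xlen \<phi>)"

lemma insts_nonempty: "insts \<noteq> {}"
proof -
  obtain m where "m \<in> M" using M(2) by blast
  then have "replicate (xlen \<phi>) m \<in> insts" by (auto simp: tuples_def)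
  then show ?thesis by blast
qed

lemma pts_nonempty: "pts \<noteq> {}"
proof -
  obtain m where "m \<in> Dom U" using M(2,3) by blast
  then have "replicate (ylen \<phi>) m \<in> pts" by (auto simp: tuples_def)
  then show ?thesis by blast
qed

lemma countable_insts: "countable insts"
proof -
  have "insts \<subseteq> lists M" by (auto simp: tuples_def)
  then show ?thesis using countable_lists[OF M(1)] countable_subset by blast
qed

definition literal :: "bool \<Rightarrow> 'a list \<Rightarrow> ('f, 'r) fm \<times> (nat \<Rightarrow> 'a)" where
  "literal P a = ((if P then Form \<phi> else Neg (Form \<phi>)), asg (\<lambda>_. undefined) (ObjVars \<phi>) a)"

lemma literal_par:
  assumes "a \<in> insts"
  shows "literal P a \<in> par_formulas L M (ParVars \<phi>)"
proof -
  have "asg (\<lambda>_. undefined) (ObjVars \<phi>) a v \<in> M"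
    if v: "v \<in> fvars (Form \<phi>) - set (ParVars \<phi>)" for v
  proof -
    have "v \<in> set (ObjVars \<phi>)" using v pform by (auto simp: is_pformula_def)
    then have "asg (\<lambda>_. undefined) (ObjVars \<phi>) a v \<in> set a"
      by (rule asg_in(2)) (use assms in \<open>simp add: tuples_def\<close>)
    then show ?thesis using assms by (auto simp: tuples_def)
  qed
  then show ?thesis using pform by (simp add: literal_def par_formulas_def is_pformula_def)
qed

lemma sat_literal:
  assumes "a \<in> insts" "b \<in> pts"
  shows "sat U (asg (snd (literal P a)) (ParVars \<phi>) b) (fst (literal P a)) \<longleftrightarrow> (holds U \<phi> a b \<longleftrightarrow> P)"
  using sat_asg_Form[OF pform, of a b U "\<lambda>_. undefined"] assms by (simp add: literal_def tuples_def)

text \<open>The main form in which saturation is used: literals over \<open>insts\<close> are added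
  to the type defining \<open>C\<close>, and that type may consist of arbitrary formulas over
  \<open>M\<close>.\<close>

lemma realize_pattern:
  assumes C: "C \<in> closed_over L U (ParVars \<phi>) M" and a: "\<And>i. i \<in> I \<Longrightarrow> a i \<in> insts"
    and fin: "\<And>J. J \<subseteq> I \<Longrightarrow> finite J \<Longrightarrow> \<exists>b\<in>C. \<forall>i\<in>J. holds U \<phi> (a i) b \<longleftrightarrow> P i"
  shows "\<exists>b\<in>C. \<forall>i\<in>I. holds U \<phi> (a i) b \<longleftrightarrow> P i"
proof -
  obtain \<pi> where \<pi>: "C = realizations U (ParVars \<phi>) \<pi>" "\<pi> \<subseteq> par_formulas L M (ParVars \<phi>)"
    using C by (auto simp: closed_over_def)
  define lit where "lit = (\<lambda>i. literal (P i) (a i))"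
  have char: "b \<in> realizations U (ParVars \<phi>) (\<pi>' \<union> lit ` J) \<longleftrightarrow>
      b \<in> realizations U (ParVars \<phi>) \<pi>' \<and> (\<forall>i\<in>J. holds U \<phi> (a i) b \<longleftrightarrow> P i)" if "J \<subseteq> I" for b \<pi>' J
    using that a sat_literal unfolding realizations_def lit_def
    by (auto simp: split_beta ball_Un subset_iff)
  have "realizations U (ParVars \<phi>) (\<pi> \<union> lit ` I) \<noteq> {}"
  proof (rule tuple_saturation[OF mon M])
    show "distinct (ParVars \<phi>)" using pform by (simp add: is_pformula_def)
    show "\<pi> \<union> lit ` I \<subseteq> par_formulas L M (ParVars \<phi>)"
      using \<pi>(2) a literal_par by (auto simp: lit_def)
    fix \<pi>' assume \<pi>': "\<pi>' \<subseteq> \<pi> \<union> lit ` I" "finite \<pi>'"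
    then obtain J where J: "J \<subseteq> I" "finite J" "\<pi>' \<inter> lit ` I = lit ` J"
      by (meson finite_Int finite_subset_image inf_le2)
    obtain b where "b \<in> C" "\<forall>i\<in>J. holds U \<phi> (a i) b \<longleftrightarrow> P i" using fin[OF J(1,2)] by blast
    then have "b \<in> realizations U (ParVars \<phi>) (\<pi> \<union> lit ` J)"
      using char[OF J(1)] \<pi>(1) by simp
    moreover have "\<pi>' \<subseteq> \<pi> \<union> lit ` J" using \<pi>'(1) J(3) by blast
    ultimately show "realizations U (ParVars \<phi>) \<pi>' \<noteq> {}"
      unfolding realizations_def by blast
  qed
  then obtain b where "b \<in> realizations U (ParVars \<phi>) (\<pi> \<union> lit ` I)" by blast
  then have "b \<in> C \<and> (\<forall>i\<in>I. holds U \<phi> (a i) b \<longleftrightarrow> P i)"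
    unfolding char[OF subset_refl] \<pi>(1) .
  then show ?thesis by blast
qed

lemma phi_formulas_opp: "\<psi> \<in> phi_formulas (opp \<phi>) M \<longleftrightarrow> set_bform \<psi> \<subseteq> insts"
  by (simp add: phi_formulas_def opp_def)

text \<open>Instances with different parameters compete for the variables \<open>x\<close>. Under
  the common \<open>\<epsilon>\<close> they turn into formulas that can be negated and
  conjoined.\<close>

lemma bsat_closed_over:
  assumes "\<psi> \<in> phi_formulas (opp \<phi>) M"
  shows "{b \<in> pts. bsat U (opp \<phi>) b \<psi>} \<in> closed_over L U (ParVars \<phi>) M"
proof -
  obtain \<epsilon> where \<epsilon>: "range \<epsilon> \<subseteq> M"
    and common: "\<forall>\<psi> e. (\<psi>, e) \<in> par_formulas L M (ParVars \<phi>) \<longrightarrow>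
      (\<exists>\<theta>. is_formula L \<theta> \<and> (\<forall>U c. length c = ylen \<phi> \<longrightarrow>
        sat U (asg e (ParVars \<phi>) c) \<psi> = sat U (asg \<epsilon> (ParVars \<phi>) c) \<theta>))"
    using common_parameters[OF M(1,2), of L "ParVars \<phi>"] by (elim exE conjE) (rule that)
  have "\<exists>\<theta>. is_formula L \<theta> \<and> (\<forall>b\<in>pts. sat U (asg \<epsilon> (ParVars \<phi>) b) \<theta> \<longleftrightarrow> bsat U (opp \<phi>) b \<psi>)"
    if "set_bform \<psi> \<subseteq> insts" for \<psi>
    using that
  proof (induction \<psi>)
    case (Inst a)
    then have a: "a \<in> insts" by simp
    obtain \<theta> where \<theta>: "is_formula L \<theta>" "\<And>U c. length c = ylen \<phi> \<Longrightarrow>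
        sat U (asg (snd (literal True a)) (ParVars \<phi>) c) (fst (literal True a)) = sat U (asg \<epsilon> (ParVars \<phi>) c) \<theta>"
      using common literal_par[OF a, of True] by (metis prod.collapse)
    have "sat U (asg \<epsilon> (ParVars \<phi>) b) \<theta> \<longleftrightarrow> bsat U (opp \<phi>) b (Inst a)" if "b \<in> pts" for b
      using \<theta>(2)[of b U] sat_literal[OF a that, of True] holds_opp[OF pform, of a b U] a that
      by (simp add: bsat_def tuples_def)
    then show ?case using \<theta>(1) by blast
  next
    case (BNot \<psi>)
    then obtain \<theta> where "is_formula L \<theta>"
      "\<forall>b\<in>pts. sat U (asg \<epsilon> (ParVars \<phi>) b) \<theta> \<longleftrightarrow> bsat U (opp \<phi>) b \<psi>" by auto
    then show ?case by (intro exI[of _ "Neg \<theta>"]) (simp add: bsat_def)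
  next
    case (BAnd \<psi> \<psi>')
    then obtain \<theta> \<theta>' where "is_formula L \<theta>" "is_formula L \<theta>'"
      "\<forall>b\<in>pts. sat U (asg \<epsilon> (ParVars \<phi>) b) \<theta> \<longleftrightarrow> bsat U (opp \<phi>) b \<psi>"
      "\<forall>b\<in>pts. sat U (asg \<epsilon> (ParVars \<phi>) b) \<theta>' \<longleftrightarrow> bsat U (opp \<phi>) b \<psi>'" by auto
    then show ?case by (intro exI[of _ "Conj \<theta> \<theta>'"]) (simp add: bsat_def)
  qed
  then obtain \<theta> where \<theta>: "is_formula L \<theta>"
    "\<forall>b\<in>pts. sat U (asg \<epsilon> (ParVars \<phi>) b) \<theta> \<longleftrightarrow> bsat U (opp \<phi>) b \<psi>"
    using assms unfolding phi_formulas_opp by blast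
  have "{b \<in> pts. bsat U (opp \<phi>) b \<psi>} = realizations U (ParVars \<phi>) {(\<theta>, \<epsilon>)}"
    using \<theta>(2) by (auto simp: realizations_def)
  moreover have "{(\<theta>, \<epsilon>)} \<subseteq> par_formulas L M (ParVars \<phi>)"
    using \<theta>(1) \<epsilon> by (auto simp: par_formulas_def)
  ultimately show ?thesis unfolding closed_over_def by blast
qed

abbreviation types :: "'a list bform set set" where
  "types \<equiv> phi_types U (opp \<phi>) M"

abbreviation tp :: "'a list \<Rightarrow> 'a list bform set" where
  "tp \<equiv> phi_tp U (opp \<phi>) M"

lemma Inst_in_tp:
  assumes "a \<in> insts" "b \<in> pts"
  shows "Inst a \<in> tp b \<longleftrightarrow> holds U \<phi> a b"
  using assms holds_opp[OF pform, of a b U]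
  by (simp add: phi_tp_def phi_formulas_def bsat_def opp_def tuples_def)

lemma tp_in_types:
  assumes "b \<in> pts"
  shows "tp b \<in> types"
  using assms
  by (auto simp: phi_types_def phi_tp_def phi_formulas_def consistent_def bsat_def opp_def intro!: bexI[of _ b])

text \<open>Saturation realizes the literals in \<open>q\<close>. Boolean combinations follow,
  because a point satisfying \<open>\<psi>\<close> together with the literals on its parameters
  agrees with \<open>b\<close> on all instances in \<open>\<psi>\<close>.\<close>

lemma type_realized:
  assumes q: "q \<in> types"
  shows "\<exists>b\<in>pts. tp b = q"
proof -
  have cons: "\<exists>b\<in>pts. \<forall>\<psi>\<in>p0. bsat U (opp \<phi>) b \<psi>" if "p0 \<subseteq> q" "finite p0" for p0
    using q that by (auto simp: phi_types_def consistent_def opp_def)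
  have qf: "q \<subseteq> phi_formulas (opp \<phi>) M" "\<And>\<psi>. \<psi> \<in> phi_formulas (opp \<phi>) M \<Longrightarrow> \<psi> \<in> q \<or> BNot \<psi> \<in> q"
    using q by (auto simp: phi_types_def)
  have pf: "\<psi> \<in> phi_formulas (opp \<phi>) M \<longleftrightarrow> set_bform \<psi> \<subseteq> insts" for \<psi>
    by (simp add: phi_formulas_def opp_def)
  define lit where "lit = (\<lambda>a :: 'a list. if Inst a \<in> q then Inst a else BNot (Inst a))"
  have lit: "lit a \<in> q" if "a \<in> insts" for a
    using qf(2)[of "Inst a"] that by (auto simp: pf lit_def)
  have bsat_lit: "bsat U (opp \<phi>) b (lit a) \<longleftrightarrow> (holds U \<phi> a b \<longleftrightarrow> Inst a \<in> q)" if "a \<in> insts" "b \<in> pts" for a b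
    using that holds_opp[OF pform, of a b U] by (simp add: lit_def bsat_def tuples_def)
  have "\<exists>b\<in>pts. \<forall>a\<in>insts. holds U \<phi> a b \<longleftrightarrow> Inst a \<in> q"
  proof (rule realize_pattern[where a = "\<lambda>a. a", OF closed_over_full])
    fix J assume J: "J \<subseteq> insts" "finite J"
    have "lit ` J \<subseteq> q" "finite (lit ` J)" using J lit by auto
    then obtain b where "b \<in> pts" "\<forall>\<psi>\<in>lit ` J. bsat U (opp \<phi>) b \<psi>" using cons by blast
    then show "\<exists>b\<in>pts. \<forall>a\<in>J. holds U \<phi> a b \<longleftrightarrow> Inst a \<in> q" using bsat_lit J by blast
  qed
  then obtain b where b: "b \<in> pts" "\<And>a. a \<in> insts \<Longrightarrow> holds U \<phi> a b \<longleftrightarrow> Inst a \<in> q" by blast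
  have bq: "bsat U (opp \<phi>) b \<psi>" if \<psi>: "\<psi> \<in> q" for \<psi>
  proof -
    have sub: "set_bform \<psi> \<subseteq> insts" using \<psi> qf(1) pf by blast
    have "insert \<psi> (lit ` set_bform \<psi>) \<subseteq> q" using \<psi> sub lit by blast
    then obtain b' where b': "b' \<in> pts" "\<forall>\<theta>\<in>insert \<psi> (lit ` set_bform \<psi>). bsat U (opp \<phi>) b' \<theta>"
      using cons finite_set_bform by (metis finite_imageI finite_insert)
    have "holds U (opp \<phi>) b a = holds U (opp \<phi>) b' a" if a: "a \<in> set_bform \<psi>" for a
      using bsat_lit[of a b'] b'(2) a b(2)[of a] b'(1) b(1) sub
        holds_opp[OF pform, of a b U] holds_opp[OF pform, of a b' U]
      by (auto simp: tuples_def)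
    then have "bsat U (opp \<phi>) b \<psi> = bsat U (opp \<phi>) b' \<psi>"
      unfolding bsat_def by (rule beval_cong)
    then show ?thesis using b'(2) by simp
  qed
  have "tp b = q"
  proof
    show "q \<subseteq> tp b" using bq qf(1) by (auto simp: phi_tp_def)
    show "tp b \<subseteq> q"
    proof
      fix \<psi> assume \<psi>: "\<psi> \<in> tp b"
      then have "\<psi> \<in> q \<or> BNot \<psi> \<in> q" using qf(2) by (simp add: phi_tp_def)
      then show "\<psi> \<in> q" using bq[of "BNot \<psi>"] \<psi> by (auto simp: phi_tp_def bsat_def)
    qed
  qed
  then show ?thesis using b(1) by blast
qed

lemma topspace_stone: "topspace (stone_space U (opp \<phi>) M) = types"
proof -
  obtain a where a: "a \<in> insts" using insts_nonempty by blast
  have f: "Inst a \<in> phi_formulas (opp \<phi>) M" "BNot (Inst a) \<in> phi_formulas (opp \<phi>) M"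
    using a by (simp_all add: phi_formulas_def opp_def)
  have "types \<subseteq> \<Union>{{q \<in> types. \<psi> \<in> q} | \<psi>. \<psi> \<in> phi_formulas (opp \<phi>) M}"
  proof
    fix q assume q: "q \<in> types"
    then have "Inst a \<in> q \<or> BNot (Inst a) \<in> q" using f by (auto simp: phi_types_def)
    then show "q \<in> \<Union>{{q \<in> types. \<psi> \<in> q} | \<psi>. \<psi> \<in> phi_formulas (opp \<phi>) M}" using q f by blast
  qed
  then show ?thesis
    unfolding stone_space_def topology_generated_by_topspace by blast
qed

lemma mem_type_iff:
  assumes "b \<in> pts" "\<psi> \<in> phi_formulas (opp \<phi>) M"
  shows "\<psi> \<in> tp b \<longleftrightarrow> bsat U (opp \<phi>) b \<psi>"
  using assms by (simp add: phi_tp_def)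

end

section \<open>From NIP to a bound on shattered sequences\<close>

context
  fixes L :: "('f, 'r) lang" and \<kappa> :: "'k rel" and U :: "('f, 'r, 'a) struc"
    and \<phi> :: "('f, 'r) pformula"
  assumes mon: "monster_model L \<kappa> U" and pform: "is_pformula L \<phi>"
begin

text \<open>\<open>NIP\<close> forbids one infinite pattern, and compactness turns arbitrarily long
  finite ones into it. The sequence comes from a type in countably many variables saying that all
  patterns on its initial segments are realized; the uncountably many \<open>b E\<close> are then
  realized separately over it.\<close>

lemma NIP_bounded_vc:
  assumes nip: "NIP U \<phi>"
  shows "\<exists>d. \<forall>a. a ` {..<d} \<subseteq> tuples (Dom U) (xlen \<phi>) \<longrightarrow>
           \<not> vc_shattered (holds U \<phi>) (tuples (Dom U) (ylen \<phi>)) d a"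
proof (rule ccontr)
  assume "\<not> ?thesis"
  then have "\<forall>d. \<exists>a. a ` {..<d} \<subseteq> tuples (Dom U) (xlen \<phi>) \<and>
           vc_shattered (holds U \<phi>) (tuples (Dom U) (ylen \<phi>)) d a" by blast
  then obtain sa where sa: "\<And>d. sa d ` {..<d} \<subseteq> tuples (Dom U) (xlen \<phi>)"
    "\<And>d. vc_shattered (holds U \<phi>) (tuples (Dom U) (ylen \<phi>)) d (sa d)" by metis
  define xs where "xs = ObjVars \<phi>"
  define ys where "ys = ParVars \<phi>"
  have dist: "distinct xs" "distinct ys" "set xs \<inter> set ys = {}"
    using pform by (auto simp: is_pformula_def xs_def ys_def)
  have fF: "is_formula L (Form \<phi>)" using pform by (simp add: is_pformula_def)
  obtain c0 where c0: "c0 \<in> Dom U"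
    using mon by (auto simp: monster_model_def is_struc_def)
  obtain K where K: "\<And>v. v \<in> set ys \<Longrightarrow> v < K"
    using finite_nat_set_iff_bounded[of "set ys"] by blast
  \<comment> \<open>\<open>h i\<close> moves \<open>x\<close> to a block of variables for the
    \<open>i\<close>-th copy and leaves \<open>y\<close> in place, so that one quantification over
    \<open>y\<close> binds it in all copies.\<close>
  define h where "h = (\<lambda>i v. if v \<in> set ys then v else K + prod_encode (i, v))"
  have inj: "inj (h i)" for i
  proof (rule injI)
    fix u v assume "h i u = h i v"
    then show "u = v" using K[of u] K[of v] by (auto simp: h_def split: if_splits)
  qed
  have h_ys: "h i v = v" if "v \<in> set ys" for i v using that by (simp add: h_def)
  have h_xs: "h i v = K + prod_encode (i, v)" "h i v \<notin> set ys" if "v \<in> set xs" for i v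
  proof -
    have "v \<notin> set ys" using that dist(3) by blast
    then show "h i v = K + prod_encode (i, v)" by (simp add: h_def)
    then show "h i v \<notin> set ys" using K[of "h i v"] by auto
  qed
  have sat_h: "sat U f (fren (h i) (Form \<phi>)) \<longleftrightarrow> holds U \<phi> (map (\<lambda>v. f (h i v)) xs) (map f ys)" for f i
  proof -
    have "map (f \<circ> h i) ys = map f ys" by (intro map_cong) (simp_all add: h_ys)
    then show ?thesis
      unfolding sat_fren[OF inj] sat_Form[OF pform] xs_def[symmetric] ys_def[symmetric]
      by (simp only: comp_def)
  qed
  define lit where "lit = (\<lambda>i (\<sigma> :: nat set). if i \<in> \<sigma> then fren (h i) (Form \<phi>) else Neg (fren (h i) (Form \<phi>)))"
  define \<psi> where "\<psi> = (\<lambda>n \<sigma>. ex_list ys (conj_list (map (\<lambda>i. lit i \<sigma>) [0..<n])))"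
  have sat_lit: "sat U f (lit i \<sigma>) \<longleftrightarrow> (holds U \<phi> (map (\<lambda>v. f (h i v)) xs) (map f ys) \<longleftrightarrow> i \<in> \<sigma>)" for f i \<sigma>
    by (simp add: lit_def sat_h)
  have sat_\<psi>: "sat U f (\<psi> n \<sigma>) \<longleftrightarrow> (\<exists>b\<in>tuples (Dom U) (length ys). \<forall>i<n.
      holds U \<phi> (map (\<lambda>v. f (h i v)) xs) b \<longleftrightarrow> i \<in> \<sigma>)" (is "?l \<longleftrightarrow> ?r") for f n \<sigma>
  proof
    assume ?l
    then obtain f' where f': "\<forall>v. v \<notin> set ys \<longrightarrow> f' v = f v" "\<forall>v\<in>set ys. f' v \<in> Dom U"
      "\<forall>i<n. sat U f' (lit i \<sigma>)"
      unfolding \<psi>_def sat_ex_list by auto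
    have "map (\<lambda>v. f' (h i v)) xs = map (\<lambda>v. f (h i v)) xs" for i
      by (intro map_cong) (simp_all add: f'(1) h_xs(2))
    then have "\<forall>i<n. holds U \<phi> (map (\<lambda>v. f (h i v)) xs) (map f' ys) \<longleftrightarrow> i \<in> \<sigma>"
      using f'(3) by (simp add: sat_lit del: map_eq_conv)
    moreover have "map f' ys \<in> tuples (Dom U) (length ys)" using f'(2) by (auto simp: tuples_def)
    ultimately show ?r by blast
  next
    assume ?r
    then obtain b where b: "set b \<subseteq> Dom U" "length b = length ys"
      "\<And>i. i < n \<Longrightarrow> holds U \<phi> (map (\<lambda>v. f (h i v)) xs) b \<longleftrightarrow> i \<in> \<sigma>"
      by (auto simp: tuples_def)
    have "map (\<lambda>v. asg f ys b (h i v)) xs = map (\<lambda>v. f (h i v)) xs" for i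
      by (intro map_cong refl asg_notin) (simp_all add: h_xs(2) b(2))
    then have "\<forall>i<n. sat U (asg f ys b) (lit i \<sigma>)"
      using b(3) by (simp add: sat_lit map_asg[OF dist(2) b(2)] del: map_eq_conv)
    moreover have "\<forall>v. v \<notin> set ys \<longrightarrow> asg f ys b v = f v" using b(2) by (simp add: asg_notin)
    moreover have "\<forall>v\<in>set ys. asg f ys b v \<in> Dom U" using asg_in(2)[OF _ b(2)] b(1) by blast
    ultimately show ?l unfolding \<psi>_def sat_ex_list by (intro exI[of _ "asg f ys b"]) auto
  qed
  define \<Gamma> where "\<Gamma> = {\<psi> n \<sigma> | n \<sigma>. \<sigma> \<subseteq> {..<n}}"
  have "extendable U \<Gamma> UNIV (\<lambda>_. c0)"
    unfolding extendable_def
  proof (intro conjI allI impI)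
    show "range (\<lambda>_ :: nat. c0) \<subseteq> Dom U" using c0 by auto
    fix \<Gamma>0 assume \<Gamma>0: "\<Gamma>0 \<subseteq> \<Gamma>" "finite \<Gamma>0"
    have "\<forall>\<theta>\<in>\<Gamma>0. \<exists>p. \<theta> = \<psi> (fst p) (snd p) \<and> snd p \<subseteq> {..<fst p}"
      using \<Gamma>0(1) by (fastforce simp: \<Gamma>_def)
    then obtain p where p: "\<And>\<theta>. \<theta> \<in> \<Gamma>0 \<Longrightarrow> \<theta> = \<psi> (fst (p \<theta>)) (snd (p \<theta>)) \<and> snd (p \<theta>) \<subseteq> {..<fst (p \<theta>)}"
      by metis
    obtain m where "\<forall>k\<in>(\<lambda>\<theta>. fst (p \<theta>)) ` \<Gamma>0. k \<le> m"
      using \<Gamma>0(2) finite_nat_set_iff_bounded_le[of "(\<lambda>\<theta>. fst (p \<theta>)) ` \<Gamma>0"] by auto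
    then have m: "\<And>\<theta>. \<theta> \<in> \<Gamma>0 \<Longrightarrow> fst (p \<theta>) \<le> m" by blast
    \<comment> \<open>The finitely many formulas of \<open>\<Gamma>0\<close> concern copies below
      \<open>m\<close>; a shattered sequence of length \<open>m\<close> fills these blocks, and
      \<open>c0\<close> fills everything else.\<close>
    define f where "f = (\<lambda>w. let (i, v) = prod_decode (w - K) in
        if i < m \<and> v \<in> set xs then asg (\<lambda>_. c0) xs (sa m i) v else c0)"
    have len: "length (sa m i) = length xs" "set (sa m i) \<subseteq> Dom U" if "i < m" for i
      using sa(1)[of m] that by (auto simp: tuples_def xs_def)
    have fh: "map (\<lambda>v. f (h i v)) xs = sa m i" if i: "i < m" for i
    proof -
      have "map (\<lambda>v. f (h i v)) xs = map (asg (\<lambda>_. c0) xs (sa m i)) xs"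
        using i by (intro map_cong) (simp_all add: h_xs(1) f_def)
      then show ?thesis using map_asg[OF dist(1) len(1)[OF i]] by simp
    qed
    have "range f \<subseteq> Dom U"
    proof
      fix x assume "x \<in> range f"
      then obtain w where w: "x = f w" by blast
      obtain i v where iv: "prod_decode (w - K) = (i, v)" by fastforce
      show "x \<in> Dom U"
      proof (cases "i < m \<and> v \<in> set xs")
        case True
        then have "asg (\<lambda>_. c0) xs (sa m i) v \<in> set (sa m i)" using len by (intro asg_in(2)) auto
        then show ?thesis using w iv True len by (auto simp: f_def)
      next
        case False
        then show ?thesis using w iv c0 by (auto simp: f_def)
      qed
    qed
    moreover have "sat U f \<theta>" if \<theta>: "\<theta> \<in> \<Gamma>0" for \<theta>
    proof -
      define n \<sigma> where "n = fst (p \<theta>)" and "\<sigma> = snd (p \<theta>)"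
      have n: "\<theta> = \<psi> n \<sigma>" "\<sigma> \<subseteq> {..<n}" "n \<le> m" using p[OF \<theta>] m[OF \<theta>] by (simp_all add: n_def \<sigma>_def)
      have "\<sigma> \<subseteq> {..<m}" using n(2,3) by auto
      then obtain b where b: "b \<in> tuples (Dom U) (ylen \<phi>)" "\<forall>i<m. holds U \<phi> (sa m i) b \<longleftrightarrow> i \<in> \<sigma>"
        using sa(2)[of m] unfolding vc_shattered_def by blast
      then show ?thesis
        unfolding n(1) sat_\<psi> ys_def using fh n(3) by (intro bexI[of _ b]) auto
    qed
    ultimately show "\<exists>e'. (\<forall>v. v \<notin> UNIV \<longrightarrow> e' v = c0) \<and> range e' \<subseteq> Dom U \<and> (\<forall>\<theta>\<in>\<Gamma>0. sat U e' \<theta>)"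
      by blast
  qed
  moreover have "is_formula L \<theta>" if "\<theta> \<in> \<Gamma>" for \<theta>
    using that fF by (auto simp: \<Gamma>_def \<psi>_def lit_def is_formula_fren)
  ultimately obtain e where e: "range e \<subseteq> Dom U" "\<And>\<theta>. \<theta> \<in> \<Gamma> \<Longrightarrow> sat U e \<theta>"
    using monster_realizes[OF mon, of \<Gamma> UNIV "\<lambda>_. c0"] by blast
  define a where "a = (\<lambda>i. map (\<lambda>v. e (h i v)) xs)"
  have a_dom: "a i \<in> tuples (Dom U) (xlen \<phi>)" for i
    using e(1) by (auto simp: a_def tuples_def xs_def)
  \<comment> \<open>The points of the sequence become parameters, and each \<open>E\<close> is now a
    countable type over them.\<close>
  define M where "M = insert c0 (\<Union>i. set (a i))"
  have "countable (\<Union>i. set (a i))" by (rule countable_UN) (simp_all add: countable_finite)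
  then interpret phi_setting L \<kappa> U \<phi> M
    by unfold_locales (use mon pform c0 a_dom in \<open>auto simp: M_def tuples_def\<close>)
  have "\<exists>b\<in>pts. \<forall>i\<in>UNIV. holds U \<phi> (a i) b \<longleftrightarrow> i \<in> E" for E
  proof (rule realize_pattern[OF closed_over_full])
    fix i show "a i \<in> insts" using a_dom[of i] by (auto simp: M_def tuples_def)
  next
    fix J :: "nat set" assume "finite J"
    then obtain n where n: "\<forall>i\<in>J. i < n" using finite_nat_set_iff_bounded by blast
    have "\<psi> n (E \<inter> {..<n}) \<in> \<Gamma>" by (auto simp: \<Gamma>_def)
    then have "sat U e (\<psi> n (E \<inter> {..<n}))" by (rule e(2))
    then obtain b where "b \<in> pts" "\<forall>i<n. holds U \<phi> (a i) b \<longleftrightarrow> i \<in> E \<inter> {..<n}"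
      unfolding sat_\<psi> a_def ys_def by blast
    then show "\<exists>b\<in>pts. \<forall>i\<in>J. holds U \<phi> (a i) b \<longleftrightarrow> i \<in> E" using n by auto
  qed
  then obtain b where "\<And>E. b E \<in> pts \<and> (\<forall>i. holds U \<phi> (a i) (b E) \<longleftrightarrow> i \<in> E)" by (metis UNIV_I)
  then have "(\<forall>i. a i \<in> tuples (Dom U) (xlen \<phi>)) \<and> (\<forall>E. b E \<in> pts) \<and>
      (\<forall>i E. holds U \<phi> (a i) (b E) \<longleftrightarrow> i \<in> E)" using a_dom by simp
  then have "\<exists>(a :: nat \<Rightarrow> _) (b :: nat set \<Rightarrow> _). (\<forall>i. a i \<in> tuples (Dom U) (xlen \<phi>)) \<and> (\<forall>E. b E \<in> pts) \<and>
      (\<forall>i E. holds U \<phi> (a i) (b E) \<longleftrightarrow> i \<in> E)" by blast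
  then show False using nip unfolding NIP_def by (rule notE[rotated])
qed

end

section \<open>Separation by iterated derivatives\<close>

text \<open>The closure of \<open>Z\<close> in \<open>B\<close> for the topology in which the
  instances \<open>R a\<close> with \<open>a \<in> A\<close> are clopen; on tuples it is the
  pullback of closure in the type space.\<close>

definition pat_closure :: "('a \<Rightarrow> 'b \<Rightarrow> bool) \<Rightarrow> 'a set \<Rightarrow> 'b set \<Rightarrow> 'b set \<Rightarrow> 'b set" where
  "pat_closure R A B Z = {b \<in> B. \<forall>S\<subseteq>A. finite S \<longrightarrow> (\<exists>z\<in>Z. \<forall>a\<in>S. R a b \<longleftrightarrow> R a z)}"

lemma pat_closure_subset: "pat_closure R A B Z \<subseteq> B"
  by (auto simp: pat_closure_def)

lemma subset_pat_closure: "Z \<subseteq> B \<Longrightarrow> Z \<subseteq> pat_closure R A B Z"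
  by (auto simp: pat_closure_def)

lemma pat_closure_mono: "Z \<subseteq> Z' \<Longrightarrow> pat_closure R A B Z \<subseteq> pat_closure R A B Z'"
  unfolding pat_closure_def by blast

lemma pat_closure_idem: "pat_closure R A B (pat_closure R A B Z) \<subseteq> pat_closure R A B Z"
proof
  fix b assume b: "b \<in> pat_closure R A B (pat_closure R A B Z)"
  show "b \<in> pat_closure R A B Z"
    unfolding pat_closure_def
  proof (intro CollectI conjI allI impI)
    show "b \<in> B" using b by (simp add: pat_closure_def)
    fix S assume S: "S \<subseteq> A" "finite S"
    obtain c where c: "c \<in> pat_closure R A B Z" "\<forall>a\<in>S. R a b \<longleftrightarrow> R a c"
      using b S unfolding pat_closure_def by blast
    obtain z where "z \<in> Z" "\<forall>a\<in>S. R a c \<longleftrightarrow> R a z"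
      using c(1) S unfolding pat_closure_def by blast
    then show "\<exists>z\<in>Z. \<forall>a\<in>S. R a b \<longleftrightarrow> R a z" using c(2) by blast
  qed
qed

text \<open>\<open>f\<close> abstracts the evaluation map of a finitely satisfiable measure;
  \<open>exact\<close> is all that the derivative argument retains of it.\<close>

locale separation =
  fixes R :: "'a \<Rightarrow> 'b \<Rightarrow> bool" and A :: "'a set" and B :: "'b set"
    and f :: "'b \<Rightarrow> real" and r s :: real
  assumes rs: "r < s"
    and exact: "\<And>Y. Y \<subseteq> B \<Longrightarrow> finite Y \<Longrightarrow> \<exists>S w. prob_weights A S w \<and> (\<forall>b\<in>Y. f b = mean R S w b)"
begin

primrec derived :: "nat \<Rightarrow> 'b set" where
  "derived 0 = B"
| "derived (Suc k) = pat_closure R A B (derived k \<inter> {b. s \<le> f b}) \<inter> pat_closure R A B (derived k \<inter> {b. f b \<le> r})"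

declare derived.simps(2) [simp del]

definition upper :: "nat \<Rightarrow> 'b set" where
  "upper k = pat_closure R A B (derived k \<inter> {b. s \<le> f b})"

lemma derived_subset: "derived k \<subseteq> B"
  by (cases k) (auto simp: pat_closure_def derived.simps(2))

lemma derived_closed: "pat_closure R A B (derived k) \<subseteq> derived k"
proof (cases k)
  case 0
  then show ?thesis by (simp add: pat_closure_subset)
next
  case (Suc j)
  have sub: "derived k \<subseteq> pat_closure R A B Z \<Longrightarrow> pat_closure R A B (derived k) \<subseteq> pat_closure R A B Z" for Z
    using pat_closure_mono[of "derived k" "pat_closure R A B Z" R A B] pat_closure_idem[of R A B Z]
    by (rule order_trans)
  show ?thesis
    unfolding Suc derived.simps(2)
    by (rule Int_greatest; rule sub[unfolded Suc derived.simps(2)]; simp)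
qed

lemma upper_subset: "upper k \<subseteq> derived k"
  using order_trans[OF pat_closure_mono[OF Int_lower1] derived_closed] by (simp add: upper_def)

lemma derived_Suc_subset: "derived (Suc k) \<subseteq> upper k"
  by (simp add: upper_def derived.simps(2))

lemma derived_antimono: "j \<le> k \<Longrightarrow> derived k \<subseteq> derived j"
proof (induction k rule: dec_induct)
  case (step k)
  then show ?case using derived_Suc_subset[of k] upper_subset[of k] by blast
qed simp

text \<open>The induction goes back one derivative per level. A point of
  \<open>derived (n - j)\<close> is approximated within \<open>derived (n - Suc j)\<close> both by
  points where \<open>f\<close> is at least \<open>s\<close> and by points where \<open>f\<close> is
  at most \<open>r\<close>; one of each replaces it as its two children.\<close>

lemma tree:
  assumes "derived n \<noteq> {}" "j \<le> n"
  shows "\<exists>S w x. (\<forall>E\<subseteq>{..<j}. x E \<in> derived (n - j)) \<and> fat_shattered R A B r s j S w x"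
  using assms(2)
proof (induction j)
  case 0
  obtain b where "b \<in> derived n" using assms(1) by blast
  then have "fat_shattered R A B r s 0 S w (\<lambda>_. b)" for S w
    using derived_subset by (auto simp: fat_shattered_def)
  then show ?case using \<open>b \<in> derived n\<close> by (metis diff_zero)
next
  case (Suc j)
  then obtain S w x where x: "\<And>E. E \<subseteq> {..<j} \<Longrightarrow> x E \<in> derived (n - j)"
    and fs: "fat_shattered R A B r s j S w x" by auto
  have Sk: "prob_weights A (S k) (w k)" if "k < j" for k using fs that by (simp add: fat_shattered_def)
  \<comment> \<open>Agreement on all earlier supports is a finite condition, and it preserves the
    values of all earlier means.\<close>
  define T where "T = (\<Union>k<j. S k)"
  have T: "T \<subseteq> A" "finite T" using Sk by (auto simp: T_def prob_weights_def)
  have nj: "n - j = Suc (n - Suc j)" using Suc.prems by simp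
  have "\<exists>hi lo. hi \<in> derived (n - Suc j) \<and> lo \<in> derived (n - Suc j) \<and> s \<le> f hi \<and> f lo \<le> r \<and>
      (\<forall>a\<in>T. R a (x E) \<longleftrightarrow> R a hi) \<and> (\<forall>a\<in>T. R a (x E) \<longleftrightarrow> R a lo)" if E: "E \<subseteq> {..<j}" for E
  proof -
    have "x E \<in> pat_closure R A B (derived (n - Suc j) \<inter> {b. s \<le> f b})"
      "x E \<in> pat_closure R A B (derived (n - Suc j) \<inter> {b. f b \<le> r})"
      using x[OF E] unfolding nj by (simp_all add: derived.simps(2))
    then show ?thesis using T unfolding pat_closure_def by blast
  qed
  then obtain hi lo where hl: "\<And>E. E \<subseteq> {..<j} \<Longrightarrow> hi E \<in> derived (n - Suc j) \<and> lo E \<in> derived (n - Suc j) \<and>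
      s \<le> f (hi E) \<and> f (lo E) \<le> r \<and>
      (\<forall>a\<in>T. R a (x E) \<longleftrightarrow> R a (hi E)) \<and> (\<forall>a\<in>T. R a (x E) \<longleftrightarrow> R a (lo E))" by metis
  define y where "y = (\<lambda>E. if j \<in> E then hi (E \<inter> {..<j}) else lo (E \<inter> {..<j}))"
  have y: "y E \<in> derived (n - Suc j)" "\<And>a. a \<in> T \<Longrightarrow> R a (y E) \<longleftrightarrow> R a (x (E \<inter> {..<j}))"
    "if j \<in> E then s \<le> f (y E) else f (y E) \<le> r" for E
    using hl[of "E \<inter> {..<j}"] by (auto simp: y_def)
  have "y ` Pow {..<Suc j} \<subseteq> B" using y(1) derived_subset by blast
  \<comment> \<open>One new average reproduces \<open>f\<close> at all points of the new level at
    once, so it separates the two children of every node.\<close>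
  then obtain S' w' where w': "prob_weights A S' w'"
    "\<And>E. E \<subseteq> {..<Suc j} \<Longrightarrow> f (y E) = mean R S' w' (y E)"
    using exact[of "y ` Pow {..<Suc j}"] by auto
  have old: "mean R (S k) (w k) (y E) = mean R (S k) (w k) (x (E \<inter> {..<j}))" if "k < j" for k E
    unfolding mean_def using that y(2) by (intro sum.cong) (auto simp: T_def)
  have "fat_shattered R A B r s (Suc j) (S(j := S')) (w(j := w')) y"
    unfolding fat_shattered_def
  proof (intro conjI allI impI)
    fix k assume "k < Suc j"
    then show "prob_weights A ((S(j := S')) k) ((w(j := w')) k)" using Sk w'(1) by auto
  next
    fix E assume "E \<subseteq> {..<Suc j}"
    then show "y E \<in> B" using y(1) derived_subset by blast
  next
    fix E k assume E: "E \<subseteq> {..<Suc j}" and k: "k < Suc j"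
    show "if k \<in> E then s \<le> mean R ((S(j := S')) k) ((w(j := w')) k) (y E)
          else mean R ((S(j := S')) k) ((w(j := w')) k) (y E) \<le> r"
    proof (cases "k = j")
      case True
      then show ?thesis using y(3)[of E] w'(2)[OF E] by (cases "j \<in> E") auto
    next
      case False
      then have "k < j" using k by simp
      have "E \<inter> {..<j} \<subseteq> {..<j}" by simp
      then have "if k \<in> E \<inter> {..<j} then s \<le> mean R (S k) (w k) (x (E \<inter> {..<j}))
          else mean R (S k) (w k) (x (E \<inter> {..<j})) \<le> r"
        using fs \<open>k < j\<close> unfolding fat_shattered_def by blast
      then show ?thesis using old[OF \<open>k < j\<close>, of E] \<open>k < j\<close> False by simp
    qed
  qed
  then show ?case using y(1) by blast
qed

lemma derived_eventually_empty:
  assumes "\<And>a. a ` {..<d} \<subseteq> A \<Longrightarrow> \<not> vc_shattered R B d a"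
  shows "\<exists>n. derived n = {}"
proof -
  obtain n where "\<And>S w x. \<not> fat_shattered R A B r s n S w x"
    using no_large_fat_shattering[OF assms rs] by blast
  then show ?thesis using tree[of n n] by blast
qed

definition layer :: "nat \<Rightarrow> 'b set" where
  "layer k = upper k - derived (Suc k)"

lemma layer_disjoint:
  assumes "b \<in> layer j" "b \<in> layer k"
  shows "j = k"
proof -
  have "\<not> j < k" if "b \<in> layer j" "b \<in> layer k" for j k
  proof
    assume "j < k"
    then have "derived k \<subseteq> derived (Suc j)" by (intro derived_antimono) simp
    then show False using that upper_subset[of k] unfolding layer_def by blast
  qed
  then show ?thesis using assms by (metis linorder_neqE_nat)
qed

text \<open>A point with value at least \<open>s\<close> lies in the layer of the last derivative
  that contains it. A point with value at most \<open>r\<close> in \<open>upper k\<close> also lies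
  in the other closure, hence in \<open>derived (Suc k)\<close>, which the layer omits.\<close>

lemma layer_separates:
  assumes b: "b \<in> B" and empty: "derived n = {}"
  shows "s \<le> f b \<Longrightarrow> \<exists>k<n. b \<in> layer k" "f b \<le> r \<Longrightarrow> b \<notin> layer k"
proof -
  assume s: "s \<le> f b"
  have "\<exists>k<n. b \<in> derived k \<and> b \<notin> derived (Suc k)"
  proof (rule ccontr)
    assume no: "\<not> ?thesis"
    have "k \<le> n \<Longrightarrow> b \<in> derived k" for k
      by (induction k) (use b no in auto)
    then show False using empty by blast
  qed
  then obtain k where k: "k < n" "b \<in> derived k" "b \<notin> derived (Suc k)" by blast
  have "derived k \<inter> {b. s \<le> f b} \<subseteq> upper k"
    unfolding upper_def by (rule subset_pat_closure) (use derived_subset in auto)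
  then have "b \<in> layer k" using k(2,3) s unfolding layer_def by blast
  then show "\<exists>k<n. b \<in> layer k" using k(1) by blast
next
  assume r: "f b \<le> r"
  show "b \<notin> layer k"
  proof
    assume l: "b \<in> layer k"
    then have "b \<in> derived k" using upper_subset by (auto simp: layer_def)
    moreover have "derived k \<inter> {b. f b \<le> r} \<subseteq> pat_closure R A B (derived k \<inter> {b. f b \<le> r})"
      by (rule subset_pat_closure) (use derived_subset in auto)
    ultimately have "b \<in> derived (Suc k)" using l r by (auto simp: layer_def upper_def derived.simps(2))
    then show False using l by (simp add: layer_def)
  qed
qed

text \<open>Disjointness of the layers makes the indicator of their union a linear combination of
  indicators of closed sets, and \<open>DBSC\<close> is preserved by such combinations.\<close>

lemma sum_layers:
  fixes b :: 'b
  shows "(\<Sum>k<n. of_bool (b \<in> upper k) - of_bool (b \<in> derived (Suc k)) :: real) = of_bool (\<exists>k<n. b \<in> layer k)"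
proof -
  have "(\<Sum>k<n. of_bool (b \<in> upper k) - of_bool (b \<in> derived (Suc k)) :: real)
      = (\<Sum>k<n. of_bool (b \<in> layer k))"
    by (rule sum.cong) (use derived_Suc_subset in \<open>auto simp: layer_def\<close>)
  also have "\<dots> = of_bool (\<exists>k<n. b \<in> layer k)"
  proof (cases "\<exists>k<n. b \<in> layer k")
    case True
    then obtain j where j: "j < n" "b \<in> layer j" by blast
    have "(\<Sum>k<n. of_bool (b \<in> layer k) :: real) = (\<Sum>k<n. if k = j then 1 else 0)"
      by (rule sum.cong) (use j layer_disjoint in auto)
    then show ?thesis using j True by simp
  qed simp
  finally show ?thesis .
qed

end

section \<open>Restriction of Keisler measures to finite algebras\<close>

context phi_setting
begin

text \<open>On the finite algebra generated by the instances from \<open>Y\<close>, the atoms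
  correspond to traces on \<open>Y\<close>. Finite satisfiability puts a point with parameters in
  \<open>M\<close> into each atom of positive mass, and that point takes over the mass.\<close>

lemma keisler_weights:
  assumes \<mu>: "keisler_phi_measure U \<phi> \<mu>" and fs: "measure_fin_sat U \<phi> M \<mu>"
    and Y: "Y \<subseteq> pts" "finite Y"
  shows "\<exists>S w. prob_weights insts S w \<and> (\<forall>b\<in>Y. \<mu> (Inst b) = mean (holds U \<phi>) S w b)"
proof -
  let ?F = "phi_formulas \<phi> (Dom U)" and ?X = "tuples (Dom U) (xlen \<phi>)"
  have pf: "\<psi> \<in> ?F \<longleftrightarrow> set_bform \<psi> \<subseteq> pts" for \<psi> by (simp add: phi_formulas_def)
  have nonneg: "\<And>\<psi>. \<psi> \<in> ?F \<Longrightarrow> 0 \<le> \<mu> \<psi>"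
    and equiv: "\<And>\<psi> \<theta>. \<psi> \<in> ?F \<Longrightarrow> \<theta> \<in> ?F \<Longrightarrow> (\<And>a. a \<in> ?X \<Longrightarrow> bsat U \<phi> a \<psi> \<longleftrightarrow> bsat U \<phi> a \<theta>) \<Longrightarrow> \<mu> \<psi> = \<mu> \<theta>"
    and one: "\<And>\<psi>. \<psi> \<in> ?F \<Longrightarrow> (\<And>a. a \<in> ?X \<Longrightarrow> bsat U \<phi> a \<psi>) \<Longrightarrow> \<mu> \<psi> = 1"
    and add: "\<And>\<psi> \<theta>. \<psi> \<in> ?F \<Longrightarrow> \<theta> \<in> ?F \<Longrightarrow> (\<And>a. a \<in> ?X \<Longrightarrow> \<not> (bsat U \<phi> a \<psi> \<and> bsat U \<phi> a \<theta>)) \<Longrightarrow>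
        \<mu> (BOr \<psi> \<theta>) = \<mu> \<psi> + \<mu> \<theta>"
    using \<mu> unfolding keisler_phi_measure_def by blast+
  have BOr_F: "\<psi> \<in> ?F \<Longrightarrow> \<theta> \<in> ?F \<Longrightarrow> BOr \<psi> \<theta> \<in> ?F" for \<psi> \<theta> by (simp add: pf BOr_def)
  have bsat_BOr: "bsat U \<phi> a (BOr \<psi> \<theta>) \<longleftrightarrow> bsat U \<phi> a \<psi> \<or> bsat U \<phi> a \<theta>" for a \<psi> \<theta>
    by (simp add: bsat_def BOr_def)
  define tr where "tr = (\<lambda>a. {b \<in> Y. holds U \<phi> a b})"
  have "\<exists>\<psi>. set_bform \<psi> \<subseteq> pts \<and> (\<forall>v. beval v \<psi> \<longleftrightarrow> {b \<in> Y. v b} \<in> \<P>)" for \<P>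
    by (rule pattern_bform[OF Y(2,1) pts_nonempty])
  then obtain pat where "\<And>\<P>. set_bform (pat \<P>) \<subseteq> pts \<and> (\<forall>v. beval v (pat \<P>) \<longleftrightarrow> {b \<in> Y. v b} \<in> \<P>)"
    by metis
  then have pat: "pat \<P> \<in> ?F" "bsat U \<phi> a (pat \<P>) \<longleftrightarrow> tr a \<in> \<P>" for \<P> a
    by (auto simp: pf bsat_def tr_def)
  \<comment> \<open>The empty set is disjoint from itself, so additivity doubles its
    measure.\<close>
  have \<mu>_empty: "\<mu> (pat {}) = 0"
  proof -
    have "\<mu> (BOr (pat {}) (pat {})) = \<mu> (pat {}) + \<mu> (pat {})" by (rule add) (simp_all add: pat)
    moreover have "\<mu> (BOr (pat {}) (pat {})) = \<mu> (pat {})"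
      by (rule equiv) (simp_all add: pat BOr_F bsat_BOr)
    ultimately show ?thesis by simp
  qed
  define m where "m = (\<lambda>E. \<mu> (pat {E}))"
  have \<mu>_sum: "\<mu> (pat \<P>) = sum m \<P>" if "finite \<P>" for \<P>
    using that
  proof (induction \<P> rule: finite_induct)
    case empty
    then show ?case by (simp add: \<mu>_empty)
  next
    case (insert E \<P>)
    have "\<mu> (pat (insert E \<P>)) = \<mu> (BOr (pat {E}) (pat \<P>))"
      by (rule equiv) (simp_all add: pat BOr_F bsat_BOr)
    also have "\<dots> = \<mu> (pat {E}) + \<mu> (pat \<P>)"
      by (rule add) (use insert.hyps in \<open>auto simp: pat\<close>)
    finally show ?case using insert by (simp add: m_def)
  qed
  \<comment> \<open>An atom of mass zero may contain no point over \<open>M\<close>, so these atoms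
    are left out.\<close>
  define \<E> where "\<E> = {E. E \<subseteq> Y \<and> 0 < m E}"
  have fin: "finite \<E>" using Y(2) by (simp add: \<E>_def)
  have m0: "m E = 0" if "E \<subseteq> Y" "E \<notin> \<E>" for E
    using that nonneg[OF pat(1)[of "{E}"]] by (auto simp: \<E>_def m_def)
  have "\<exists>a\<in>insts. tr a = E" if "E \<in> \<E>" for E
  proof -
    have "0 < \<mu> (pat {E})" using that by (simp add: \<E>_def m_def)
    then obtain a where "a \<in> insts" "bsat U \<phi> a (pat {E})"
      using fs pat(1)[of "{E}"] unfolding measure_fin_sat_def by blast
    then show ?thesis using pat(2) by blast
  qed
  then obtain c where c: "\<And>E. E \<in> \<E> \<Longrightarrow> c E \<in> insts" "\<And>E. E \<in> \<E> \<Longrightarrow> tr (c E) = E" by metis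
  have inj: "inj_on c \<E>" using c(2) by (metis inj_onI)
  have "sum m \<E> = sum m (Pow Y)"
    by (rule sum.mono_neutral_left) (use Y(2) m0 in \<open>auto simp: \<E>_def\<close>)
  also have "\<dots> = \<mu> (pat (Pow Y))" using \<mu>_sum[of "Pow Y"] Y(2) by simp
  also have "\<dots> = 1" by (rule one) (auto simp: pat tr_def)
  finally have m1: "sum m \<E> = 1" .
  show ?thesis
  proof (intro exI conjI ballI)
    show "prob_weights insts (c ` \<E>) (m \<circ> tr)"
      unfolding prob_weights_def
    proof (intro conjI ballI)
      show "finite (c ` \<E>)" using fin by simp
      show "c ` \<E> \<subseteq> insts" using c(1) by blast
      show "0 \<le> (m \<circ> tr) a" if "a \<in> c ` \<E>" for a
        using that c(2) by (auto simp: \<E>_def)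
      have "sum (m \<circ> tr) (c ` \<E>) = (\<Sum>E\<in>\<E>. m (tr (c E)))" by (simp add: sum.reindex[OF inj])
      also have "\<dots> = sum m \<E>" by (rule sum.cong) (simp_all add: c(2))
      finally show "sum (m \<circ> tr) (c ` \<E>) = 1" using m1 by simp
    qed
    fix b assume b: "b \<in> Y"
    have "\<mu> (Inst b) = \<mu> (pat {E. E \<subseteq> Y \<and> b \<in> E})"
      by (rule equiv) (use b Y(1) pat(1) in \<open>auto simp: pat(2) pf bsat_def[of U \<phi> _ "Inst b"] tr_def\<close>)
    also have "\<dots> = sum m {E. E \<subseteq> Y \<and> b \<in> E}"
      by (rule \<mu>_sum) (use Y(2) in \<open>auto intro: finite_subset[of _ "Pow Y"]\<close>)
    also have "\<dots> = (\<Sum>E\<in>\<E>. m E * of_bool (b \<in> E))"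
    proof -
      have "(\<Sum>E\<in>\<E>. m E * of_bool (b \<in> E)) = (\<Sum>E\<in>Pow Y. m E * of_bool (b \<in> E))"
        by (rule sum.mono_neutral_left) (use Y(2) m0 in \<open>auto simp: \<E>_def\<close>)
      also have "\<dots> = (\<Sum>E\<in>{E. E \<subseteq> Y \<and> b \<in> E}. m E * of_bool (b \<in> E))"
        by (rule sum.mono_neutral_right) (use Y(2) in auto)
      finally show ?thesis by simp
    qed
    also have "\<dots> = (\<Sum>E\<in>\<E>. (m \<circ> tr) (c E) * of_bool (holds U \<phi> (c E) b))"
    proof (rule sum.cong[OF refl])
      fix E assume E: "E \<in> \<E>"
      have "b \<in> E \<longleftrightarrow> holds U \<phi> (c E) b" using c(2)[OF E] b by (auto simp: tr_def)
      then show "m E * of_bool (b \<in> E) = (m \<circ> tr) (c E) * of_bool (holds U \<phi> (c E) b)"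
        using c(2)[OF E] by simp
    qed
    also have "\<dots> = mean (holds U \<phi>) (c ` \<E>) (m \<circ> tr) b"
      unfolding mean_def by (simp add: sum.reindex[OF inj])
    finally show "\<mu> (Inst b) = mean (holds U \<phi>) (c ` \<E>) (m \<circ> tr) b" .
  qed
qed

end

section \<open>Functions of bounded variation and definability\<close>

lemma DBSC_add:
  assumes "DBSC X f" "DBSC X g"
  shows "DBSC X (\<lambda>x. f x + g x)"
proof -
  obtain u C where C: "C > 0" and u: "\<And>n. continuous_map X euclideanreal (u n)"
    "\<And>x. x \<in> topspace X \<Longrightarrow> u 0 x = 0" "\<And>x. x \<in> topspace X \<Longrightarrow> (\<lambda>n. u n x) \<longlonglongrightarrow> f x"
    "\<And>x. x \<in> topspace X \<Longrightarrow> summable (\<lambda>n. \<bar>u (Suc n) x - u n x\<bar>)"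
    "\<And>x. x \<in> topspace X \<Longrightarrow> (\<Sum>n. \<bar>u (Suc n) x - u n x\<bar>) \<le> C"
    using assms(1) unfolding DBSC_def by auto
  obtain v D where D: "D > 0" and v: "\<And>n. continuous_map X euclideanreal (v n)"
    "\<And>x. x \<in> topspace X \<Longrightarrow> v 0 x = 0" "\<And>x. x \<in> topspace X \<Longrightarrow> (\<lambda>n. v n x) \<longlonglongrightarrow> g x"
    "\<And>x. x \<in> topspace X \<Longrightarrow> summable (\<lambda>n. \<bar>v (Suc n) x - v n x\<bar>)"
    "\<And>x. x \<in> topspace X \<Longrightarrow> (\<Sum>n. \<bar>v (Suc n) x - v n x\<bar>) \<le> D"
    using assms(2) unfolding DBSC_def by auto
  show ?thesis
    unfolding DBSC_def
  proof (intro exI[of _ "\<lambda>n x. u n x + v n x"] exI[of _ "C + D"] conjI allI ballI)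
    show "C + D > 0" using C D by simp
    show "continuous_map X euclideanreal (\<lambda>x. u n x + v n x)" for n
      by (intro continuous_map_add u v)
    fix x assume x: "x \<in> topspace X"
    show "u 0 x + v 0 x = 0" using u v x by simp
    show "(\<lambda>n. u n x + v n x) \<longlonglongrightarrow> f x + g x" by (intro tendsto_add u v x)
    let ?S = "\<lambda>n. \<bar>u (Suc n) x - u n x\<bar> + \<bar>v (Suc n) x - v n x\<bar>"
    have S: "summable ?S" by (intro summable_add u v x)
    show sm: "summable (\<lambda>n. \<bar>u (Suc n) x + v (Suc n) x - (u n x + v n x)\<bar>)"
      by (rule summable_comparison_test'[OF S, of 0]) auto
    have "(\<Sum>n. \<bar>u (Suc n) x + v (Suc n) x - (u n x + v n x)\<bar>) \<le> suminf ?S"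
      by (rule suminf_le[OF _ sm S]) auto
    also have "\<dots> = (\<Sum>n. \<bar>u (Suc n) x - u n x\<bar>) + (\<Sum>n. \<bar>v (Suc n) x - v n x\<bar>)"
      using u(4)[OF x] v(4)[OF x] by (rule suminf_add[symmetric])
    also have "\<dots> \<le> C + D" using u(5)[OF x] v(5)[OF x] by simp
    finally show "(\<Sum>n. \<bar>u (Suc n) x + v (Suc n) x - (u n x + v n x)\<bar>) \<le> C + D" .
  qed
qed

lemma DBSC_cmult:
  assumes "DBSC X f"
  shows "DBSC X (\<lambda>x. c * f x)"
proof -
  obtain u C where C: "C > 0" and u: "\<And>n. continuous_map X euclideanreal (u n)"
    "\<And>x. x \<in> topspace X \<Longrightarrow> u 0 x = 0" "\<And>x. x \<in> topspace X \<Longrightarrow> (\<lambda>n. u n x) \<longlonglongrightarrow> f x"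
    "\<And>x. x \<in> topspace X \<Longrightarrow> summable (\<lambda>n. \<bar>u (Suc n) x - u n x\<bar>)"
    "\<And>x. x \<in> topspace X \<Longrightarrow> (\<Sum>n. \<bar>u (Suc n) x - u n x\<bar>) \<le> C"
    using assms unfolding DBSC_def by auto
  show ?thesis
    unfolding DBSC_def
  proof (intro exI[of _ "\<lambda>n x. c * u n x"] exI[of _ "\<bar>c\<bar> * C + 1"] conjI allI ballI)
    show "\<bar>c\<bar> * C + 1 > 0" using C by (intro add_nonneg_pos) auto
    show "continuous_map X euclideanreal (\<lambda>x. c * u n x)" for n
      by (intro continuous_map_real_mult u) simp
    fix x assume x: "x \<in> topspace X"
    show "c * u 0 x = 0" using u x by simp
    show "(\<lambda>n. c * u n x) \<longlonglongrightarrow> c * f x" by (intro tendsto_mult tendsto_const u x)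
    have eq: "\<bar>c * u (Suc n) x - c * u n x\<bar> = \<bar>c\<bar> * \<bar>u (Suc n) x - u n x\<bar>" for n
      by (simp add: abs_mult[symmetric] right_diff_distrib)
    show "summable (\<lambda>n. \<bar>c * u (Suc n) x - c * u n x\<bar>)"
      unfolding eq by (rule summable_mult[OF u(4)[OF x]])
    have "(\<Sum>n. \<bar>c * u (Suc n) x - c * u n x\<bar>) = \<bar>c\<bar> * (\<Sum>n. \<bar>u (Suc n) x - u n x\<bar>)"
      unfolding eq by (rule suminf_mult[OF u(4)[OF x]])
    also have "\<dots> \<le> \<bar>c\<bar> * C" using u(5)[OF x] by (intro mult_left_mono) auto
    finally show "(\<Sum>n. \<bar>c * u (Suc n) x - c * u n x\<bar>) \<le> \<bar>c\<bar> * C + 1" by simp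
  qed
qed

lemma DBSC_zero: "DBSC X (\<lambda>_. 0)"
  unfolding DBSC_def by (intro exI[of _ "\<lambda>_ _. 0"] exI[of _ 1]) auto

lemma DBSC_diff:
  assumes "DBSC X f" "DBSC X g"
  shows "DBSC X (\<lambda>x. f x - g x)"
  using DBSC_add[OF assms(1) DBSC_cmult[OF assms(2), of "- 1"]] by simp

lemma DBSC_sum:
  assumes "\<And>i. i \<in> I \<Longrightarrow> DBSC X (f i)"
  shows "DBSC X (\<lambda>x. \<Sum>i\<in>I. f i x)"
  using assms
proof (induction I rule: infinite_finite_induct)
  case (insert i I)
  then show ?case using DBSC_add[of X "f i" "\<lambda>x. \<Sum>i\<in>I. f i x"] by simp
qed (simp_all add: DBSC_zero)

text \<open>A decreasing sequence with values in the unit interval has variation at most 1. Starting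
  from the function 0, as \<open>DBSC\<close> requires, costs one more jump of size at most 1,
  whence the bound 2.\<close>

lemma DBSC_decreasing_limit:
  assumes cont: "\<And>n. continuous_map X euclideanreal (g n)"
    and dec: "\<And>x n. x \<in> topspace X \<Longrightarrow> g (Suc n) x \<le> g n x"
    and bounds: "\<And>x n. x \<in> topspace X \<Longrightarrow> 0 \<le> g n x \<and> g n x \<le> 1"
    and lim: "\<And>x. x \<in> topspace X \<Longrightarrow> (\<lambda>n. g n x) \<longlonglongrightarrow> f x"
  shows "DBSC X f"
  unfolding DBSC_def
proof (intro exI[of _ "\<lambda>n x. case n of 0 \<Rightarrow> 0 | Suc m \<Rightarrow> g m x"] exI[of _ 2] conjI allI ballI)
  let ?h = "\<lambda>n x. case n of 0 \<Rightarrow> 0 | Suc m \<Rightarrow> g m x"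
  show "continuous_map X euclideanreal (?h n)" for n
    by (cases n) (simp_all add: cont)
  fix x assume x: "x \<in> topspace X"
  show "(case 0 of 0 \<Rightarrow> 0 | Suc m \<Rightarrow> g m x) = 0" by simp
  show "(\<lambda>n. ?h n x) \<longlonglongrightarrow> f x"
    by (rule LIMSEQ_imp_Suc) (simp add: lim[OF x])
  have partial: "(\<Sum>k<Suc n. \<bar>?h (Suc k) x - ?h k x\<bar>) = 2 * g 0 x - g n x" for n
  proof (induction n)
    case 0
    then show ?case using bounds[OF x, of 0] by simp
  next
    case (Suc n)
    then show ?case using dec[OF x, of n] by simp
  qed
  have bound: "(\<Sum>k<n. \<bar>?h (Suc k) x - ?h k x\<bar>) \<le> 2" for n
  proof (cases n)
    case (Suc m)
    then show ?thesis using partial[of m] bounds[OF x, of 0] bounds[OF x, of m] by simp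
  qed simp
  show sm: "summable (\<lambda>n. \<bar>?h (Suc n) x - ?h n x\<bar>)"
    by (rule summableI_nonneg_bounded[OF _ bound]) simp
  show "(\<Sum>n. \<bar>?h (Suc n) x - ?h n x\<bar>) \<le> 2"
    by (rule suminf_le_const[OF sm bound])
qed simp

text \<open>\<open>P j\<close> is undetermined only if \<open>j < y < j + 1\<close>, which happens
  for at most one \<open>j\<close>; the count therefore lies between the floor and the ceiling of
  \<open>y\<close>.\<close>

lemma count_thresholds:
  fixes y :: real
  assumes y: "0 \<le> y" "y \<le> real N"
    and low: "\<And>j. j < N \<Longrightarrow> real j + 1 \<le> y \<Longrightarrow> P j" and high: "\<And>j. j < N \<Longrightarrow> y \<le> real j \<Longrightarrow> \<not> P j"
  shows "\<bar>y - (\<Sum>j<N. of_bool (P j))\<bar> \<le> 1"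
proof -
  have sum: "(\<Sum>j<N. of_bool (P j) :: real) = real (card {j \<in> {..<N}. P j})"
    by (simp add: sum.If_cases of_bool_def Int_def)
  have "{..<nat \<lfloor>y\<rfloor>} \<subseteq> {j \<in> {..<N}. P j}"
  proof
    fix j assume "j \<in> {..<nat \<lfloor>y\<rfloor>}"
    then have "real j + 1 \<le> y" by (simp add: zless_nat_conj) linarith
    then show "j \<in> {j \<in> {..<N}. P j}" using low y by auto
  qed
  then have "nat \<lfloor>y\<rfloor> \<le> card {j \<in> {..<N}. P j}"
    using card_mono[of "{j \<in> {..<N}. P j}" "{..<nat \<lfloor>y\<rfloor>}"] by simp
  then have l: "y - 1 \<le> real (card {j \<in> {..<N}. P j})" using y by linarith
  have "{j \<in> {..<N}. P j} \<subseteq> {..<nat \<lceil>y\<rceil>}"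
  proof
    fix j assume "j \<in> {j \<in> {..<N}. P j}"
    then have "real j < y" using high by force
    then show "j \<in> {..<nat \<lceil>y\<rceil>}" by (simp add: less_ceiling_iff zless_nat_eq_int_zless)
  qed
  then have "card {j \<in> {..<N}. P j} \<le> nat \<lceil>y\<rceil>"
    using card_mono[of "{..<nat \<lceil>y\<rceil>}" "{j \<in> {..<N}. P j}"] by simp
  then have "real (card {j \<in> {..<N}. P j}) \<le> y + 1" using y by linarith
  then show ?thesis using l sum by simp
qed

lemma boolean_combinations_Un:
  assumes "X \<in> boolean_combinations \<Omega> G" "Y \<in> boolean_combinations \<Omega> G" "X \<subseteq> \<Omega>" "Y \<subseteq> \<Omega>"
  shows "X \<union> Y \<in> boolean_combinations \<Omega> G"
proof -
  have "\<Omega> - ((\<Omega> - X) \<inter> (\<Omega> - Y)) \<in> boolean_combinations \<Omega> G"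
    by (intro boolean_combinations.compl boolean_combinations.inter assms)
  moreover have "\<Omega> - ((\<Omega> - X) \<inter> (\<Omega> - Y)) = X \<union> Y" using assms(3,4) by blast
  ultimately show ?thesis by simp
qed

lemma boolean_combinations_diff:
  assumes "X \<in> boolean_combinations \<Omega> G" "Y \<in> boolean_combinations \<Omega> G" "X \<subseteq> \<Omega>"
  shows "X - Y \<in> boolean_combinations \<Omega> G"
proof -
  have "X \<inter> (\<Omega> - Y) \<in> boolean_combinations \<Omega> G"
    by (intro boolean_combinations.compl boolean_combinations.inter assms)
  moreover have "X \<inter> (\<Omega> - Y) = X - Y" using assms(3) by blast
  ultimately show ?thesis by simp
qed

text \<open>Membership in \<open>p\<close> of finitely many formulas becomes truth at one point,
  which reduces the laws of a measure in \<open>type_keisler_measure\<close> to propositional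
  logic.\<close>

lemma type_realizer:
  assumes p: "p \<in> phi_types U \<phi> B" and \<Psi>: "\<Psi> \<subseteq> phi_formulas \<phi> B" "finite \<Psi>"
  shows "\<exists>a\<in>tuples (Dom U) (xlen \<phi>). \<forall>\<psi>\<in>\<Psi>. \<psi> \<in> p \<longleftrightarrow> bsat U \<phi> a \<psi>"
proof -
  let ?g = "\<lambda>\<psi>. if \<psi> \<in> p then \<psi> else BNot \<psi>"
  have "?g ` \<Psi> \<subseteq> p" using p \<Psi>(1) by (auto simp: phi_types_def)
  moreover have "finite (?g ` \<Psi>)" using \<Psi>(2) by simp
  ultimately obtain a where a: "a \<in> tuples (Dom U) (xlen \<phi>)" "\<forall>\<psi>\<in>?g ` \<Psi>. bsat U \<phi> a \<psi>"
    using p unfolding phi_types_def consistent_def by blast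
  have "\<psi> \<in> p \<longleftrightarrow> bsat U \<phi> a \<psi>" if "\<psi> \<in> \<Psi>" for \<psi>
  proof -
    have "bsat U \<phi> a (?g \<psi>)" using a(2) that by blast
    then show ?thesis by (auto simp: bsat_def split: if_splits)
  qed
  then show ?thesis using a(1) by blast
qed

lemma type_keisler_measure:
  assumes p: "p \<in> phi_types U \<phi> (Dom U)"
  shows "keisler_phi_measure U \<phi> (\<lambda>\<psi>. of_bool (\<psi> \<in> p))"
  unfolding keisler_phi_measure_def
proof (intro conjI ballI impI)
  fix \<psi> \<theta> assume f: "\<psi> \<in> phi_formulas \<phi> (Dom U)" "\<theta> \<in> phi_formulas \<phi> (Dom U)"
    and eq: "\<forall>a\<in>tuples (Dom U) (xlen \<phi>). bsat U \<phi> a \<psi> = bsat U \<phi> a \<theta>"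
  show "of_bool (\<psi> \<in> p) = (of_bool (\<theta> \<in> p) :: real)"
    using type_realizer[OF p, of "{\<psi>, \<theta>}"] f eq by auto
next
  fix \<psi> assume "\<psi> \<in> phi_formulas \<phi> (Dom U)" "\<forall>a\<in>tuples (Dom U) (xlen \<phi>). bsat U \<phi> a \<psi>"
  then show "of_bool (\<psi> \<in> p) = (1 :: real)"
    using type_realizer[OF p, of "{\<psi>}"] by auto
next
  fix \<psi> \<theta> assume f: "\<psi> \<in> phi_formulas \<phi> (Dom U)" "\<theta> \<in> phi_formulas \<phi> (Dom U)"
    and dis: "\<forall>a\<in>tuples (Dom U) (xlen \<phi>). \<not> (bsat U \<phi> a \<psi> \<and> bsat U \<phi> a \<theta>)"
  have "BOr \<psi> \<theta> \<in> phi_formulas \<phi> (Dom U)" using f by (simp add: phi_formulas_def BOr_def)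
  then obtain a where a: "a \<in> tuples (Dom U) (xlen \<phi>)"
    "\<forall>\<chi>'\<in>{\<psi>, \<theta>, BOr \<psi> \<theta>}. \<chi>' \<in> p \<longleftrightarrow> bsat U \<phi> a \<chi>'"
    using type_realizer[OF p, of "{\<psi>, \<theta>, BOr \<psi> \<theta>}"] f by auto
  have "bsat U \<phi> a (BOr \<psi> \<theta>) \<longleftrightarrow> bsat U \<phi> a \<psi> \<or> bsat U \<phi> a \<theta>" by (simp add: bsat_def BOr_def)
  then show "of_bool (BOr \<psi> \<theta> \<in> p) = of_bool (\<psi> \<in> p) + (of_bool (\<theta> \<in> p) :: real)"
    using a dis by auto
qed simp

lemma type_measure_fin_sat:
  "type_fin_sat U \<phi> M p \<Longrightarrow> measure_fin_sat U \<phi> M (\<lambda>\<psi>. of_bool (\<psi> \<in> p))"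
  by (auto simp: type_fin_sat_def measure_fin_sat_def)

section \<open>Definability of measures and types under NIP\<close>

context phi_setting
begin

text \<open>Sets of tuples become functions on the type space through a chosen realizer. Membership
  in sets such as \<open>cl Z\<close> depends only on the type, so the choice is immaterial
  there.\<close>

definition rep :: "'a list bform set \<Rightarrow> 'a list" where
  "rep q = (SOME b. b \<in> pts \<and> tp b = q)"

lemma rep: "q \<in> types \<Longrightarrow> rep q \<in> pts" "q \<in> types \<Longrightarrow> tp (rep q) = q"
  using someI_ex[of "\<lambda>b. b \<in> pts \<and> tp b = q"] type_realized[of q] by (auto simp: rep_def)

lemma openin_stone:
  assumes "\<psi> \<in> phi_formulas (opp \<phi>) M"
  shows "openin (stone_space U (opp \<phi>) M) {q \<in> types. \<psi> \<in> q}"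
  unfolding stone_space_def using assms by (intro topology_generated_by_Basis) blast

lemma types_BNot:
  assumes "\<psi> \<in> phi_formulas (opp \<phi>) M" "q \<in> types"
  shows "BNot \<psi> \<in> q \<longleftrightarrow> \<psi> \<notin> q"
proof -
  have "BNot \<psi> \<in> phi_formulas (opp \<phi>) M" using assms(1) by (simp add: phi_formulas_def)
  then show ?thesis
    using mem_type_iff[OF rep(1)[OF assms(2)]] rep(2)[OF assms(2)] assms(1) by (simp add: bsat_def)
qed

lemma continuous_membership:
  assumes "\<psi> \<in> phi_formulas (opp \<phi>) M"
  shows "continuous_map (stone_space U (opp \<phi>) M) euclideanreal (\<lambda>q. of_bool (\<psi> \<in> q))"
  unfolding continuous_map_def
proof (intro conjI allI impI)
  let ?X = "stone_space U (opp \<phi>) M"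
  fix V :: "real set"
  have "BNot \<psi> \<in> phi_formulas (opp \<phi>) M" using assms by (simp add: phi_formulas_def)
  note ops = openin_stone[OF assms] openin_stone[OF this]
  have "{q \<in> topspace ?X. of_bool (\<psi> \<in> q) \<in> V} =
      (if 1 \<in> V then {q \<in> types. \<psi> \<in> q} else {}) \<union> (if 0 \<in> V then {q \<in> types. BNot \<psi> \<in> q} else {})"
    unfolding topspace_stone using types_BNot[OF assms] by (auto simp: of_bool_def split: if_splits)
  then show "openin ?X {q \<in> topspace ?X. of_bool (\<psi> \<in> q) \<in> V}"
    using ops by (auto intro!: openin_Un)
qed simp

text \<open>\<open>Z\<close> may be infinite, yet its members leave only finitely many traces on
  \<open>S\<close>, so a single Boolean combination expresses agreement on \<open>S\<close> with a
  member of \<open>Z\<close>.\<close>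

lemma pattern_formula:
  assumes "finite S" "S \<subseteq> insts"
  shows "\<exists>\<psi>\<in>phi_formulas (opp \<phi>) M. \<forall>b\<in>pts. bsat U (opp \<phi>) b \<psi> \<longleftrightarrow>
      (\<exists>z\<in>Z. \<forall>a\<in>S. holds U \<phi> a b \<longleftrightarrow> holds U \<phi> a z)"
proof -
  obtain \<psi> where \<psi>: "set_bform \<psi> \<subseteq> insts"
    "\<And>v. beval v \<psi> \<longleftrightarrow> {a \<in> S. v a} \<in> (\<lambda>z. {a \<in> S. holds U \<phi> a z}) ` Z"
    using pattern_bform[OF assms insts_nonempty, of "(\<lambda>z. {a \<in> S. holds U \<phi> a z}) ` Z"] by blast
  have "bsat U (opp \<phi>) b \<psi> \<longleftrightarrow> (\<exists>z\<in>Z. \<forall>a\<in>S. holds U \<phi> a b \<longleftrightarrow> holds U \<phi> a z)" if b: "b \<in> pts" for b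
  proof -
    have "{a \<in> S. holds U (opp \<phi>) b a} = {a \<in> S. holds U \<phi> a b}"
      using assms(2) b holds_opp[OF pform, of _ b U] by (auto simp: tuples_def)
    then have "bsat U (opp \<phi>) b \<psi> \<longleftrightarrow> (\<exists>z\<in>Z. {a \<in> S. holds U \<phi> a b} = {a \<in> S. holds U \<phi> a z})"
      unfolding bsat_def \<psi>(2) by auto
    also have "\<dots> \<longleftrightarrow> (\<exists>z\<in>Z. \<forall>a\<in>S. holds U \<phi> a b \<longleftrightarrow> holds U \<phi> a z)" by blast
    finally show ?thesis .
  qed
  then show ?thesis using \<psi>(1) phi_formulas_opp by blast
qed

abbreviation cl :: "'a list set \<Rightarrow> 'a list set" where
  "cl \<equiv> pat_closure (holds U \<phi>) insts pts"

lemma cl_closed_over: "cl Z \<in> closed_over L U (ParVars \<phi>) M"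
proof -
  let ?I = "{S. S \<subseteq> insts \<and> finite S}"
  obtain \<psi> where \<psi>: "\<And>S. S \<in> ?I \<Longrightarrow> \<psi> S \<in> phi_formulas (opp \<phi>) M"
    "\<And>S b. S \<in> ?I \<Longrightarrow> b \<in> pts \<Longrightarrow> bsat U (opp \<phi>) b (\<psi> S) \<longleftrightarrow>
      (\<exists>z\<in>Z. \<forall>a\<in>S. holds U \<phi> a b \<longleftrightarrow> holds U \<phi> a z)"
    using pattern_formula[of _ Z] by (metis (no_types, lifting) mem_Collect_eq)
  have "{} \<in> ?I" by simp
  then have ne: "?I \<noteq> {}" by blast
  have "cl Z = (\<Inter>S\<in>?I. {b \<in> pts. bsat U (opp \<phi>) b (\<psi> S)})"
  proof
    show "cl Z \<subseteq> (\<Inter>S\<in>?I. {b \<in> pts. bsat U (opp \<phi>) b (\<psi> S)})"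
      using \<psi>(2) by (auto simp: pat_closure_def)
    show "(\<Inter>S\<in>?I. {b \<in> pts. bsat U (opp \<phi>) b (\<psi> S)}) \<subseteq> cl Z"
    proof
      fix b assume b: "b \<in> (\<Inter>S\<in>?I. {b \<in> pts. bsat U (opp \<phi>) b (\<psi> S)})"
      then have "b \<in> pts" using \<open>{} \<in> ?I\<close> by blast
      then show "b \<in> cl Z" using b \<psi>(2) by (auto simp: pat_closure_def)
    qed
  qed
  also have "\<dots> \<in> closed_over L U (ParVars \<phi>) M"
    by (rule closed_over_INT[OF ne]) (rule bsat_closed_over[OF \<psi>(1)])
  finally show ?thesis .
qed

text \<open>\<open>insts\<close> is countable, so the closure is the intersection of a decreasing
  sequence of clopen sets, one for each initial segment of an enumeration of
  \<open>insts\<close>.\<close>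

lemma DBSC_cl: "DBSC (stone_space U (opp \<phi>) M) (\<lambda>q. of_bool (rep q \<in> cl Z))"
proof -
  define S where "S = (\<lambda>n. from_nat_into insts ` {..<n :: nat})"
  have S: "finite (S n)" "S n \<subseteq> insts" for n
    using from_nat_into[OF insts_nonempty] by (auto simp: S_def)
  obtain \<psi> where \<psi>: "\<And>n. \<psi> n \<in> phi_formulas (opp \<phi>) M"
    "\<And>n b. b \<in> pts \<Longrightarrow> bsat U (opp \<phi>) b (\<psi> n) \<longleftrightarrow> (\<exists>z\<in>Z. \<forall>a\<in>S n. holds U \<phi> a b \<longleftrightarrow> holds U \<phi> a z)"
    using pattern_formula[OF S, of Z] by metis
  have mem: "\<psi> n \<in> q \<longleftrightarrow> (\<exists>z\<in>Z. \<forall>a\<in>S n. holds U \<phi> a (rep q) \<longleftrightarrow> holds U \<phi> a z)" if "q \<in> types" for n q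
    using mem_type_iff[OF rep(1)[OF that] \<psi>(1)] rep(2)[OF that] \<psi>(2)[OF rep(1)[OF that]] by metis
  show ?thesis
  proof (rule DBSC_decreasing_limit[where g = "\<lambda>n q. of_bool (\<psi> n \<in> q)"])
    show "continuous_map (stone_space U (opp \<phi>) M) euclideanreal (\<lambda>q. of_bool (\<psi> n \<in> q))" for n
      by (rule continuous_membership[OF \<psi>(1)])
    fix q assume "q \<in> topspace (stone_space U (opp \<phi>) M)"
    then have q: "q \<in> types" by (simp add: topspace_stone)
    have "S n \<subseteq> S (Suc n)" for n by (auto simp: S_def)
    then have "\<psi> (Suc n) \<in> q \<Longrightarrow> \<psi> n \<in> q" for n
      unfolding mem[OF q] by blast
    then show "of_bool (\<psi> (Suc n) \<in> q) \<le> (of_bool (\<psi> n \<in> q) :: real)" for n by simp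
    show "0 \<le> (of_bool (\<psi> n \<in> q) :: real) \<and> of_bool (\<psi> n \<in> q) \<le> (1 :: real)" for n by simp
    show "(\<lambda>n. of_bool (\<psi> n \<in> q) :: real) \<longlonglongrightarrow> of_bool (rep q \<in> cl Z)"
    proof (cases "rep q \<in> cl Z")
      case True
      then have "\<psi> n \<in> q" for n unfolding mem[OF q] using S[of n] by (auto simp: pat_closure_def)
      then show ?thesis using True by simp
    next
      case False
      then obtain X where X: "X \<subseteq> insts" "finite X"
        "\<not> (\<exists>z\<in>Z. \<forall>a\<in>X. holds U \<phi> a (rep q) \<longleftrightarrow> holds U \<phi> a z)"
        using rep(1)[OF q] unfolding pat_closure_def by blast
      obtain m where m: "\<forall>k\<in>to_nat_on insts ` X. k < m"
        using X(2) finite_nat_set_iff_bounded[of "to_nat_on insts ` X"] by auto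
      have "X \<subseteq> S n" if "m \<le> n" for n
      proof
        fix a assume a: "a \<in> X"
        then have "from_nat_into insts (to_nat_on insts a) = a"
          using X(1) countable_insts by (auto intro: from_nat_into_to_nat_on)
        moreover have "to_nat_on insts a < n" using m a that by auto
        ultimately show "a \<in> S n" unfolding S_def by (metis imageI lessThan_iff)
      qed
      then have "\<psi> n \<notin> q" if "m \<le> n" for n
        unfolding mem[OF q] using X(3) that by blast
      then have "\<forall>\<^sub>F n in sequentially. of_bool (\<psi> n \<in> q) = (0 :: real)"
        by (auto simp: eventually_sequentially)
      then show ?thesis using False by (simp add: tendsto_eventually)
    qed
  qed
qed

lemma measure_depends_on_type:
  assumes "keisler_phi_measure U \<phi> \<mu>" "measure_fin_sat U \<phi> M \<mu>" "b \<in> pts" "c \<in> pts" "tp b = tp c"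
  shows "\<mu> (Inst b) = \<mu> (Inst c)"
proof -
  obtain S w where S: "prob_weights insts S w" "\<forall>b\<in>{b, c}. \<mu> (Inst b) = mean (holds U \<phi>) S w b"
    using keisler_weights[OF assms(1,2), of "{b, c}"] assms(3,4) by auto
  have "holds U \<phi> a b \<longleftrightarrow> holds U \<phi> a c" if "a \<in> insts" for a
    using Inst_in_tp[OF that assms(3)] Inst_in_tp[OF that assms(4)] assms(5) by simp
  then have "mean (holds U \<phi>) S w b = mean (holds U \<phi>) S w c"
    unfolding mean_def using S(1) by (intro sum.cong) (auto simp: prob_weights_def subset_iff)
  then show ?thesis using S(2) by simp
qed

lemma measure_Inst_bounds:
  assumes "keisler_phi_measure U \<phi> \<mu>" "measure_fin_sat U \<phi> M \<mu>" "b \<in> pts"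
  shows "0 \<le> \<mu> (Inst b)" "\<mu> (Inst b) \<le> 1"
proof -
  obtain S w where S: "prob_weights insts S w" "\<mu> (Inst b) = mean (holds U \<phi>) S w b"
    using keisler_weights[OF assms(1,2), of "{b}"] assms(3) by auto
  show "0 \<le> \<mu> (Inst b)"
    using S by (auto simp: mean_def prob_weights_def intro!: sum_nonneg)
  have "mean (holds U \<phi>) S w b \<le> sum w S"
    unfolding mean_def by (rule sum_mono) (use S(1) in \<open>auto simp: prob_weights_def\<close>)
  then show "\<mu> (Inst b) \<le> 1" using S by (simp add: prob_weights_def)
qed

text \<open>The same \<open>W\<close> is delivered in two forms: its indicator as a
  \<open>DBSC\<close> function serves measures, its description as a Boolean combination serves
  types.\<close>

lemma NIP_separating_set:
  assumes nip: "NIP U \<phi>" and \<mu>: "keisler_phi_measure U \<phi> \<mu>" "measure_fin_sat U \<phi> M \<mu>" and rs: "r < s"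
  shows "\<exists>W\<subseteq>pts. (\<forall>b\<in>pts. s \<le> \<mu> (Inst b) \<longrightarrow> b \<in> W) \<and> (\<forall>b\<in>pts. \<mu> (Inst b) \<le> r \<longrightarrow> b \<notin> W) \<and>
      DBSC (stone_space U (opp \<phi>) M) (\<lambda>q. of_bool (rep q \<in> W)) \<and>
      W \<in> boolean_combinations pts (closed_over L U (ParVars \<phi>) M)"
proof -
  interpret separation "holds U \<phi>" insts pts "\<lambda>b. \<mu> (Inst b)" r s
    by unfold_locales (use rs keisler_weights[OF \<mu>] in auto)
  obtain d where d: "\<And>a. a ` {..<d} \<subseteq> tuples (Dom U) (xlen \<phi>) \<Longrightarrow> \<not> vc_shattered (holds U \<phi>) pts d a"
    using NIP_bounded_vc[OF mon pform nip] by blast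
  have "insts \<subseteq> tuples (Dom U) (xlen \<phi>)" using M(3) by (auto simp: tuples_def)
  then obtain n where n: "derived n = {}" using derived_eventually_empty[of d] d by (meson order_trans)
  define W where "W = (\<Union>k<n. layer k)"
  have W: "b \<in> W \<longleftrightarrow> (\<exists>k<n. b \<in> layer k)" for b by (auto simp: W_def)
  have derived_eq: "derived k = cl (derived k)" for k
    using derived_closed[of k] subset_pat_closure[OF derived_subset[of k]] by blast
  have layer_sub: "layer k \<subseteq> pts" for k
    using upper_subset[of k] derived_subset[of k] by (auto simp: layer_def)
  have "DBSC (stone_space U (opp \<phi>) M)
      (\<lambda>q. \<Sum>k<n. of_bool (rep q \<in> upper k) - of_bool (rep q \<in> derived (Suc k)))"
  proof (intro DBSC_sum DBSC_diff)
    fix k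
    show "DBSC (stone_space U (opp \<phi>) M) (\<lambda>q. of_bool (rep q \<in> upper k))"
      unfolding upper_def by (rule DBSC_cl)
    show "DBSC (stone_space U (opp \<phi>) M) (\<lambda>q. of_bool (rep q \<in> derived (Suc k)))"
      by (subst derived_eq) (rule DBSC_cl)
  qed
  then have 1: "DBSC (stone_space U (opp \<phi>) M) (\<lambda>q. of_bool (rep q \<in> W))"
    unfolding sum_layers W .
  have bc_layer: "layer k \<in> boolean_combinations pts (closed_over L U (ParVars \<phi>) M)" for k
    unfolding layer_def
  proof (rule boolean_combinations_diff)
    show "upper k \<in> boolean_combinations pts (closed_over L U (ParVars \<phi>) M)"
      unfolding upper_def by (rule boolean_combinations.basic[OF cl_closed_over])
    show "derived (Suc k) \<in> boolean_combinations pts (closed_over L U (ParVars \<phi>) M)"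
      by (subst derived_eq) (rule boolean_combinations.basic[OF cl_closed_over])
    show "upper k \<subseteq> pts" using upper_subset[of k] derived_subset[of k] by blast
  qed
  have "(\<Union>k<m. layer k) \<in> boolean_combinations pts (closed_over L U (ParVars \<phi>) M)" for m
  proof (induction m)
    case 0
    \<comment> \<open>\<open>boolean_combinations\<close> has no rule for the empty set; the
      difference of a layer with itself provides it.\<close>
    have "layer 0 - layer 0 \<in> boolean_combinations pts (closed_over L U (ParVars \<phi>) M)"
      by (intro boolean_combinations_diff bc_layer layer_sub)
    then show ?case by simp
  next
    case (Suc m)
    have "(\<Union>k<Suc m. layer k) = (\<Union>k<m. layer k) \<union> layer m" by (auto simp: less_Suc_eq)
    then show ?case
      using boolean_combinations_Un[OF Suc.IH bc_layer[of m]] layer_sub by auto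
  qed
  then have 2: "W \<in> boolean_combinations pts (closed_over L U (ParVars \<phi>) M)" by (simp add: W_def)
  have "W \<subseteq> pts" using layer_sub by (auto simp: W_def)
  moreover have "\<forall>b\<in>pts. s \<le> \<mu> (Inst b) \<longrightarrow> b \<in> W" using layer_separates(1)[OF _ n] W by blast
  moreover have "\<forall>b\<in>pts. \<mu> (Inst b) \<le> r \<longrightarrow> b \<notin> W" using layer_separates(2)[OF _ n] W by blast
  ultimately show ?thesis using 1 2 by blast
qed

lemma NIP_baire_half_definable:
  assumes nip: "NIP U \<phi>" and \<mu>: "keisler_phi_measure U \<phi> \<mu>" "measure_fin_sat U \<phi> M \<mu>"
  shows "baire_half_definable U \<phi> M \<mu>"
proof -
  let ?X = "stone_space U (opp \<phi>) M"
  define F where "F = (\<lambda>q. \<mu> (Inst (rep q)))"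
  have F: "F (tp b) = \<mu> (Inst b)" if b: "b \<in> pts" for b
    unfolding F_def using rep[OF tp_in_types[OF b]] b
    by (intro measure_depends_on_type[OF \<mu>])
  have "\<exists>g. DBSC ?X g \<and> (\<forall>q\<in>types. \<bar>F q - g q\<bar> \<le> 1 / (real n + 1))" for n
  proof -
    \<comment> \<open>For each \<open>j\<close> a set separates the values above
      \<open>(j + 1) / N\<close> from those below \<open>j / N\<close>. Counting the sets that
      contain a point gives \<open>N\<close> times its value up to an error of 1.\<close>
    let ?N = "Suc n"
    have "\<exists>W\<subseteq>pts. (\<forall>b\<in>pts. (real j + 1) / real ?N \<le> \<mu> (Inst b) \<longrightarrow> b \<in> W) \<and>
        (\<forall>b\<in>pts. \<mu> (Inst b) \<le> real j / real ?N \<longrightarrow> b \<notin> W) \<and>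
        DBSC ?X (\<lambda>q. of_bool (rep q \<in> W)) \<and>
        W \<in> boolean_combinations pts (closed_over L U (ParVars \<phi>) M)" for j
      by (rule NIP_separating_set[OF nip \<mu>]) (simp add: divide_strict_right_mono)
    then obtain W where W: "\<And>j b. b \<in> pts \<Longrightarrow> (real j + 1) / real ?N \<le> \<mu> (Inst b) \<Longrightarrow> b \<in> W j"
      "\<And>j b. b \<in> pts \<Longrightarrow> \<mu> (Inst b) \<le> real j / real ?N \<Longrightarrow> b \<notin> W j"
      "\<And>j. DBSC ?X (\<lambda>q. of_bool (rep q \<in> W j))" by metis
    define g where "g = (\<lambda>q. (1 / real ?N) * (\<Sum>j<?N. of_bool (rep q \<in> W j)))"
    have "DBSC ?X g" unfolding g_def by (intro DBSC_cmult DBSC_sum W(3))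
    moreover have "\<bar>F q - g q\<bar> \<le> 1 / (real n + 1)" if q: "q \<in> types" for q
    proof -
      have b: "rep q \<in> pts" by (rule rep(1)[OF q])
      let ?y = "real ?N * \<mu> (Inst (rep q))"
      have "\<bar>?y - (\<Sum>j<?N. of_bool (rep q \<in> W j))\<bar> \<le> 1"
      proof (rule count_thresholds)
        show "0 \<le> ?y" using measure_Inst_bounds[OF \<mu> b] by simp
        show "?y \<le> real ?N" using measure_Inst_bounds[OF \<mu> b] by (simp add: mult_left_le)
        show "rep q \<in> W j" if "real j + 1 \<le> ?y" for j
          by (rule W(1)[OF b]) (use that in \<open>simp add: field_simps\<close>)
        show "rep q \<notin> W j" if "?y \<le> real j" for j
          by (rule W(2)[OF b]) (use that in \<open>simp add: field_simps\<close>)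
      qed
      moreover have "?y - (\<Sum>j<?N. of_bool (rep q \<in> W j)) = real ?N * (F q - g q)"
        by (simp add: F_def g_def field_simps del: sum.lessThan_Suc)
      ultimately have "real ?N * \<bar>F q - g q\<bar> \<le> 1" by (simp add: abs_mult)
      then show ?thesis by (simp add: field_simps)
    qed
    ultimately show ?thesis by blast
  qed
  then obtain g where g: "\<And>n. DBSC ?X (g n)" "\<And>n q. q \<in> types \<Longrightarrow> \<bar>F q - g n q\<bar> \<le> 1 / (real n + 1)"
    by metis
  have "uniform_limit (topspace ?X) g F sequentially"
  proof (rule uniform_limitI)
    fix e :: real assume "0 < e"
    then obtain m where m: "1 / (real m + 1) < e"
      using reals_Archimedean[of e] by (auto simp: inverse_eq_divide add.commute)
    have "dist (g n q) (F q) < e" if "m \<le> n" "q \<in> types" for n q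
    proof -
      have "1 / (real n + 1) \<le> 1 / (real m + 1)" using that(1) by (simp add: frac_le)
      then show ?thesis using g(2)[OF that(2), of n] m by (simp add: dist_real_def abs_minus_commute)
    qed
    then show "\<forall>\<^sub>F n in sequentially. \<forall>q\<in>topspace ?X. dist (g n q) (F q) < e"
      unfolding topspace_stone by (auto simp: eventually_sequentially)
  qed
  then have "baire_half ?X F" unfolding baire_half_def using g(1) by blast
  then show ?thesis unfolding baire_half_definable_def using F by blast
qed

text \<open>The measure of a type takes only the values 0 and 1, so a gap strictly between them
  makes the separating set equal to the defining set.\<close>

lemma NIP_strongly_borel_definable:
  assumes nip: "NIP U \<phi>" and p: "p \<in> phi_types U \<phi> (Dom U)" "type_fin_sat U \<phi> M p"
  shows "strongly_borel_definable L U \<phi> M p"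
proof -
  obtain W where W: "W \<subseteq> pts" "\<forall>b\<in>pts. 2 / 3 \<le> (of_bool (Inst b \<in> p) :: real) \<longrightarrow> b \<in> W"
    "\<forall>b\<in>pts. (of_bool (Inst b \<in> p) :: real) \<le> 1 / 3 \<longrightarrow> b \<notin> W"
    "W \<in> boolean_combinations pts (closed_over L U (ParVars \<phi>) M)"
    using NIP_separating_set[OF nip type_keisler_measure[OF p(1)] type_measure_fin_sat[OF p(2)], of "1 / 3" "2 / 3"]
    by auto
  have "Inst b \<in> p \<longleftrightarrow> b \<in> W" if "b \<in> pts" for b
    using W(2,3) that by (cases "Inst b \<in> p") auto
  then have "{b \<in> pts. Inst b \<in> p} = W" using W(1) by blast
  then show ?thesis unfolding strongly_borel_definable_def using W(4) by simp
qed

end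

section \<open>Countable elementary substructures and nonprincipal limits\<close>

instance trm :: (countable) countable by countable_datatype
instance fm :: (countable, countable) countable by countable_datatype

lemma is_term_set_trm: "is_term L t \<Longrightarrow> set_trm t \<subseteq> Funs L"
  by (induction t) (auto simp: list_all_iff)

lemma is_formula_set_fm: "is_formula L \<psi> \<Longrightarrow> set1_fm \<psi> \<subseteq> Funs L \<and> set2_fm \<psi> \<subseteq> Rels L"
proof (induction \<psi>)
  case (Eq s t)
  then show ?case using is_term_set_trm[of L s] is_term_set_trm[of L t] by auto
next
  case (Rel r ts)
  then show ?case using is_term_set_trm by (fastforce simp: list_all_iff)
qed auto

text \<open>The types \<open>'f\<close> and \<open>'r\<close> may be uncountable. Enumerating the
  symbols of \<open>L\<close> exhibits its formulas as images of formulas with symbols in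
  \<open>nat\<close>.\<close>

lemma countable_formulas:
  assumes "countable_language L"
  shows "countable {\<psi>. is_formula L \<psi>}"
proof -
  have c: "countable (Funs L)" "countable (Rels L)" using assms by (auto simp: countable_language_def)
  let ?enc = "map_fm (to_nat_on (Funs L)) (to_nat_on (Rels L))"
  let ?dec = "map_fm (from_nat_into (Funs L)) (from_nat_into (Rels L))"
  have "\<psi> = ?dec (?enc \<psi>)" if "is_formula L \<psi>" for \<psi>
  proof -
    have "?dec (?enc \<psi>) = map_fm id id \<psi>"
      unfolding fm.map_comp
      by (rule fm.map_cong0) (use is_formula_set_fm[OF that] c in \<open>auto intro: from_nat_into_to_nat_on\<close>)
    then show ?thesis by (simp add: fm.map_id)
  qed
  then have "{\<psi>. is_formula L \<psi>} \<subseteq> range ?dec" by blast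
  then show ?thesis by (rule countable_subset) simp
qed

text \<open>Zorn's lemma among filters of infinite sets. By maximality, a set that meets every
  member of \<open>D\<close> in an infinite set belongs to \<open>D\<close>, and this decides
  between a set and its complement.\<close>

lemma nonprincipal_ultrafilter:
  "\<exists>D :: nat set set. (\<forall>A\<in>D. \<forall>B\<in>D. A \<inter> B \<in> D) \<and> (\<forall>A\<in>D. \<forall>B. A \<subseteq> B \<longrightarrow> B \<in> D) \<and>
     (\<forall>A. A \<in> D \<or> - A \<in> D) \<and> (\<forall>A\<in>D. infinite A)"
proof -
  define \<A> where "\<A> = {F :: nat set set. UNIV \<in> F \<and> (\<forall>A\<in>F. \<forall>B\<in>F. A \<inter> B \<in> F) \<and>
      (\<forall>A\<in>F. \<forall>B. A \<subseteq> B \<longrightarrow> B \<in> F) \<and> (\<forall>A\<in>F. infinite A)}"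
  have "\<exists>D\<in>\<A>. \<forall>F\<in>\<A>. D \<subseteq> F \<longrightarrow> F = D"
  proof (rule subset_Zorn_nonempty)
    have "{UNIV} \<in> \<A>" by (auto simp: \<A>_def)
    then show "\<A> \<noteq> {}" by blast
    fix \<C> assume ne: "\<C> \<noteq> {}" and ch: "subset.chain \<A> \<C>"
    have sub: "\<C> \<subseteq> \<A>" using ch by (simp add: subset.chain_def)
    have lin: "F \<subseteq> G \<or> G \<subseteq> F" if "F \<in> \<C>" "G \<in> \<C>" for F G
      using ch that by (auto simp: subset.chain_def)
    show "\<Union>\<C> \<in> \<A>"
      unfolding \<A>_def
    proof (intro CollectI conjI ballI allI impI)
      show "UNIV \<in> \<Union>\<C>" using ne sub by (auto simp: \<A>_def)
      show "A \<inter> B \<in> \<Union>\<C>" if AB: "A \<in> \<Union>\<C>" "B \<in> \<Union>\<C>" for A B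
      proof -
        obtain F G where FG: "F \<in> \<C>" "A \<in> F" "G \<in> \<C>" "B \<in> G" using AB by blast
        then obtain H where "H \<in> \<C>" "A \<in> H" "B \<in> H" using lin[OF FG(1,3)] by blast
        then have "A \<inter> B \<in> H" using sub unfolding \<A>_def by blast
        then show ?thesis using \<open>H \<in> \<C>\<close> by blast
      qed
      show "B \<in> \<Union>\<C>" if AB: "A \<in> \<Union>\<C>" "A \<subseteq> B" for A B
      proof -
        obtain F where "F \<in> \<C>" "A \<in> F" using AB by blast
        then have "B \<in> F" using AB(2) sub unfolding \<A>_def by blast
        then show ?thesis using \<open>F \<in> \<C>\<close> by blast
      qed
      show "infinite A" if "A \<in> \<Union>\<C>" for A using that sub unfolding \<A>_def by blast
    qed
  qed
  then obtain D where D: "D \<in> \<A>" and max: "\<And>F. F \<in> \<A> \<Longrightarrow> D \<subseteq> F \<Longrightarrow> F = D" by blast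
  have D': "UNIV \<in> D" "\<And>A B. A \<in> D \<Longrightarrow> B \<in> D \<Longrightarrow> A \<inter> B \<in> D"
    "\<And>A B. A \<in> D \<Longrightarrow> A \<subseteq> B \<Longrightarrow> B \<in> D" "\<And>A. A \<in> D \<Longrightarrow> infinite A"
    using D unfolding \<A>_def by blast+
  have adjoin: "A \<in> D" if inf: "\<And>B. B \<in> D \<Longrightarrow> infinite (A \<inter> B)" for A
  proof -
    let ?F = "{C. \<exists>B\<in>D. A \<inter> B \<subseteq> C}"
    have "?F \<in> \<A>"
      unfolding \<A>_def
    proof (intro CollectI conjI ballI allI impI)
      show "\<exists>B\<in>D. A \<inter> B \<subseteq> UNIV" using D'(1) by blast
      show "\<exists>B\<in>D. A \<inter> B \<subseteq> X \<inter> Y" if "X \<in> ?F" "Y \<in> ?F" for X Y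
      proof -
        obtain B C where "B \<in> D" "A \<inter> B \<subseteq> X" "C \<in> D" "A \<inter> C \<subseteq> Y" using \<open>X \<in> ?F\<close> \<open>Y \<in> ?F\<close> by blast
        then show ?thesis using D'(2)[of B C] by (intro bexI[of _ "B \<inter> C"]) auto
      qed
      show "\<exists>B\<in>D. A \<inter> B \<subseteq> Y" if "X \<in> ?F" "X \<subseteq> Y" for X Y using that by blast
      show "infinite X" if "X \<in> ?F" for X using that inf infinite_super by blast
    qed
    moreover have "D \<subseteq> ?F" by blast
    ultimately have "?F = D" by (rule max)
    moreover have "A \<in> ?F" using D'(1) by blast
    ultimately show ?thesis by blast
  qed
  have "A \<in> D \<or> - A \<in> D" for A
  proof (rule disjCI)
    assume "- A \<notin> D"
    then obtain B where B: "B \<in> D" "finite (- A \<inter> B)" using adjoin by blast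
    show "A \<in> D"
    proof (rule adjoin)
      fix C assume "C \<in> D"
      then have "infinite (B \<inter> C)" using B(1) D'(2,4) by blast
      moreover have "B \<inter> C \<subseteq> (A \<inter> C) \<union> (- A \<inter> B)" by blast
      ultimately show "infinite (A \<inter> C)" using B(2) by (meson finite_UnI finite_subset)
    qed
  qed
  then show ?thesis using D' by (intro exI[of _ D]) blast
qed

text \<open>The witness condition also gives closure under functions, through an equation in which
  the variables below the arity hold the arguments and the next one holds the value.\<close>

lemma tarski_vaught:
  assumes U: "is_struc L U" and M: "M \<subseteq> Dom U" "M \<noteq> {}"
    and wit: "\<And>\<psi> v e. is_formula L \<psi> \<Longrightarrow> range e \<subseteq> M \<Longrightarrow> \<exists>a\<in>Dom U. sat U (e(v := a)) \<psi> \<Longrightarrow>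
      \<exists>a\<in>M. sat U (e(v := a)) \<psi>"
  shows "elem_substructure L M U"
proof -
  obtain d where d: "d \<in> M" using M(2) by blast
  have "fint U f as \<in> M" if f: "f \<in> Funs L" and as: "as \<in> tuples M (farity L f)" for f as
  proof -
    let ?k = "farity L f"
    let ?\<psi> = "Eq (Var ?k) (Fn f (map Var [0..<?k]))"
    let ?e = "\<lambda>n. if n < ?k then as ! n else d"
    have as': "set as \<subseteq> M" "length as = ?k" using as by (auto simp: tuples_def)
    have form: "is_formula L ?\<psi>" using f by (simp add: list_all_iff)
    have rng: "range ?e \<subseteq> M" using as' d by (auto simp: set_conv_nth)
    have "map (tval U (?e(?k := a))) (map Var [0..<?k]) = as" for a
      using as'(2) by (intro nth_equalityI) auto
    then have sat: "sat U (?e(?k := a)) ?\<psi> \<longleftrightarrow> a = fint U f as" for a by simp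
    have "fint U f as \<in> Dom U" using U f as M(1) by (auto simp: is_struc_def tuples_def)
    then have "\<exists>a\<in>Dom U. sat U (?e(?k := a)) ?\<psi>" unfolding sat by blast
    then have "\<exists>a\<in>M. sat U (?e(?k := a)) ?\<psi>" by (rule wit[OF form rng])
    then show ?thesis unfolding sat by blast
  qed
  then have struc: "is_struc L (restr U M)" using M(2) by (simp add: is_struc_def restr_def)
  have tval: "tval (U\<lparr>Dom := M\<rparr>) e t = tval U e t" for e t
    by (induction t) (simp_all cong: map_cong)
  have "sat (restr U M) e \<psi> \<longleftrightarrow> sat U e \<psi>" if "is_formula L \<psi>" "range e \<subseteq> M" for \<psi> e
    using that
  proof (induction \<psi> arbitrary: e)
    case (Ex v \<psi>)
    have "sat (restr U M) (e(v := a)) \<psi> \<longleftrightarrow> sat U (e(v := a)) \<psi>" if "a \<in> M" for a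
      using Ex.prems that by (intro Ex.IH) auto
    then have "sat (restr U M) e (Ex v \<psi>) \<longleftrightarrow> (\<exists>a\<in>M. sat U (e(v := a)) \<psi>)"
      by (auto simp: restr_def)
    also have "\<dots> \<longleftrightarrow> (\<exists>a\<in>Dom U. sat U (e(v := a)) \<psi>)"
      using wit[of \<psi> e v] Ex.prems M(1) by auto
    finally show ?case by simp
  qed (simp_all add: restr_def tval cong: map_cong)
  then show ?thesis using M(1) struc unfolding elem_substructure_def by blast
qed

lemma downward_loewenheim_skolem:
  assumes L: "countable_language L" and U: "is_struc L U" and A: "countable A" "A \<subseteq> Dom U"
  shows "\<exists>M. countable M \<and> A \<subseteq> M \<and> elem_substructure L M U"
proof -
  obtain d where d: "d \<in> Dom U" using U by (auto simp: is_struc_def)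
  \<comment> \<open>Only finitely many values of an assignment matter to a formula, so Skolem
    witnesses are indexed by finite lists, padded by \<open>d\<close>; this keeps every closure step
    countable.\<close>
  define env where "env = (\<lambda>l n. if n < length l then l ! n else d)"
  define wit where "wit = (\<lambda>(\<psi>, v, l). if \<exists>a\<in>Dom U. sat U ((env l)(v := a)) \<psi>
      then SOME a. a \<in> Dom U \<and> sat U ((env l)(v := a)) \<psi> else d)"
  have wit: "wit p \<in> Dom U" for p
    using someI_ex[of "\<lambda>a. a \<in> Dom U \<and> sat U ((env (snd (snd p)))(fst (snd p) := a)) (fst p)"] d
    by (cases p) (auto simp: wit_def)
  define H where "H = (\<lambda>B. B \<union> wit ` ({\<psi>. is_formula L \<psi>} \<times> UNIV \<times> lists B))"
  define N where "N = (\<lambda>n. (H ^^ n) (insert d A))"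
  have N: "countable (N n) \<and> N n \<subseteq> Dom U" for n
  proof (induction n)
    case 0
    then show ?case using A d by (simp add: N_def)
  next
    case (Suc n)
    have "N (Suc n) = H (N n)" by (simp add: N_def)
    moreover have "countable ({\<psi>. is_formula L \<psi>} \<times> (UNIV :: nat set) \<times> lists (N n))"
      using Suc countable_formulas[OF L] by (intro countable_SIGMA countable_lists) auto
    ultimately show ?case using Suc wit by (auto simp: H_def)
  qed
  have N_mono: "m \<le> n \<Longrightarrow> N m \<subseteq> N n" for m n
    by (induction n rule: dec_induct) (auto simp: N_def H_def)
  define M where "M = (\<Union>n. N n)"
  have M: "countable M" "M \<subseteq> Dom U" "insert d A \<subseteq> M"
    using N by (auto simp: M_def) (auto simp: N_def intro: exI[of _ 0])
  have "elem_substructure L M U"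
  proof (rule tarski_vaught[OF U M(2)])
    show "M \<noteq> {}" using M(3) by blast
    fix \<psi> v and e :: "nat \<Rightarrow> 'c" assume \<psi>: "is_formula L \<psi>" and e: "range e \<subseteq> M"
      and ex: "\<exists>a\<in>Dom U. sat U (e(v := a)) \<psi>"
    obtain k where k: "\<forall>u\<in>fvars \<psi>. u < k" using finite_fvars finite_nat_set_iff_bounded by blast
    let ?l = "map e [0..<k]"
    have env: "sat U ((env ?l)(v := a)) \<psi> \<longleftrightarrow> sat U (e(v := a)) \<psi>" for a
      by (rule sat_cong) (use k in \<open>auto simp: env_def\<close>)
    have "\<forall>i. \<exists>n. e i \<in> N n" using e by (auto simp: M_def)
    then obtain n where n: "\<And>i. e i \<in> N (n i)" by metis
    \<comment> \<open>\<open>{..k}\<close> instead of \<open>{..<k}\<close> keeps the set nonempty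
      for \<open>k = 0\<close>. The stages increase, so one of them contains the whole list.\<close>
    let ?m = "Max (n ` {..k})"
    have "e i \<in> N ?m" if "i < k" for i
      using n[of i] N_mono[of "n i" ?m] that by (auto intro!: Max_ge)
    then have "?l \<in> lists (N ?m)" by auto
    then have "wit (\<psi>, v, ?l) \<in> N (Suc ?m)" using \<psi> by (auto simp: N_def H_def)
    then have "wit (\<psi>, v, ?l) \<in> M" by (auto simp: M_def)
    moreover have "sat U (e(v := wit (\<psi>, v, ?l))) \<psi>"
    proof -
      have "wit (\<psi>, v, ?l) = (SOME a. a \<in> Dom U \<and> sat U (e(v := a)) \<psi>)"
        unfolding wit_def prod.case using ex by (simp only: env if_True)
      then show ?thesis using ex someI_ex[of "\<lambda>a. a \<in> Dom U \<and> sat U (e(v := a)) \<psi>"] by auto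
    qed
    ultimately show "\<exists>a\<in>M. sat U (e(v := a)) \<psi>" by blast
  qed
  then show ?thesis using M by blast
qed

section \<open>Countable unions of closed sets and a category argument\<close>

definition fsigma_in :: "'x set set \<Rightarrow> 'x set \<Rightarrow> bool" where
  "fsigma_in G X \<longleftrightarrow> (\<exists>\<C>\<subseteq>G. countable \<C> \<and> X = \<Union>\<C>)"

lemma fsigma_in_UN:
  assumes "countable I" "\<And>i. i \<in> I \<Longrightarrow> C i \<in> G"
  shows "fsigma_in G (\<Union>i\<in>I. C i)"
  unfolding fsigma_in_def using assms by (intro exI[of _ "C ` I"]) auto

lemma fsigma_in_Un: "fsigma_in G X \<Longrightarrow> fsigma_in G Y \<Longrightarrow> fsigma_in G (X \<union> Y)"
  unfolding fsigma_in_def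
proof (elim exE conjE)
  fix \<C> \<D> assume "\<C> \<subseteq> G" "\<D> \<subseteq> G" "countable \<C>" "countable \<D>" "X = \<Union>\<C>" "Y = \<Union>\<D>"
  then show "\<exists>\<C>\<subseteq>G. countable \<C> \<and> X \<union> Y = \<Union>\<C>" by (intro exI[of _ "\<C> \<union> \<D>"]) auto
qed

lemma fsigma_in_Int:
  assumes G: "\<And>C D. C \<in> G \<Longrightarrow> D \<in> G \<Longrightarrow> C \<inter> D \<in> G" and "fsigma_in G X" "fsigma_in G Y"
  shows "fsigma_in G (X \<inter> Y)"
proof -
  obtain \<C> \<D> where C: "\<C> \<subseteq> G" "countable \<C>" "X = \<Union>\<C>" and D: "\<D> \<subseteq> G" "countable \<D>" "Y = \<Union>\<D>"
    using assms(2,3) unfolding fsigma_in_def by blast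
  have "X \<inter> Y = (\<Union>p\<in>\<C> \<times> \<D>. fst p \<inter> snd p)" using C(3) D(3) by auto
  also have "fsigma_in G \<dots>"
  proof (rule fsigma_in_UN)
    show "countable (\<C> \<times> \<D>)" using C(2) D(2) by simp
    show "fst p \<inter> snd p \<in> G" if "p \<in> \<C> \<times> \<D>" for p
      using that C(1) D(1) by (intro G) auto
  qed
  finally show ?thesis .
qed

context phi_setting
begin

abbreviation closed_sets :: "'a list set set" where
  "closed_sets \<equiv> closed_over L U (ParVars \<phi>) M"

text \<open>Carrying the complement along makes the induction pass through complements. A point
  outside a closed set violates a single formula, so the complement is a union of sets defined by
  one formula; a countable language and one common \<open>\<epsilon>\<close> leave countably many of
  these.\<close>

lemma boolean_combination_fsigma:
  assumes L: "countable_language L" and X: "X \<in> boolean_combinations pts closed_sets"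
  shows "X \<subseteq> pts \<and> fsigma_in closed_sets X \<and> fsigma_in closed_sets (pts - X)"
  using X
proof induction
  case (basic X)
  then obtain \<pi> where \<pi>: "X = realizations U (ParVars \<phi>) \<pi>" "\<pi> \<subseteq> par_formulas L M (ParVars \<phi>)"
    by (auto simp: closed_over_def)
  obtain \<epsilon> where \<epsilon>: "range \<epsilon> \<subseteq> M"
    and common: "\<forall>\<psi> e. (\<psi>, e) \<in> par_formulas L M (ParVars \<phi>) \<longrightarrow>
      (\<exists>\<theta>. is_formula L \<theta> \<and> (\<forall>U c. length c = ylen \<phi> \<longrightarrow>
        sat U (asg e (ParVars \<phi>) c) \<psi> = sat U (asg \<epsilon> (ParVars \<phi>) c) \<theta>))"
    using common_parameters[OF M(1,2), of L "ParVars \<phi>"] by (elim exE conjE) (rule that)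
  let ?neg = "\<lambda>\<theta>. realizations U (ParVars \<phi>) {(Neg \<theta>, \<epsilon>)}"
  have neg: "b \<in> ?neg \<theta> \<longleftrightarrow> b \<in> pts \<and> \<not> sat U (asg \<epsilon> (ParVars \<phi>) b) \<theta>" for b \<theta>
    by (simp add: realizations_def)
  \<comment> \<open>Formulas are selected by their meaning, so \<open>\<pi>\<close>, with its many
    parameter assignments, is not itself enumerated.\<close>
  let ?\<Theta> = "{\<theta>. is_formula L \<theta> \<and> ?neg \<theta> \<inter> X = {}}"
  have "pts - X = (\<Union>\<theta>\<in>?\<Theta>. ?neg \<theta>)"
  proof
    show "pts - X \<subseteq> (\<Union>\<theta>\<in>?\<Theta>. ?neg \<theta>)"
    proof
      fix b assume b: "b \<in> pts - X"
      then obtain \<psi> e where p: "(\<psi>, e) \<in> \<pi>" "\<not> sat U (asg e (ParVars \<phi>) b) \<psi>"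
        unfolding \<pi>(1) realizations_def by auto
      then obtain \<theta> where \<theta>: "is_formula L \<theta>" "\<And>c. length c = ylen \<phi> \<Longrightarrow>
          sat U (asg e (ParVars \<phi>) c) \<psi> = sat U (asg \<epsilon> (ParVars \<phi>) c) \<theta>"
        using common \<pi>(2) by blast
      have len: "length c = ylen \<phi>" if "c \<in> pts" for c using that by (simp add: tuples_def)
      have "?neg \<theta> \<inter> X = {}"
        using \<theta>(2) p(1) len by (fastforce simp: neg \<pi>(1) realizations_def)
      moreover have "b \<in> ?neg \<theta>" using p(2) \<theta>(2)[OF len] b by (simp add: neg)
      ultimately show "b \<in> (\<Union>\<theta>\<in>?\<Theta>. ?neg \<theta>)" using \<theta>(1) by blast
    qed
    show "(\<Union>\<theta>\<in>?\<Theta>. ?neg \<theta>) \<subseteq> pts - X" using neg by blast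
  qed
  also have "fsigma_in closed_sets \<dots>"
  proof (rule fsigma_in_UN)
    show "countable ?\<Theta>" by (rule countable_subset[OF _ countable_formulas[OF L]]) blast
    fix \<theta> assume "\<theta> \<in> ?\<Theta>"
    then have "{(Neg \<theta>, \<epsilon>)} \<subseteq> par_formulas L M (ParVars \<phi>)" using \<epsilon> by (auto simp: par_formulas_def)
    then show "?neg \<theta> \<in> closed_sets" unfolding closed_over_def by blast
  qed
  finally have "fsigma_in closed_sets (pts - X)" .
  moreover have "fsigma_in closed_sets X"
    using fsigma_in_UN[of "{()}" "\<lambda>_. X" closed_sets] basic by simp
  moreover have "X \<subseteq> pts" unfolding \<pi>(1) realizations_def by auto
  ultimately show ?case by blast
next
  case (compl X)
  then have "pts - (pts - X) = X" by blast
  then show ?case using compl.IH by auto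
next
  case (inter X Y)
  have "pts - X \<inter> Y = (pts - X) \<union> (pts - Y)" by blast
  moreover have "fsigma_in closed_sets (X \<inter> Y)"
    using inter.IH by (intro fsigma_in_Int closed_over_Int) auto
  ultimately show ?case using inter.IH fsigma_in_Un by fastforce
qed

text \<open>Sets defined by Boolean combinations are closed under intersection, so they form a base
  and not only a subbase; a closed set of types is therefore an intersection of such sets.\<close>

lemma closedin_closed_over:
  assumes "closedin (stone_space U (opp \<phi>) M) K"
  shows "{b \<in> pts. tp b \<in> K} \<in> closed_sets"
proof -
  let ?F = "phi_formulas (opp \<phi>) M"
  let ?G = "{{q \<in> types. \<psi> \<in> q} | \<psi>. \<psi> \<in> ?F}"
  have K: "K \<subseteq> types" "generate_topology_on ?G (types - K)"
    using assms unfolding closedin_def topspace_stone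
    by (auto simp: stone_space_def openin_topology_generated_by_iff)
  have base: "\<exists>\<psi>\<in>?F. bsat U (opp \<phi>) b \<psi> \<and> (\<forall>c\<in>pts. bsat U (opp \<phi>) c \<psi> \<longrightarrow> tp c \<in> O')"
    if "generate_topology_on ?G O'" "b \<in> pts" "tp b \<in> O'" for O' b
    using that
  proof (induction arbitrary: b)
    case (Int A B)
    obtain \<psi> where 1: "\<psi> \<in> ?F" "bsat U (opp \<phi>) b \<psi>" "\<forall>c\<in>pts. bsat U (opp \<phi>) c \<psi> \<longrightarrow> tp c \<in> A"
      using Int by blast
    obtain \<theta> where 2: "\<theta> \<in> ?F" "bsat U (opp \<phi>) b \<theta>" "\<forall>c\<in>pts. bsat U (opp \<phi>) c \<theta> \<longrightarrow> tp c \<in> B"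
      using Int by blast
    show ?case
      by (rule bexI[of _ "BAnd \<psi> \<theta>"]) (use 1 2 in \<open>auto simp: bsat_def phi_formulas_def\<close>)
  next
    case (UN \<K>)
    then obtain k where "k \<in> \<K>" "tp b \<in> k" by blast
    then show ?case using UN.IH[of k b] UN.prems by blast
  next
    case (Basis A)
    then obtain \<psi> where \<psi>: "\<psi> \<in> ?F" "A = {q \<in> types. \<psi> \<in> q}" by blast
    then show ?case
      using Basis.prems mem_type_iff[OF _ \<psi>(1)] tp_in_types by (intro bexI[of _ \<psi>]) auto
  qed simp
  let ?\<Psi> = "{\<psi> \<in> ?F. \<forall>c\<in>pts. bsat U (opp \<phi>) c \<psi> \<longrightarrow> tp c \<notin> K}"
  \<comment> \<open>A contradictory formula keeps the index set of the intersection below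
    nonempty.\<close>
  obtain a where a: "a \<in> insts" using insts_nonempty by blast
  then have "BAnd (Inst a) (BNot (Inst a)) \<in> ?\<Psi>"
    by (simp add: phi_formulas_opp bsat_def)
  then have ne: "?\<Psi> \<noteq> {}" by blast
  have "{b \<in> pts. tp b \<in> K} = (\<Inter>\<psi>\<in>?\<Psi>. {b \<in> pts. bsat U (opp \<phi>) b (BNot \<psi>)})"
  proof
    show "{b \<in> pts. tp b \<in> K} \<subseteq> (\<Inter>\<psi>\<in>?\<Psi>. {b \<in> pts. bsat U (opp \<phi>) b (BNot \<psi>)})"
      by (auto simp: bsat_def)
    show "(\<Inter>\<psi>\<in>?\<Psi>. {b \<in> pts. bsat U (opp \<phi>) b (BNot \<psi>)}) \<subseteq> {b \<in> pts. tp b \<in> K}"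
    proof
      fix b assume b: "b \<in> (\<Inter>\<psi>\<in>?\<Psi>. {b \<in> pts. bsat U (opp \<phi>) b (BNot \<psi>)})"
      then have bp: "b \<in> pts" using ne by blast
      have "tp b \<in> K"
      proof (rule ccontr)
        assume "tp b \<notin> K"
        then have "tp b \<in> types - K" using tp_in_types[OF bp] by blast
        from base[OF K(2) bp this] obtain \<psi> where "\<psi> \<in> ?\<Psi>" "bsat U (opp \<phi>) b \<psi>" by blast
        then show False using b by (auto simp: bsat_def)
      qed
      then show "b \<in> {b \<in> pts. tp b \<in> K}" using bp by blast
    qed
  qed
  also have "\<dots> \<in> closed_sets"
    by (rule closed_over_INT[OF ne]) (rule bsat_closed_over, simp add: phi_formulas_def)
  finally show ?thesis .
qed

text \<open>Countably many closed pieces, each inside \<open>V\<close> or inside its complement,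
  would cover \<open>pts\<close>. Each is nowhere dense in the space of patterns on
  \<open>a\<close>, so nested finite patterns avoid one piece after the other, and a point realizing
  their limit lies in no piece.\<close>

lemma ultrafilter_not_fsigma:
  fixes D :: "nat set set" and a :: "nat \<Rightarrow> 'a list"
  assumes a: "\<And>i. a i \<in> insts" and b: "\<And>E. \<exists>c\<in>pts. \<forall>i. holds U \<phi> (a i) c \<longleftrightarrow> i \<in> E"
    and D: "\<And>A. A \<in> D \<or> - A \<in> D" "\<And>A. A \<in> D \<Longrightarrow> infinite A"
    and V: "V \<subseteq> pts" "\<And>c. c \<in> pts \<Longrightarrow> c \<in> V \<longleftrightarrow> {i. holds U \<phi> (a i) c} \<in> D"
    and fs: "fsigma_in closed_sets V" "fsigma_in closed_sets (pts - V)"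
  shows False
proof -
  obtain \<C> \<D> where CD: "\<C> \<subseteq> closed_sets" "countable \<C>" "V = \<Union>\<C>"
    "\<D> \<subseteq> closed_sets" "countable \<D>" "pts - V = \<Union>\<D>"
    using fs unfolding fsigma_in_def by (elim exE conjE) (rule that)
  define \<K> where "\<K> = \<C> \<union> \<D>"
  have cover: "\<Union>\<K> = pts" using CD(3,6) V(1) by (auto simp: \<K>_def)
  have \<K>: "countable \<K>" "\<K> \<noteq> {}" using CD(2,5) cover pts_nonempty by (auto simp: \<K>_def)
  have \<K>_cases: "K \<in> closed_sets \<and> (K \<subseteq> V \<or> K \<subseteq> pts - V)" if "K \<in> \<K>" for K
    using that CD by (auto simp: \<K>_def)
  define tr where "tr = (\<lambda>n c. {i. i < n \<and> holds U \<phi> (a i) c})"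
  \<comment> \<open>Otherwise, by saturation, the set \<open>K\<close> would contain points with every pattern extending
    \<open>E\<close>, both finite (outside \<open>D\<close>) and cofinite (in \<open>D\<close>), and would meet \<open>V\<close> and its complement.\<close>
  have step: "\<exists>n' E'. n \<le> n' \<and> E' \<subseteq> {..<n'} \<and> E' \<inter> {..<n} = E \<and> (\<forall>c\<in>K. tr n' c \<noteq> E')"
    if K: "K \<in> \<K>" and E: "E \<subseteq> {..<n}" for K n E
  proof (rule ccontr)
    assume no: "\<not> ?thesis"
    then have all: "\<exists>c\<in>K. tr n' c = E'" if "n \<le> n'" "E' \<subseteq> {..<n'}" "E' \<inter> {..<n} = E" for n' E'
      using that by blast
    \<comment> \<open>A piece of \<open>V\<close> receives the finite extension of \<open>E\<close>,
      a piece of the complement the cofinite one: in each case a pattern on the wrong side of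
      \<open>D\<close>.\<close>
    define G where "G = (if K \<subseteq> V then E else E \<union> {n..})"
    have G: "G \<inter> {..<n} = E" using E by (auto simp: G_def)
    have "\<exists>c\<in>K. \<forall>i\<in>UNIV. holds U \<phi> (a i) c \<longleftrightarrow> i \<in> G"
    proof (rule realize_pattern)
      show "K \<in> closed_sets" using \<K>_cases[OF K] by blast
      fix J :: "nat set" assume "finite J"
      then obtain m where m: "\<forall>i\<in>J. i < m" using finite_nat_set_iff_bounded by blast
      let ?m = "max n m"
      have "G \<inter> {..<?m} \<inter> {..<n} = E" using G by auto
      then obtain c where c: "c \<in> K" "tr ?m c = G \<inter> {..<?m}"
        using all[of ?m "G \<inter> {..<?m}"] by auto
      have "holds U \<phi> (a i) c \<longleftrightarrow> i \<in> G" if "i \<in> J" for i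
      proof -
        have "i < ?m" using m that by auto
        then have "holds U \<phi> (a i) c \<longleftrightarrow> i \<in> tr ?m c" by (simp add: tr_def)
        then show ?thesis unfolding c(2) using \<open>i < ?m\<close> by simp
      qed
      then show "\<exists>c\<in>K. \<forall>i\<in>J. holds U \<phi> (a i) c \<longleftrightarrow> i \<in> G" using c(1) by blast
    qed (rule a)
    then obtain c where c: "c \<in> K" "{i. holds U \<phi> (a i) c} = G" by auto
    have "c \<in> pts" using c(1) K cover by blast
    then have cV: "c \<in> V \<longleftrightarrow> G \<in> D" using V(2) c(2) by simp
    show False
    proof (cases "K \<subseteq> V")
      case True
      then have "E \<in> D" using c(1) cV by (auto simp: G_def)
      then show False using D(2) E finite_subset by blast
    next
      case False
      then have "K \<subseteq> pts - V" using \<K>_cases[OF K] by blast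
      then have "- G \<in> D" using c(1) cV D(1) by blast
      moreover have "- G \<subseteq> {..<n}" using False by (auto simp: G_def)
      ultimately show False using D(2) finite_subset by blast
    qed
  qed
  define K where "K = from_nat_into \<K>"
  have K: "K k \<in> \<K>" for k unfolding K_def by (rule from_nat_into[OF \<K>(2)])
  have "\<exists>f. \<forall>k. snd (f k) \<subseteq> {..<fst (f k)} \<and> (fst (f k) \<le> fst (f (Suc k)) \<and>
      snd (f (Suc k)) \<inter> {..<fst (f k)} = snd (f k) \<and> (\<forall>c\<in>K k. tr (fst (f (Suc k))) c \<noteq> snd (f (Suc k))))"
  proof (rule dependent_nat_choice)
    show "\<exists>x. snd x \<subseteq> {..<fst x :: nat}" by (rule exI[of _ "(0, {})"]) simp
    fix x :: "nat \<times> nat set" and k assume x: "snd x \<subseteq> {..<fst x}"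
    obtain n' E' where "fst x \<le> n' \<and> E' \<subseteq> {..<n'} \<and> E' \<inter> {..<fst x} = snd x \<and> (\<forall>c\<in>K k. tr n' c \<noteq> E')"
      using step[OF K[of k] x] by blast
    then show "\<exists>y. snd y \<subseteq> {..<fst y} \<and> (fst x \<le> fst y \<and>
        snd y \<inter> {..<fst x} = snd x \<and> (\<forall>c\<in>K k. tr (fst y) c \<noteq> snd y))"
      by (intro exI[of _ "(n', E')"]) auto
  qed
  then obtain f where f': "\<And>k. snd (f k) \<subseteq> {..<fst (f k)} \<and> (fst (f k) \<le> fst (f (Suc k)) \<and>
      snd (f (Suc k)) \<inter> {..<fst (f k)} = snd (f k) \<and> (\<forall>c\<in>K k. tr (fst (f (Suc k))) c \<noteq> snd (f (Suc k))))"
    by blast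
  have f: "snd (f k) \<subseteq> {..<fst (f k)}" "fst (f k) \<le> fst (f (Suc k))"
      "snd (f (Suc k)) \<inter> {..<fst (f k)} = snd (f k)"
      "c \<in> K k \<Longrightarrow> tr (fst (f (Suc k))) c \<noteq> snd (f (Suc k))" for k c
    using f'[of k] by blast+
  have coherent: "fst (f k) \<le> fst (f j) \<and> snd (f j) \<inter> {..<fst (f k)} = snd (f k)" if "k \<le> j" for j k
    using that
  proof (induction j rule: dec_induct)
    case base
    then show ?case using f(1) by blast
  next
    case (step j)
    have "x \<in> snd (f (Suc j)) \<longleftrightarrow> x \<in> snd (f j)" if "x < fst (f k)" for x
    proof -
      have "x \<in> {..<fst (f j)}" using that step.IH by simp
      then show ?thesis using f(3)[of j] by blast
    qed
    then have "snd (f (Suc j)) \<inter> {..<fst (f k)} = snd (f j) \<inter> {..<fst (f k)}" by blast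
    then show ?case using step.IH f(2)[of j] by simp
  qed
  define E where "E = (\<Union>k. snd (f k))"
  have E: "E \<inter> {..<fst (f k)} = snd (f k)" for k
  proof
    show "snd (f k) \<subseteq> E \<inter> {..<fst (f k)}" using f(1) by (auto simp: E_def)
    have "snd (f j) \<inter> {..<fst (f k)} \<subseteq> snd (f k)" for j
      using coherent[of j k] coherent[of k j] by (cases "j \<le> k") auto
    then show "E \<inter> {..<fst (f k)} \<subseteq> snd (f k)" by (auto simp: E_def)
  qed
  obtain c where c: "c \<in> pts" "\<And>i. holds U \<phi> (a i) c \<longleftrightarrow> i \<in> E" using b by blast
  obtain X where X: "X \<in> \<K>" "c \<in> X" using c(1) cover by blast
  obtain k where "K k = X"
    unfolding K_def using X(1) \<K>(1) by (metis from_nat_into_surj)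
  then have "tr (fst (f (Suc k))) c \<noteq> snd (f (Suc k))" using f(4) X(2) by blast
  moreover have "tr (fst (f (Suc k))) c = E \<inter> {..<fst (f (Suc k))}" using c(2) by (auto simp: tr_def)
  ultimately show False using E by simp
qed

text \<open>An approximation within \<open>1 / 4\<close> of a function with values 0 and 1 never
  takes the value \<open>1 / 2\<close>, so strict and weak inequality agree. Each set is then the
  union over \<open>m\<close> of the closed conditions that all \<open>g n\<close> with
  \<open>n \<ge> m\<close> lie on the proper side of \<open>1 / 2\<close>.\<close>

lemma baire_half_definable_fsigma:
  assumes bh: "baire_half_definable U \<phi> M (\<lambda>\<psi>. of_bool (\<psi> \<in> p))"
  shows "fsigma_in closed_sets {b \<in> pts. Inst b \<in> p}" "fsigma_in closed_sets (pts - {b \<in> pts. Inst b \<in> p})"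
proof -
  let ?X = "stone_space U (opp \<phi>) M" and ?V = "{b \<in> pts. Inst b \<in> p}"
  obtain F where F: "\<And>b. b \<in> pts \<Longrightarrow> F (tp b) = of_bool (Inst b \<in> p)" "baire_half ?X F"
    using bh unfolding baire_half_definable_def by blast
  obtain G where G: "\<And>k. DBSC ?X (G k)" "uniform_limit types G F sequentially"
    using F(2) unfolding baire_half_def topspace_stone by blast
  have "\<forall>\<^sub>F k in sequentially. \<forall>q\<in>types. dist (G k q) (F q) < 1 / 4"
    by (rule uniform_limitD[OF G(2)]) simp
  then obtain k where k: "\<And>q. q \<in> types \<Longrightarrow> dist (G k q) (F q) < 1 / 4"
    by (auto simp: eventually_sequentially)
  obtain g where g: "\<And>n. continuous_map ?X euclideanreal (g n)"
    "\<And>q. q \<in> types \<Longrightarrow> (\<lambda>n. g n q) \<longlonglongrightarrow> G k q"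
    using G(1)[of k] unfolding DBSC_def topspace_stone by blast
  have near: "\<bar>G k (tp b) - of_bool (Inst b \<in> p)\<bar> < 1 / 4" if "b \<in> pts" for b
    using k[OF tp_in_types[OF that]] F(1)[OF that] by (simp add: dist_real_def)
  have close: "1 / 2 < G k (tp b)" if "b \<in> pts" "Inst b \<in> p" for b
    using near[OF that(1)] that(2) by (simp add: abs_real_def split: if_splits)
  have far: "G k (tp b) < 1 / 2" if "b \<in> pts" "Inst b \<notin> p" for b
    using near[OF that(1)] that(2) by (simp add: abs_real_def split: if_splits)
  have closed: "{b \<in> pts. \<forall>n\<ge>m. g n (tp b) \<in> S} \<in> closed_sets" if "closed S" for m S
  proof -
    have "closedin ?X (\<Inter>n\<in>{m..}. {q \<in> topspace ?X. g n q \<in> S})"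
      using that by (intro closedin_INT closedin_continuous_map_preimage[OF g(1)]) auto
    then have "{b \<in> pts. tp b \<in> (\<Inter>n\<in>{m..}. {q \<in> topspace ?X. g n q \<in> S})} \<in> closed_sets"
      by (rule closedin_closed_over)
    moreover have "{b \<in> pts. tp b \<in> (\<Inter>n\<in>{m..}. {q \<in> topspace ?X. g n q \<in> S})}
        = {b \<in> pts. \<forall>n\<ge>m. g n (tp b) \<in> S}"
      using tp_in_types by (auto simp: topspace_stone)
    ultimately show ?thesis by simp
  qed
  have "?V = (\<Union>m. {b \<in> pts. \<forall>n\<ge>m. g n (tp b) \<in> {1 / 2..}})"
  proof (intro equalityI subsetI)
    fix b assume b: "b \<in> ?V"
    then have "1 / 2 < G k (tp b)" using close by auto
    then have "\<forall>\<^sub>F n in sequentially. 1 / 2 < g n (tp b)"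
      using b by (intro order_tendstoD(1)[OF g(2)] tp_in_types) auto
    then obtain m where "\<forall>n\<ge>m. 1 / 2 < g n (tp b)" by (auto simp: eventually_sequentially)
    then have "\<forall>n\<ge>m. g n (tp b) \<in> {1 / 2..}" by (auto intro: less_imp_le)
    then show "b \<in> (\<Union>m. {b \<in> pts. \<forall>n\<ge>m. g n (tp b) \<in> {1 / 2..}})" using b by blast
  next
    fix b assume "b \<in> (\<Union>m. {b \<in> pts. \<forall>n\<ge>m. g n (tp b) \<in> {1 / 2..}})"
    then obtain m where b: "b \<in> pts" and m: "\<And>n. m \<le> n \<Longrightarrow> 1 / 2 \<le> g n (tp b)" by auto
    have "1 / 2 \<le> G k (tp b)"
      by (rule LIMSEQ_le_const[OF g(2)[OF tp_in_types[OF b]]]) (use m in blast)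
    then have "Inst b \<in> p" using far[OF b] by fastforce
    then show "b \<in> ?V" using b by blast
  qed
  also have "fsigma_in closed_sets \<dots>"
    by (rule fsigma_in_UN) (simp, rule closed, simp)
  finally show "fsigma_in closed_sets ?V" .
  have "pts - ?V = (\<Union>m. {b \<in> pts. \<forall>n\<ge>m. g n (tp b) \<in> {..1 / 2}})"
  proof (intro equalityI subsetI)
    fix b assume b: "b \<in> pts - ?V"
    then have "G k (tp b) < 1 / 2" using far by auto
    then have "\<forall>\<^sub>F n in sequentially. g n (tp b) < 1 / 2"
      using b by (intro order_tendstoD(2)[OF g(2)] tp_in_types) auto
    then obtain m where "\<forall>n\<ge>m. g n (tp b) < 1 / 2" by (auto simp: eventually_sequentially)
    then have "\<forall>n\<ge>m. g n (tp b) \<in> {..1 / 2}" by (auto intro: less_imp_le)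
    then show "b \<in> (\<Union>m. {b \<in> pts. \<forall>n\<ge>m. g n (tp b) \<in> {..1 / 2}})" using b by blast
  next
    fix b assume "b \<in> (\<Union>m. {b \<in> pts. \<forall>n\<ge>m. g n (tp b) \<in> {..1 / 2}})"
    then obtain m where b: "b \<in> pts" and m: "\<And>n. m \<le> n \<Longrightarrow> g n (tp b) \<le> 1 / 2" by auto
    have "G k (tp b) \<le> 1 / 2"
      by (rule LIMSEQ_le_const2[OF g(2)[OF tp_in_types[OF b]]]) (use m in blast)
    then have "Inst b \<notin> p" using close[OF b] by fastforce
    then show "b \<in> pts - ?V" using b by blast
  qed
  also have "fsigma_in closed_sets \<dots>"
    by (rule fsigma_in_UN) (simp, rule closed, simp)
  finally show "fsigma_in closed_sets (pts - ?V)" .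
qed

end

text \<open>The conclusion is phrased with countable unions because Baire-1/2 definability and
  strong Borel definability both imply them; one type then refutes both.\<close>

lemma not_NIP_type:
  fixes L :: "('f, 'r) lang" and U :: "('f, 'r, 'a) struc"
  assumes cl: "countable_language L" and mon: "monster_model L \<kappa> U" and pform: "is_pformula L \<phi>"
    and T: "T \<subseteq> sentences L" "models L U T" and nip: "\<not> NIP U \<phi>"
  shows "\<exists>M p. phi_setting L \<kappa> U \<phi> M \<and> countable_model L T U M \<and>
    p \<in> phi_types U \<phi> (Dom U) \<and> type_fin_sat U \<phi> M p \<and>
    \<not> (fsigma_in (closed_over L U (ParVars \<phi>) M) {b \<in> tuples (Dom U) (ylen \<phi>). Inst b \<in> p} \<and>
       fsigma_in (closed_over L U (ParVars \<phi>) M)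
         (tuples (Dom U) (ylen \<phi>) - {b \<in> tuples (Dom U) (ylen \<phi>). Inst b \<in> p}))"
proof -
  obtain a :: "nat \<Rightarrow> 'a list" and b :: "nat set \<Rightarrow> 'a list"
    where ab: "\<And>i. a i \<in> tuples (Dom U) (xlen \<phi>)" "\<And>E. b E \<in> tuples (Dom U) (ylen \<phi>)"
      "\<And>i E. holds U \<phi> (a i) (b E) \<longleftrightarrow> i \<in> E"
    using nip unfolding NIP_def by auto
  have U: "is_struc L U" using T(2) by (simp add: models_def)
  have "countable (\<Union>i. set (a i))" by (rule countable_UN) (simp_all add: countable_finite)
  moreover have "(\<Union>i. set (a i)) \<subseteq> Dom U" using ab(1) by (auto simp: tuples_def)
  ultimately have "\<exists>M. countable M \<and> (\<Union>i. set (a i)) \<subseteq> M \<and> elem_substructure L M U"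
    by (rule downward_loewenheim_skolem[OF cl U])
  then obtain M where hull: "countable M" "(\<Union>i. set (a i)) \<subseteq> M" "elem_substructure L M U" by blast
  have sub: "M \<subseteq> Dom U" "is_struc L (restr U M)" using hull(3) by (simp_all add: elem_substructure_def)
  then have "M \<noteq> {}" by (simp add: is_struc_def restr_def)
  then interpret phi_setting L \<kappa> U \<phi> M
    by unfold_locales (use mon pform hull(1) sub(1) in auto)
  have "sat (restr U M) e \<sigma>" if "\<sigma> \<in> T" "range e \<subseteq> M" for \<sigma> e
  proof -
    have "is_formula L \<sigma>" using that(1) T(1) by (auto simp: sentences_def)
    moreover have "range e \<subseteq> Dom U" using that(2) sub(1) by blast
    then have "sat U e \<sigma>" using T(2) that(1) by (simp add: models_def)
    moreover have "\<forall>\<psi> e. is_formula L \<psi> \<longrightarrow> range e \<subseteq> M \<longrightarrow> (sat (restr U M) e \<psi> \<longleftrightarrow> sat U e \<psi>)"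
      using hull(3) unfolding elem_substructure_def by (elim conjE)
    ultimately show ?thesis using that(2) by metis
  qed
  then have "models L (restr U M) T"
    using sub(2) by (simp add: models_def) (simp add: restr_def)
  then have cm: "countable_model L T U M" using hull(1,3) by (simp add: countable_model_def)
  from nonprincipal_ultrafilter obtain D :: "nat set set" where
    "(\<forall>A\<in>D. \<forall>B\<in>D. A \<inter> B \<in> D) \<and> (\<forall>A\<in>D. \<forall>B. A \<subseteq> B \<longrightarrow> B \<in> D) \<and>
     (\<forall>A. A \<in> D \<or> - A \<in> D) \<and> (\<forall>A\<in>D. infinite A)" by (elim exE)
  then have D: "\<And>A B. A \<in> D \<Longrightarrow> B \<in> D \<Longrightarrow> A \<inter> B \<in> D"
    "\<And>A B. A \<in> D \<Longrightarrow> A \<subseteq> B \<Longrightarrow> B \<in> D" "\<And>A. A \<in> D \<or> - A \<in> D" "\<And>A. A \<in> D \<Longrightarrow> infinite A"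
    by blast+
  have UNIV_D: "UNIV \<in> D" using D(2,3) by blast
  \<comment> \<open>The limit along \<open>D\<close> of the types of the \<open>a i\<close>. Members
    of \<open>D\<close> are infinite, hence nonempty, so every formula of \<open>p\<close> holds at
    some \<open>a i\<close>, and the \<open>a i\<close> have their entries in
    \<open>M\<close>.\<close>
  define p where "p = {\<psi> \<in> phi_formulas \<phi> (Dom U). {i. bsat U \<phi> (a i) \<psi>} \<in> D}"
  have a_insts: "a i \<in> insts" for i using ab(1)[of i] hull(2) by (auto simp: tuples_def)
  have "p \<in> phi_types U \<phi> (Dom U)"
    unfolding phi_types_def consistent_def
  proof (intro CollectI conjI allI impI ballI)
    show "p \<subseteq> phi_formulas \<phi> (Dom U)" by (auto simp: p_def)
    fix p0 assume "p0 \<subseteq> p" "finite p0"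
    have "{i. \<forall>\<psi>\<in>p0. bsat U \<phi> (a i) \<psi>} \<in> D"
      using \<open>finite p0\<close> \<open>p0 \<subseteq> p\<close>
    proof (induction p0 rule: finite_induct)
      case empty
      then show ?case using UNIV_D by simp
    next
      case (insert \<psi> p0)
      have "{i. \<forall>\<theta>\<in>insert \<psi> p0. bsat U \<phi> (a i) \<theta>} = {i. bsat U \<phi> (a i) \<psi>} \<inter> {i. \<forall>\<theta>\<in>p0. bsat U \<phi> (a i) \<theta>}"
        by auto
      then show ?case using insert by (auto simp: p_def intro!: D(1))
    qed
    then have "infinite {i. \<forall>\<psi>\<in>p0. bsat U \<phi> (a i) \<psi>}" by (rule D(4))
    then obtain i where "\<forall>\<psi>\<in>p0. bsat U \<phi> (a i) \<psi>" using not_finite_existsD by blast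
    then show "\<exists>a\<in>tuples (Dom U) (xlen \<phi>). \<forall>\<psi>\<in>p0. bsat U \<phi> a \<psi>" using ab(1) by blast
  next
    fix \<psi> assume \<psi>: "\<psi> \<in> phi_formulas \<phi> (Dom U)"
    have "{i. bsat U \<phi> (a i) (BNot \<psi>)} = - {i. bsat U \<phi> (a i) \<psi>}" by (auto simp: bsat_def)
    then show "\<psi> \<in> p \<or> BNot \<psi> \<in> p"
      using D(3)[of "{i. bsat U \<phi> (a i) \<psi>}"] \<psi> by (auto simp: p_def phi_formulas_def)
  qed
  moreover have "type_fin_sat U \<phi> M p"
    unfolding type_fin_sat_def
  proof
    fix \<psi> assume "\<psi> \<in> p"
    then have "infinite {i. bsat U \<phi> (a i) \<psi>}" using D(4) by (simp add: p_def)
    then obtain i where "bsat U \<phi> (a i) \<psi>" using not_finite_existsD by blast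
    then show "\<exists>c\<in>insts. bsat U \<phi> c \<psi>" using a_insts by blast
  qed
  moreover have "\<not> (fsigma_in closed_sets {b \<in> pts. Inst b \<in> p} \<and> fsigma_in closed_sets (pts - {b \<in> pts. Inst b \<in> p}))"
  proof
    assume fs: "fsigma_in closed_sets {b \<in> pts. Inst b \<in> p} \<and> fsigma_in closed_sets (pts - {b \<in> pts. Inst b \<in> p})"
    show False
    proof (rule ultrafilter_not_fsigma[where a = a and D = D and V = "{b \<in> pts. Inst b \<in> p}"])
      show "\<exists>c\<in>pts. \<forall>i. holds U \<phi> (a i) c \<longleftrightarrow> i \<in> E" for E using ab(2,3) by blast
      show "c \<in> {b \<in> pts. Inst b \<in> p} \<longleftrightarrow> {i. holds U \<phi> (a i) c} \<in> D" if "c \<in> pts" for c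
        using that by (simp add: p_def phi_formulas_def bsat_def)
    qed (use a_insts D fs in auto)
  qed
  ultimately show ?thesis using cm phi_setting_axioms by blast
qed

theorem theorem3p9:
  fixes L :: "('f, 'r) lang" and T :: "('f, 'r) fm set" and \<kappa> :: "'k rel"
    and U :: "('f, 'r, 'a) struc" and \<phi> :: "('f, 'r) pformula"
  assumes "complete_theory L T"
    and "monster_model L \<kappa> U" and "models L U T"
    and "is_pformula L \<phi>"
  shows "(NIP U \<phi> \<longrightarrow>
            fs_measures_baire_half_definable L T U \<phi> \<and> fs_types_strongly_borel_definable L T U \<phi>) \<and>
         (countable_language L \<longrightarrow>
            (NIP U \<phi> \<longleftrightarrow> fs_measures_baire_half_definable L T U \<phi>) \<and>
            (NIP U \<phi> \<longleftrightarrow> fs_types_strongly_borel_definable L T U \<phi>))"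
proof -
  have setting: "phi_setting L \<kappa> U \<phi> M" if "countable_model L T U M" for M
  proof
    show "M \<noteq> {}" using that by (auto simp: countable_model_def elem_substructure_def is_struc_def restr_def)
  qed (use that assms in \<open>auto simp: countable_model_def elem_substructure_def\<close>)
  have fwd: "fs_measures_baire_half_definable L T U \<phi> \<and> fs_types_strongly_borel_definable L T U \<phi>" if "NIP U \<phi>"
    unfolding fs_measures_baire_half_definable_def fs_types_strongly_borel_definable_def
  proof (intro conjI allI impI)
    fix \<mu> M assume "keisler_phi_measure U \<phi> \<mu>" "countable_model L T U M" "measure_fin_sat U \<phi> M \<mu>"
    then show "baire_half_definable U \<phi> M \<mu>"
      by (intro phi_setting.NIP_baire_half_definable[OF setting that])
  next
    fix p M assume "p \<in> phi_types U \<phi> (Dom U)" "countable_model L T U M" "type_fin_sat U \<phi> M p"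
    then show "strongly_borel_definable L U \<phi> M p"
      by (intro phi_setting.NIP_strongly_borel_definable[OF setting that])
  qed
  have bwd: "\<not> fs_measures_baire_half_definable L T U \<phi> \<and> \<not> fs_types_strongly_borel_definable L T U \<phi>"
    if cl: "countable_language L" and nip: "\<not> NIP U \<phi>"
  proof -
    have T: "T \<subseteq> sentences L" using assms(1) by (simp add: complete_theory_def)
    obtain M p where setM: "phi_setting L \<kappa> U \<phi> M" and cm: "countable_model L T U M"
      and p: "p \<in> phi_types U \<phi> (Dom U)" "type_fin_sat U \<phi> M p"
      and nf: "\<not> (fsigma_in (closed_over L U (ParVars \<phi>) M) {b \<in> tuples (Dom U) (ylen \<phi>). Inst b \<in> p} \<and>
        fsigma_in (closed_over L U (ParVars \<phi>) M)
         (tuples (Dom U) (ylen \<phi>) - {b \<in> tuples (Dom U) (ylen \<phi>). Inst b \<in> p}))"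
      using not_NIP_type[OF cl assms(2,4) T assms(3) nip] by (elim exE conjE) (rule that)
    interpret phi_setting L \<kappa> U \<phi> M by (rule setM)
    \<comment> \<open>The indicator of \<open>p\<close> is a measure that inherits finite
      satisfiability in \<open>M\<close>, so the type is a counterexample to the condition on
      measures as well.\<close>
    have "\<not> baire_half_definable U \<phi> M (\<lambda>\<psi>. of_bool (\<psi> \<in> p))"
      using baire_half_definable_fsigma nf by blast
    moreover have "\<not> strongly_borel_definable L U \<phi> M p"
      using boolean_combination_fsigma[OF cl] nf unfolding strongly_borel_definable_def by blast
    ultimately show ?thesis
      unfolding fs_measures_baire_half_definable_def fs_types_strongly_borel_definable_def
      using cm p type_keisler_measure[OF p(1)] type_measure_fin_sat[OF p(2)] by blast
  qed
  show ?thesis using fwd bwd by blast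
qed

end
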